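(* Let $1<\alpha<2$, $\frac12<\beta\le 1$, $T>0$. Let $\sigma_k$ and $\sigma_k^n$ ($k\ge 1$) be differentiable deterministic functions on $[0,T]$ such that for all $t\in[0,T]$ and all $k$ $$|\sigma_k(t)|\le\mu_k,\quad |\sigma_k'(t)|\le\gamma_k,\quad |\sigma_k(t)-\sigma_k^n(t)|\le\eta_k^n,\quad |\sigma_k^n(t)|\le\mu_k^n,\quad |(\sigma_k^n)'(t)|\le\gamma_k^n,$$ where $\{\mu_k\},\{\gamma_k\},\{\eta_k^n\},\{\mu_k^n\},\{\gamma_k^n\}$ are positive sequences. Let $u$ be the solution of the stochastic space-time fractional wave equation $\partial_t^\alpha u+(-\Delta)^\beta u=\frac{\partial^2W}{\partial t\partial x}$ and $u_n$ the solution of the regularized equation $\partial_t^\alpha u_n+(-\Delta)^\beta u_n=\frac{\partial^2W_n}{\partial t\partial x}$ (both on $(0,T)\times(0,1)$, with homogeneous Dirichlet boundary conditions and the same initial data $v_1,v_2$), as defined in the context. Then, provided that the infinite series on the right-hand sides below are all convergent, there is a constant $C>0$ independent of $\Delta t$ such that the following hold. (i) If $1<\alpha\le\frac32$, then for any $0<\varepsilon<\frac12$ (with $C$ allowed to depend on $\varepsilon$) and all $t\in(0,T]$, $$\mathbf{E}\|u(t)-u_n(t)\|^2\le C\sum_{k=1}^\infty\lambda_k^{-\frac{2\beta(\alpha-1)}{\alpha}}(\eta_k^n)^2+C(\Delta t)^2\sum_{k=1}^\infty\lambda_k^{-\frac{2\beta(\alpha-1)}{\alpha}}(\gamma_k^n)^2+Ct^{2\varepsilon}(\Delta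 t)^{2\alpha-1-2\varepsilon}\sum_{k=1}^\infty(\mu_k^n)^2 .$$ (ii) If $\frac32<\alpha<2$, then for all $t\in(0,T]$, $$\mathbf{E}\|u(t)-u_n(t)\|^2\le C\sum_{k=1}^\infty\lambda_k^{-\frac{2\beta(\alpha-1)}{\alpha}}(\eta_k^n)^2+C(\Delta t)^2\sum_{k=1}^\infty\lambda_k^{-\frac{2\beta(\alpha-1)}{\alpha}}(\gamma_k^n)^2+Ct^{2\alpha-3}(\Delta t)^{2}\sum_{k=1}^\infty(\mu_k^n)^2 .$$
   Context: $H=L^2(0,1)$ with inner product $(\cdot,\cdot)$ and norm $\|\cdot\|$. $\lambda_k=k^2\pi^2$ and $e_k(x)=\sqrt2\sin(k\pi x)$, $k\ge1$, are the Dirichlet eigenpairs of $-\Delta=-\frac{d^2}{dx^2}$ on $(0,1)$; $\{e_k\}$ is an orthonormal basis of $H$. The fractional Laplacian is $(-\Delta)^\beta u=\sum_k\lambda_k^\beta(u,e_k)e_k$. $\partial_t^\alpha$ is the left-sided Caputo derivative of order $\alpha$ in time with lower limit $0$. The Mittag-Leffler function is $E_{a,b}(z)=\sum_{k\ge0}\frac{z^k}{\Gamma(ak+b)}$. Noise: on a complete filtered probability space, $\xi_k$ ($k\ge1$) are standard real Wiener processes, and formally $\frac{\partial^2W}{\partial t\partial x}(t,x)=\sum_k\sigma_k(t)\dot\xi_k(t)e_k(x)$. Partition $[0,T]$ by $t_i=(i-1)\Delta t$, $i=1,\dots,I+1$, $\Delta t=T/I$. With $\chi_i$ the characteristic function of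 the $i$th subinterval $[t_i,t_{i+1})$ and $\xi_{ki}=\frac{1}{\sqrt{\Delta t}}(\xi_k(t_{i+1})-\xi_k(t_i))$, the regularized noise is $$\frac{\partial^2W_n}{\partial t\partial x}(t,x)=\sum_{k=1}^\infty\sigma_k^n(t)e_k(x)\sum_{i=1}^I\frac{1}{\sqrt{\Delta t}}\xi_{ki}\chi_i(t).$$ Solutions are mild solutions: with initial data $u(0)=v_1$, $\partial_tu(0)=v_2$ in $H$, $$u(t)=\sum_{k=1}^\infty\Big[E_{\alpha,1}(-\lambda_k^\beta t^\alpha)(v_1,e_k)+tE_{\alpha,2}(-\lambda_k^\beta t^\alpha)(v_2,e_k)+\int_0^t(t-s)^{\alpha-1}E_{\alpha,\alpha}(-\lambda_k^\beta(t-s)^\alpha)\sigma_k(s)\,d\xi_k(s)\Big]e_k$$ (Itô integrals), and $u_n(t)$ is given by the same formula with $\sigma_k(s)\,d\xi_k(s)$ replaced by $\sigma_k^n(s)\sum_{i=1}^I\frac{1}{\sqrt{\Delta t}}\xi_{ki}\chi_i(s)\,ds$. The constant $C$ may depend on $\alpha,\beta,T$. *)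

theory Defs
  imports "HOL-Probability.Probability"
begin

section \<open>The space \<open>L\<^sup>2(0,1)\<close> and the Dirichlet eigenpairs\<close>

text \<open>
  Elements of \<open>H = L\<^sup>2(0,1)\<close> are represented by square-integrable functions; two functions
  represent the same element iff their difference has \<open>L2_norm01\<close> equal to 0. Values outside
  \<open>(0,1)\<close> are irrelevant.
\<close>

definition L2_01 :: "(real \<Rightarrow> real) set" where
  "L2_01 = {h. h \<in> borel_measurable (lebesgue_on {0<..<1}) \<and>
               integrable (lebesgue_on {0<..<1}) (\<lambda>x. (h x)\<^sup>2)}"

definition L2_inner01 :: "(real \<Rightarrow> real) \<Rightarrow> (real \<Rightarrow> real) \<Rightarrow> real" where
  "L2_inner01 g h = integral\<^sup>L (lebesgue_on {0<..<1}) (\<lambda>x. g x * h x)"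

definition L2_norm01 :: "(real \<Rightarrow> real) \<Rightarrow> real" where
  "L2_norm01 h = sqrt (L2_inner01 h h)"

definition eigval :: "nat \<Rightarrow> real" where
  "eigval k = (real k)\<^sup>2 * pi\<^sup>2"

definition eigfun :: "nat \<Rightarrow> real \<Rightarrow> real" where
  "eigfun k x = sqrt 2 * sin (real k * pi * x)"

text \<open>\<open>h = (\<Sum>k\<ge>1. c k *\<^sub>R eigfun k)\<close>, with convergence in \<open>H\<close>.\<close>

definition L2_expansion :: "(nat \<Rightarrow> real) \<Rightarrow> (real \<Rightarrow> real) \<Rightarrow> bool" where
  "L2_expansion c h \<longleftrightarrow> h \<in> L2_01 \<and>
     (\<lambda>N. L2_norm01 (\<lambda>x. h x - (\<Sum>k = 1..N. c k * eigfun k x))) \<longlonglongrightarrow> 0"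

definition mittag_leffler :: "real \<Rightarrow> real \<Rightarrow> real \<Rightarrow> real" where
  "mittag_leffler a b z = (\<Sum>k. z ^ k / Gamma (a * real k + b))"


section \<open>Wiener processes and the It\^o integral\<close>

text \<open>
  Time is the half-line \<open>t \<ge> 0\<close>. The library's filtrations are indexed by a whole type, here
  \<open>real\<close>; this costs no generality, as one may put \<open>F t = F 0\<close> for \<open>t < 0\<close>.
\<close>

definition complete_filtered_prob_space :: "'a measure \<Rightarrow> (real \<Rightarrow> 'a measure) \<Rightarrow> bool" where
  "complete_filtered_prob_space M F \<longleftrightarrow>
     prob_space M \<and> complete_measure M \<and> filtration (space M) F \<and>
     (\<forall>t. subalgebra M (F t)) \<and> (\<forall>t\<ge>0. null_sets M \<subseteq> sets (F t))"

definition wiener_process ::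
  "'a measure \<Rightarrow> (real \<Rightarrow> 'a measure) \<Rightarrow> (real \<Rightarrow> 'a \<Rightarrow> real) \<Rightarrow> bool" where
  "wiener_process M F W \<longleftrightarrow>
     (AE \<omega> in M. W 0 \<omega> = 0) \<and>
     (AE \<omega> in M. continuous_on {0..} (\<lambda>t. W t \<omega>)) \<and>
     (\<forall>t\<ge>0. W t \<in> borel_measurable (F t)) \<and>
     (\<forall>s t. 0 \<le> s \<and> s < t \<longrightarrow>
        distributed M lborel (\<lambda>\<omega>. W t \<omega> - W s \<omega>)
          (\<lambda>x. ennreal (normal_density 0 (sqrt (t - s)) x)) \<and>
        prob_space.indep_set M (sets (F s))
          {(\<lambda>\<omega>. W t \<omega> - W s \<omega>) -` A \<inter> space M | A. A \<in> sets borel})"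

text \<open>
  Elementary processes on \<open>[0,t]\<close>: the triple \<open>(m, \<tau>, h)\<close> stands for
  \<open>\<Sum>j<m. h\<^sub>j 1\<^bsub>(\<tau>\<^sub>j, \<tau>\<^sub>j\<^sub>+\<^sub>1]\<^esub>\<close> with \<open>h\<^sub>j\<close> bounded and
  \<open>F (\<tau>\<^sub>j)\<close>-measurable.
\<close>

definition elementary_data ::
  "'a measure \<Rightarrow> (real \<Rightarrow> 'a measure) \<Rightarrow> real \<Rightarrow> nat \<Rightarrow> (nat \<Rightarrow> real) \<Rightarrow>
   (nat \<Rightarrow> 'a \<Rightarrow> real) \<Rightarrow> bool" where
  "elementary_data M F t m \<tau> h \<longleftrightarrow>
     0 \<le> \<tau> 0 \<and> (\<forall>j<m. \<tau> j < \<tau> (Suc j)) \<and> \<tau> m \<le> t \<and>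
     (\<forall>j<m. h j \<in> borel_measurable (F (\<tau> j)) \<and> (\<exists>B. \<forall>\<omega>\<in>space M. \<bar>h j \<omega>\<bar> \<le> B))"

definition elementary_process ::
  "nat \<Rightarrow> (nat \<Rightarrow> real) \<Rightarrow> (nat \<Rightarrow> 'a \<Rightarrow> real) \<Rightarrow> real \<Rightarrow> 'a \<Rightarrow> real" where
  "elementary_process m \<tau> h s \<omega> = (\<Sum>j<m. h j \<omega> * indicator {\<tau> j <.. \<tau> (Suc j)} s)"

definition elementary_integral ::
  "nat \<Rightarrow> (nat \<Rightarrow> real) \<Rightarrow> (nat \<Rightarrow> 'a \<Rightarrow> real) \<Rightarrow> (real \<Rightarrow> 'a \<Rightarrow> real) \<Rightarrow> 'a \<Rightarrow> real" where
  "elementary_integral m \<tau> h W \<omega> = (\<Sum>j<m. h j \<omega> * (W (\<tau> (Suc j)) \<omega> - W (\<tau> j) \<omega>))"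

text \<open>
  \<open>X\<close> is (a version of) the It\^o integral \<open>\<integral>\<^sub>0\<^sup>t \<phi>(s) dW(s)\<close>: the mean-square limit of
  the integrals of elementary processes converging to \<open>\<phi>\<close> in \<open>L\<^sup>2([0,t] \<times> \<Omega>)\<close>.
\<close>

definition has_ito_integral ::
  "'a measure \<Rightarrow> (real \<Rightarrow> 'a measure) \<Rightarrow> (real \<Rightarrow> 'a \<Rightarrow> real) \<Rightarrow> real \<Rightarrow>
   (real \<Rightarrow> 'a \<Rightarrow> real) \<Rightarrow> ('a \<Rightarrow> real) \<Rightarrow> bool" where
  "has_ito_integral M F W t \<phi> X \<longleftrightarrow>
     X \<in> borel_measurable M \<and>
     (\<lambda>(s, \<omega>). indicator {0..t} s * \<phi> s \<omega>) \<in> borel_measurable (lborel \<Otimes>\<^sub>M M) \<and>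
     (\<exists>m \<tau> h. (\<forall>n. elementary_data M F t (m n) (\<tau> n) (h n)) \<and>
        (\<lambda>n. \<integral>\<^sup>+ \<omega>. (\<integral>\<^sup>+ s. ennreal ((\<phi> s \<omega> - elementary_process (m n) (\<tau> n) (h n) s \<omega>)\<^sup>2)
                 * indicator {0..t} s \<partial>lborel) \<partial>M) \<longlonglongrightarrow> 0 \<and>
        (\<lambda>n. \<integral>\<^sup>+ \<omega>. ennreal ((X \<omega> - elementary_integral (m n) (\<tau> n) (h n) W \<omega>)\<^sup>2) \<partial>M)
           \<longlonglongrightarrow> 0)"


section \<open>The noise and the mild solutions\<close>

text \<open>The one-sided derivatives are meant at the endpoints of \<open>[0,T]\<close>.\<close>

definition noise_coefficients ::
  "real \<Rightarrow> (nat \<Rightarrow> real \<Rightarrow> real) \<Rightarrow> (nat \<Rightarrow> real \<Rightarrow> real) \<Rightarrow> (nat \<Rightarrow> real) \<Rightarrow> (nat \<Rightarrow> real) \<Rightarrow>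
   (nat \<Rightarrow> real) \<Rightarrow> (nat \<Rightarrow> real) \<Rightarrow> (nat \<Rightarrow> real) \<Rightarrow> bool" where
  "noise_coefficients T \<sigma> \<sigma>n \<mu> \<gamma> \<eta>n \<mu>n \<gamma>n \<longleftrightarrow>
     (\<forall>k\<ge>1. \<mu> k > 0 \<and> \<gamma> k > 0 \<and> \<eta>n k > 0 \<and> \<mu>n k > 0 \<and> \<gamma>n k > 0) \<and>
     (\<forall>k\<ge>1. \<forall>t\<in>{0..T}.
        \<bar>\<sigma> k t\<bar> \<le> \<mu> k \<and>
        (\<exists>d. (\<sigma> k has_real_derivative d) (at t within {0..T}) \<and> \<bar>d\<bar> \<le> \<gamma> k) \<and>
        \<bar>\<sigma> k t - \<sigma>n k t\<bar> \<le> \<eta>n k \<and>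
        \<bar>\<sigma>n k t\<bar> \<le> \<mu>n k \<and>
        (\<exists>d. (\<sigma>n k has_real_derivative d) (at t within {0..T}) \<and> \<bar>d\<bar> \<le> \<gamma>n k))"

definition grid :: "real \<Rightarrow> nat \<Rightarrow> nat \<Rightarrow> real" where
  "grid T I i = (real i - 1) * (T / real I)"

definition scaled_increment ::
  "real \<Rightarrow> nat \<Rightarrow> (nat \<Rightarrow> real \<Rightarrow> 'a \<Rightarrow> real) \<Rightarrow> nat \<Rightarrow> nat \<Rightarrow> 'a \<Rightarrow> real" where
  "scaled_increment T I \<xi> k i \<omega> =
     1 / sqrt (T / real I) * (\<xi> k (grid T I (Suc i)) \<omega> - \<xi> k (grid T I i) \<omega>)"

text \<open>The piecewise constant substitute for \<open>d\<xi>\<^sub>k/dt\<close>.\<close>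

definition regularized_white_noise ::
  "real \<Rightarrow> nat \<Rightarrow> (nat \<Rightarrow> real \<Rightarrow> 'a \<Rightarrow> real) \<Rightarrow> nat \<Rightarrow> real \<Rightarrow> 'a \<Rightarrow> real" where
  "regularized_white_noise T I \<xi> k s \<omega> =
     (\<Sum>i = 1..I. 1 / sqrt (T / real I) * scaled_increment T I \<xi> k i \<omega>
                  * indicator {grid T I i ..< grid T I (Suc i)} s)"

definition mild_initial ::
  "real \<Rightarrow> real \<Rightarrow> (real \<Rightarrow> real) \<Rightarrow> (real \<Rightarrow> real) \<Rightarrow> real \<Rightarrow> nat \<Rightarrow> real" where
  "mild_initial \<alpha> \<beta> v1 v2 t k =
     mittag_leffler \<alpha> 1 (- (eigval k powr \<beta> * t powr \<alpha>)) * L2_inner01 v1 (eigfun k) +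
     t * mittag_leffler \<alpha> 2 (- (eigval k powr \<beta> * t powr \<alpha>)) * L2_inner01 v2 (eigfun k)"

definition mild_kernel :: "real \<Rightarrow> real \<Rightarrow> nat \<Rightarrow> real \<Rightarrow> real" where
  "mild_kernel \<alpha> \<beta> k r =
     r powr (\<alpha> - 1) * mittag_leffler \<alpha> \<alpha> (- (eigval k powr \<beta> * r powr \<alpha>))"

text \<open>
  Mild solutions on \<open>[0,T]\<close>; the series over the eigenfunctions converges in \<open>H\<close> almost surely.
  \<open>u t \<omega>\<close> is a representative of the value of the solution in \<open>H\<close>.
\<close>

definition mild_solution ::
  "'a measure \<Rightarrow> (real \<Rightarrow> 'a measure) \<Rightarrow> (nat \<Rightarrow> real \<Rightarrow> 'a \<Rightarrow> real) \<Rightarrow> real \<Rightarrow> real \<Rightarrow> real \<Rightarrow>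
   (nat \<Rightarrow> real \<Rightarrow> real) \<Rightarrow> (real \<Rightarrow> real) \<Rightarrow> (real \<Rightarrow> real) \<Rightarrow>
   (real \<Rightarrow> 'a \<Rightarrow> real \<Rightarrow> real) \<Rightarrow> bool" where
  "mild_solution M F \<xi> \<alpha> \<beta> T \<sigma> v1 v2 u \<longleftrightarrow>
     (\<forall>t\<in>{0..T}. \<exists>J.
        (\<forall>k\<ge>1. has_ito_integral M F (\<xi> k) t (\<lambda>s \<omega>. mild_kernel \<alpha> \<beta> k (t - s) * \<sigma> k s) (J k)) \<and>
        (AE \<omega> in M. L2_expansion (\<lambda>k. mild_initial \<alpha> \<beta> v1 v2 t k + J k \<omega>) (u t \<omega>)))"

definition regularized_mild_solution ::
  "'a measure \<Rightarrow> (nat \<Rightarrow> real \<Rightarrow> 'a \<Rightarrow> real) \<Rightarrow> real \<Rightarrow> real \<Rightarrow> real \<Rightarrow> nat \<Rightarrow>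
   (nat \<Rightarrow> real \<Rightarrow> real) \<Rightarrow> (real \<Rightarrow> real) \<Rightarrow> (real \<Rightarrow> real) \<Rightarrow>
   (real \<Rightarrow> 'a \<Rightarrow> real \<Rightarrow> real) \<Rightarrow> bool" where
  "regularized_mild_solution M \<xi> \<alpha> \<beta> T I \<sigma>n v1 v2 un \<longleftrightarrow>
     (\<forall>t\<in>{0..T}. AE \<omega> in M.
        L2_expansion
          (\<lambda>k. mild_initial \<alpha> \<beta> v1 v2 t k +
               (LBINT s:{0..t}. mild_kernel \<alpha> \<beta> k (t - s) * \<sigma>n k s
                                * regularized_white_noise T I \<xi> k s \<omega>))
          (un t \<omega>))"

end

theory Submission
  imports Defs "HOL-Complex_Analysis.Cauchy_Integral_Theorem" "HOL-Real_Asymp.Real_Asymp"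
begin

text \<open>
  By Parseval the error is the sum over the modes \<open>k\<close> of the mean squares of
  \<open>\<integral> (g\<^sub>k(t - s) \<sigma>\<^sub>k(s)) d\<xi>\<^sub>k(s)\<close> minus the same integral with
  \<open>g\<^sub>k(t - s) \<sigma>\<^sub>k\<^sup>n(s)\<close>, extended by zero beyond \<open>t\<close>, replaced by its averages over the grid cells.
  The It\^o isometry turns each of these into a deterministic \<open>L\<^sup>2\<close> distance. As a cell average is the
  best constant in \<open>L\<^sup>2\<close>, it may be replaced by the value at the left endpoint of the cell.

  Everything then follows from two bounds that are uniform in \<open>k\<close>:
  \<open>\<bar>g\<^sub>k\<bar> \<le> C \<lambda>\<^sub>k\<^bsup>-\<beta>(\<alpha>-1)/\<alpha>\<^esup>\<close> and
  \<open>\<bar>g\<^sub>k(r) - g\<^sub>k(s)\<bar> \<le> C (r\<^bsup>\<alpha>-1\<^esup> - s\<^bsup>\<alpha>-1\<^esup>)\<close> for \<open>s \<le> r\<close>.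
  They express that \<open>x\<^bsup>(\<alpha>-1)/\<alpha>\<^esup> E\<^bsub>\<alpha>,\<alpha>\<^esub>(-x)\<close> and
  \<open>E\<^bsub>\<alpha>,\<alpha>-1\<^esub>(-x)\<close> are bounded for \<open>x > 0\<close>. For \<open>1 < \<alpha> < 2\<close> this is read off the integral of
  \<open>e\<^sup>s s\<^bsup>\<alpha>-b\<^esup> / (s\<^sup>\<alpha> + x)\<close> along the rays \<open>arg s = \<plusminus>\<theta>\<close> with \<open>\<pi>/2 < \<theta> < \<pi>/\<alpha>\<close>, which
  lie between the imaginary axis and the poles.
\<close>

text \<open>For 1 < \<alpha> < 2 the function E_{\<alpha>,\<alpha>}(-x) changes sign, which rules
  out positivity and monotonicity arguments for the kernels; hence the contour. It yields bounds for
  the partial sums of the series, of the form constant plus \<open>(1/2)^N * B\<close>, where only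
  \<open>B\<close> depends on the compact part of the contour. Letting N grow gives the bounds for
  the functions; the same bounds also give convergence of the series.

  The second kernel bound has no power of \<lambda>_k because g_k has derivative r^(\<alpha>-2)
  E_{\<alpha>,\<alpha>-1}(-\<lambda>_k^\<beta> r^\<alpha>), which is at most K r^(\<alpha>-2) in
  modulus. This is why the series of the \<mu>_k^n carries no weight.

  Both cases of the theorem are instances of one estimate with the factor t^q
  (\<Delta>t)^(2\<alpha>-1-q), where 0 < q < 1 and 2\<alpha>-3 \<le> q: q = 2\<epsilon> in the
  first, q = 2\<alpha>-3 in the second. For q \<le> \<alpha>-1 it arises by bounding a squared
  increment of r^(\<alpha>-1) over a cell by a constant times (\<Delta>t)^(2\<alpha>-2-q) times the
  increment of r^q; the remaining factor \<Delta>t is the length of the cell.\<close>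

section \<open>Hankel's integral for the reciprocal Gamma function\<close>

text \<open>
  The integrand \<open>e\<^sup>s s\<^bsup>-b\<^esup> ds\<close> after the substitution \<open>s = e\<^sup>w\<close>, which makes it entire and turns rays into
  horizontal lines. Contour integrals are expressed as increments of primitives; by symmetry the
  full integral is \<open>2 \<i>\<close> times the imaginary part of that over the upper half of the contour.
\<close>

definition hankel_integrand :: "real \<Rightarrow> complex \<Rightarrow> complex" where
  "hankel_integrand b w = exp (exp w + (1 - of_real b) * w)"

lemma norm_hankel_integrand:
  "norm (hankel_integrand b (Complex v \<phi>)) = exp (exp v * cos \<phi> + (1 - b) * v)"
  by (simp add: hankel_integrand_def norm_exp_eq_Re Re_exp)

lemma hankel_integrand_has_primitive:
  obtains P where "\<And>w. (P has_field_derivative hankel_integrand b w) (at w)"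
proof -
  have "hankel_integrand b holomorphic_on UNIV"
    unfolding hankel_integrand_def by (intro holomorphic_intros)
  from holomorphic_convex_primitive'[OF convex_UNIV open_UNIV this] that show ?thesis
    by auto
qed

section \<open>Increments of primitives along horizontal and vertical lines\<close>

lemma has_vector_derivative_along_line:
  assumes "(P has_field_derivative D) (at (z + c * of_real s))"
  shows "((\<lambda>s. P (z + c * of_real s)) has_vector_derivative (c * D)) (at s within S)"
proof -
  have "((\<lambda>s. z + c * of_real s) has_vector_derivative c) (at s within S)"
    by (auto intro!: derivative_eq_intros)
  moreover have "(P has_field_derivative D) (at (z + c * of_real s) within (\<lambda>s. z + c * of_real s) ` S)"
    using assms by (rule has_field_derivative_at_within)
  ultimately show ?thesis
    using field_vector_diff_chain_within[of "\<lambda>s. z + c * of_real s" c s S P D] by (simp add: o_def)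
qed

lemma has_vector_derivative_vertical:
  assumes "(P has_field_derivative D) (at (Complex v s))"
  shows "((\<lambda>s. P (Complex v s)) has_vector_derivative (\<i> * D)) (at s within S)"
  using has_vector_derivative_along_line[of P D "of_real v" \<i> s S] assms by (simp add: Complex_eq)

lemma has_vector_derivative_horizontal:
  assumes "(P has_field_derivative D) (at (Complex s \<theta>))"
  shows "((\<lambda>s. P (Complex s \<theta>)) has_vector_derivative D) (at s within S)"
  using has_vector_derivative_along_line[of P D "\<i> * of_real \<theta>" 1 s S] assms
  by (simp add: Complex_eq add.commute)

lemma norm_vertical_increment_le:
  assumes "\<And>\<phi>. \<phi> \<in> {c..d} \<Longrightarrow> (P has_field_derivative f (Complex v \<phi>)) (at (Complex v \<phi>))"
    and "\<And>\<phi>. \<phi> \<in> {c..d} \<Longrightarrow> norm (f (Complex v \<phi>)) \<le> B" and "c \<le> d"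
  shows "norm (P (Complex v d) - P (Complex v c)) \<le> B * (d - c)"
proof -
  have "norm (P (Complex v d) - P (Complex v c)) \<le> B * norm (d - c)"
  proof (rule differentiable_bound)
    fix s assume s: "s \<in> {c..d}"
    show "((\<lambda>s. P (Complex v s)) has_derivative (\<lambda>h. h *\<^sub>R (\<i> * f (Complex v s)))) (at s within {c..d})"
      using has_vector_derivative_vertical[OF assms(1)[OF s]] unfolding has_vector_derivative_def .
    show "onorm (\<lambda>h. h *\<^sub>R (\<i> * f (Complex v s))) \<le> B"
      using assms(2)[OF s]
      by (intro onorm_le) (simp add: norm_mult mult.commute[of B] mult_left_mono)
  qed (use assms(3) in auto)
  then show ?thesis using assms(3) by simp
qed

text \<open>Moving the start of the upper half contour along the real axis, where the integrand is
  real, changes the integral by a real number only. So the starting points \<open>0\<close>,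
  \<open>\<rho>\<close> and points far to the left are interchangeable when imaginary parts are
  taken.\<close>

lemma Im_primitive_real_axis:
  assumes "\<And>v. v \<in> closed_segment a b \<Longrightarrow> (P has_field_derivative f (of_real v)) (at (of_real v))"
    and "\<And>v. v \<in> closed_segment a b \<Longrightarrow> f (of_real v) \<in> \<real>"
  shows "Im (P (of_real b)) = Im (P (of_real a))"
proof -
  have "norm (Im (P (of_real b)) - Im (P (of_real a))) \<le> 0 * norm (b - a)"
  proof (rule differentiable_bound)
    fix v assume v: "v \<in> closed_segment a b"
    have "((\<lambda>s. P (of_real s)) has_vector_derivative f (of_real v)) (at v within closed_segment a b)"
      using has_vector_derivative_along_line[of P "f (of_real v)" 0 1 v] assms(1)[OF v] by simp
    from bounded_linear.has_vector_derivative[OF bounded_linear_Im this]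
    show "((\<lambda>s. Im (P (of_real s))) has_derivative (\<lambda>h. h *\<^sub>R 0)) (at v within closed_segment a b)"
      using assms(2)[OF v] unfolding has_vector_derivative_def by (simp add: complex_is_Real_iff)
    show "onorm (\<lambda>h. h *\<^sub>R (0::real)) \<le> 0" by (simp add: onorm_zero)
  qed auto
  then show ?thesis by simp
qed

lemma hankel_integrand_real: "hankel_integrand b (of_real v) \<in> \<real>"
proof -
  have "hankel_integrand b (of_real v) = of_real (exp (exp v + (1 - b) * v))"
    by (simp add: hankel_integrand_def flip: exp_of_real)
  then show ?thesis by simp
qed

text \<open>The truncation is symmetric in \<open>ln t\<close>: its ends correspond to the abscissas
  \<open>- ln (n + 1)\<close> and \<open>ln (n + 1)\<close> on the line \<open>Im w = pi\<close>,
  between which the increments of the primitive are taken.\<close>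

lemma Gamma_truncated_integral_tendsto:
  assumes "x > (0::real)"
  shows "(\<lambda>n. integral {1 / real (Suc n)..real (Suc n)} (\<lambda>t. t powr (x - 1) / exp t)) \<longlonglongrightarrow> Gamma x"
proof -
  let ?f = "\<lambda>t. t powr (x - 1) / exp t"
  let ?S = "\<lambda>n. {1 / real (Suc n)..real (Suc n)}"
  have G: "(?f has_integral Gamma x) {0..}" by (rule Gamma_integral_real[OF assms])
  have sub: "?S n \<subseteq> {0..}" for n by (auto intro: order_trans[rotated])
  have int: "?f integrable_on ?S n" for n
    by (rule integrable_continuous_interval) (auto intro!: continuous_intros simp: field_simps)
  have "(\<lambda>n. integral {0..} (\<lambda>t. if t \<in> ?S n then ?f t else 0)) \<longlonglongrightarrow> integral {0..} ?f"
  proof (rule dominated_convergence(2))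
    show "(\<lambda>t. if t \<in> ?S n then ?f t else 0) integrable_on {0..}" for n
      using int[of n] integrable_restrict_Int[of "?S n" ?f "{0..}"] sub[of n] by (simp add: inf.absorb1)
    show "?f integrable_on {0..}" using G by blast
    fix t :: real assume t: "t \<in> {0..}"
    show "(\<lambda>n. if t \<in> ?S n then ?f t else 0) \<longlonglongrightarrow> ?f t"
    \<comment> \<open>At \<open>t = 0\<close> both sides are \<open>0\<close>, because
      \<open>0 powr y = 0\<close>.\<close>
    proof (cases "t = 0")
      case False
      with t have "t > 0" by simp
      obtain N where "real N > max t (1 / t)" using reals_Archimedean2 by blast
      then have N: "real N > t" "real N > 1 / t" by auto
      have "t \<in> ?S n" if "n \<ge> N" for n
      proof -
        have "1 / t < real (Suc n)" "t < real (Suc n)" using N that by linarith+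
        then show ?thesis using \<open>t > 0\<close> by (simp add: field_simps)
      qed
      then have "eventually (\<lambda>n. (if t \<in> ?S n then ?f t else 0) = ?f t) sequentially"
        by (intro eventually_sequentiallyI[of N]) simp
      then show ?thesis by (rule tendsto_eventually)
    qed (auto intro!: tendsto_eventually)
  qed auto
  moreover have "integral {0..} (\<lambda>t. if t \<in> ?S n then ?f t else 0) = integral (?S n) ?f" for n
    using sub[of n] integral_restrict_Int[of "{0..}" "?S n" ?f] by (simp add: inf.absorb2 inf.absorb1)
  moreover have "integral {0..} ?f = Gamma x" using G by blast
  ultimately show ?thesis by simp
qed

lemma exp_exp_decay:
  assumes "c > (0::real)"
  shows "((\<lambda>v. exp (- c * exp v + m * v)) \<longlongrightarrow> 0) at_top"
proof -
  have "filterlim (\<lambda>v::real. - c * exp v + m * v) at_bot at_top"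
    using assms by real_asymp
  then show ?thesis by (rule filterlim_compose[OF exp_at_bot])
qed

lemma exp_exp_decay_at_bot:
  assumes "m > (0::real)"
  shows "((\<lambda>v. exp (exp v + m * v) * C) \<longlongrightarrow> 0) at_bot"
proof -
  have "((\<lambda>v. exp (exp v + m * v)) \<longlongrightarrow> 0) at_bot" using assms by real_asymp
  from tendsto_mult_left_zero[OF this] show ?thesis .
qed

text \<open>On the ray \<open>arg s = \<pi>\<close> the integral is Euler's, and reflection gives the value for \<open>b < 1\<close>.
  At \<open>b = 1\<close> the ray contributes nothing; the value \<open>\<pi>\<close> comes from the half circle around the origin.\<close>

lemma tendsto_Im_primitive_pi:
  assumes b: "0 < b" "b \<le> 1" and P: "\<And>w. (P has_field_derivative hankel_integrand b w) (at w)"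
  shows "(\<lambda>n. Im (P (Complex (ln (real (Suc n))) pi) - P 0)) \<longlonglongrightarrow> pi / Gamma b"
proof -
  \<comment> \<open>The point \<open>Complex (ln r) pi\<close> is mapped to \<open>- r\<close> by
    \<open>exp\<close>, so the derivative of \<open>p\<close> is a multiple of Euler's integrand in
    \<open>r\<close>.\<close>
  define p where "p r = Im (P (Complex (ln r) pi))" for r
  define L :: "nat \<Rightarrow> real" where "L n = - ln (real (Suc n))" for n
  have L: "filterlim L at_bot sequentially" unfolding L_def by real_asymp
  have real: "Im (P (of_real v)) = Im (P 0)" for v
    using Im_primitive_real_axis[of 0 v P "hankel_integrand b"] P by (simp add: hankel_integrand_real)
  have der: "(p has_real_derivative sin (pi * (1 - b)) * (r powr ((1 - b) - 1) / exp r)) (at r within S)"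
    if "r > 0" for r S
  proof -
    have "((\<lambda>v. P (Complex v pi)) has_vector_derivative hankel_integrand b (Complex (ln r) pi)) (at (ln r))"
      by (rule has_vector_derivative_horizontal[OF P])
    from bounded_linear.has_vector_derivative[OF bounded_linear_Im this]
    have "((\<lambda>v. Im (P (Complex v pi))) has_real_derivative Im (hankel_integrand b (Complex (ln r) pi))) (at (ln r))"
      by (simp add: has_real_derivative_iff_has_vector_derivative)
    from DERIV_chain2[OF this DERIV_ln[OF that]]
    have "(p has_real_derivative Im (hankel_integrand b (Complex (ln r) pi)) * inverse r) (at r)"
      unfolding p_def .
    moreover have "Im (hankel_integrand b (Complex (ln r) pi)) * inverse r
        = sin (pi * (1 - b)) * (r powr ((1 - b) - 1) / exp r)"
    proof -
      have "exp (Complex (ln r) pi) + (1 - of_real b) * Complex (ln r) pi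
          = Complex (- r + (1 - b) * ln r) (pi * (1 - b))"
        using that by (simp add: complex_eq_iff Re_exp Im_exp algebra_simps)
      then have "Im (hankel_integrand b (Complex (ln r) pi)) = exp (- r + (1 - b) * ln r) * sin (pi * (1 - b))"
        by (simp add: hankel_integrand_def Im_exp)
      moreover have e: "exp (- r + (1 - b) * ln r) * inverse r = r powr ((1 - b) - 1) / exp r"
        using that by (simp add: powr_def exp_add exp_diff exp_minus left_diff_distrib field_simps)
      ultimately show ?thesis unfolding e[symmetric] by (simp only: ac_simps)
    qed
    ultimately show ?thesis by (simp add: has_field_derivative_at_within)
  qed
  have FTC: "p (real (Suc n)) - p (1 / real (Suc n))
      = sin (pi * (1 - b)) * integral {1 / real (Suc n)..real (Suc n)} (\<lambda>t. t powr ((1 - b) - 1) / exp t)" for n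
  proof -
    have pos: "0 < r" if "r \<in> {1 / real (Suc n)..real (Suc n)}" for r
      using that less_le_trans[of 0 "1 / real (Suc n)" r] by simp
    have "((\<lambda>t. sin (pi * (1 - b)) * (t powr ((1 - b) - 1) / exp t)) has_integral
        p (real (Suc n)) - p (1 / real (Suc n))) {1 / real (Suc n)..real (Suc n)}"
    proof (rule fundamental_theorem_of_calculus)
      show "1 / real (Suc n) \<le> real (Suc n)" by (simp add: divide_le_eq algebra_simps)
    next
      fix t assume "t \<in> {1 / real (Suc n)..real (Suc n)}"
      from der[OF pos[OF this]]
      show "(p has_vector_derivative sin (pi * (1 - b)) * (t powr ((1 - b) - 1) / exp t))
          (at t within {1 / real (Suc n)..real (Suc n)})"
        unfolding has_real_derivative_iff_has_vector_derivative .
    qed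
    then show ?thesis by (metis integral_unique integral_mult_right)
  qed
  have refl: "sin (pi * (1 - b)) * Gamma (1 - b) = pi / Gamma b" if "b < 1"
  proof -
    have "Gamma (complex_of_real b) * Gamma (complex_of_real (1 - b))
        = complex_of_real pi / sin (complex_of_real (pi * b))"
      using Gamma_reflection_complex[of "of_real b"] by simp
    then have "complex_of_real (Gamma b * Gamma (1 - b)) = complex_of_real (pi / sin (pi * b))"
      unfolding Gamma_complex_of_real sin_of_real by (simp only: of_real_mult of_real_divide)
    then have "Gamma b * Gamma (1 - b) = pi / sin (pi * b)" using of_real_eq_iff by blast
    moreover have "sin (pi * (1 - b)) = sin (pi * b)"
      using sin_pi_minus[of "pi * b"] by (simp add: right_diff_distrib)
    moreover have "sin (pi * b) > 0" using b that by (intro sin_gt_zero) auto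
    moreover have "Gamma b > 0" using b by simp
    ultimately show ?thesis by (simp add: field_simps)
  qed
  have A: "(\<lambda>n. p (real (Suc n)) - p (1 / real (Suc n))) \<longlonglongrightarrow> (if b < 1 then pi / Gamma b else 0)"
  proof (cases "b < 1")
    case True
    have "(\<lambda>n. sin (pi * (1 - b)) * integral {1 / real (Suc n)..real (Suc n)} (\<lambda>t. t powr ((1 - b) - 1) / exp t))
       \<longlonglongrightarrow> sin (pi * (1 - b)) * Gamma (1 - b)"
      using True by (intro tendsto_mult tendsto_const Gamma_truncated_integral_tendsto) simp
    then show ?thesis using True refl[OF True] unfolding FTC by simp
  next
    case False
    then show ?thesis using b unfolding FTC by simp
  qed
  have B: "(\<lambda>n. p (1 / real (Suc n)) - Im (P 0)) \<longlonglongrightarrow> (if b < 1 then 0 else pi)"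
  proof -
    have eq: "p (1 / real (Suc n)) - Im (P 0) = Im (P (Complex (L n) pi) - P (Complex (L n) 0))" for n
      using real[of "L n"] by (simp add: p_def L_def ln_div Complex_eq)
    show ?thesis
    proof (cases "b < 1")
      case True
      \<comment> \<open>The half circle has radius \<open>exp v\<close>; for \<open>b < 1\<close>
        its contribution is of order \<open>exp ((1 - b) * v)\<close> and dies out.\<close>
      have bd: "norm (P (Complex v pi) - P (Complex v 0)) \<le> exp (exp v + (1 - b) * v) * (pi - 0)" for v
        by (rule norm_vertical_increment_le[OF P])
           (auto simp: norm_hankel_integrand intro: order_trans[OF mult_left_mono[OF cos_le_one]])
      have "((\<lambda>v. exp (exp v + (1 - b) * v) * (pi - 0)) \<longlongrightarrow> 0) at_bot"
        using True exp_exp_decay_at_bot[of "1 - b" "pi - 0"] by simp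
      then have "(\<lambda>n. exp (exp (L n) + (1 - b) * L n) * (pi - 0)) \<longlonglongrightarrow> 0"
        using L by (rule filterlim_compose)
      then have "(\<lambda>n. P (Complex (L n) pi) - P (Complex (L n) 0)) \<longlonglongrightarrow> 0"
        by (rule Lim_null_comparison[rotated]) (use bd in auto)
      from tendsto_Im[OF this] show ?thesis using True unfolding eq by simp
    next
      case False
      then have b1: "b = 1" using b by simp
      \<comment> \<open>At \<open>b = 1\<close> the integrand tends to \<open>1\<close> far to the
        left. Subtracting the primitive \<open>w\<close> of this limit removes exactly the part of
        the half circle that survives, namely \<open>pi\<close> in the imaginary part.\<close>
      define Q where "Q w = P w - w" for w
      have Q: "(Q has_field_derivative (exp (exp w) - 1)) (at w)" for w
        using P[of w] unfolding Q_def b1 hankel_integrand_def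
        by (auto intro!: derivative_eq_intros)
      have bd: "norm (Q (Complex v pi) - Q (Complex v 0)) \<le> (exp 1 * exp v) * (pi - 0)" if "v \<le> 0" for v
      proof (rule norm_vertical_increment_le[OF Q])
        fix \<phi> :: real
        let ?w = "exp (Complex v \<phi>)"
        have n: "norm ?w = exp v" by (simp add: norm_exp_eq_Re)
        have "norm (exp ?w - exp 0) \<le> exp 1 * norm (?w - 0)"
        proof (rule field_differentiable_bound[of "cball 0 1" exp exp])
          show "norm (exp z) \<le> exp 1" if "z \<in> cball 0 1" for z :: complex
            using that by (intro order_trans[OF norm_exp]) auto
        qed (use n that in \<open>auto intro: has_field_derivative_at_within DERIV_exp\<close>)
        then show "norm (exp ?w - 1) \<le> exp 1 * exp v" using n by simp
      qed auto
      have "((\<lambda>v. (exp 1 * exp v) * (pi - 0)) \<longlongrightarrow> (0::real)) at_bot" by real_asymp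
      then have "(\<lambda>n. (exp 1 * exp (L n)) * (pi - 0)) \<longlonglongrightarrow> 0"
        using L by (rule filterlim_compose)
      then have "(\<lambda>n. Q (Complex (L n) pi) - Q (Complex (L n) 0)) \<longlonglongrightarrow> 0"
        by (rule Lim_null_comparison[rotated])
           (use bd in \<open>auto simp: L_def intro!: always_eventually\<close>)
      from tendsto_add[OF tendsto_Im[OF this] tendsto_const[of pi]]
      show ?thesis using False unfolding eq Q_def by (simp add: algebra_simps)
    qed
  qed
  from tendsto_add[OF A B] show ?thesis
    using b by (auto simp: p_def split: if_splits)
qed

text \<open>Rotate the ray from \<open>\<pi>\<close> to \<open>\<theta>\<close> for \<open>b \<le> 1\<close>, then raise \<open>b\<close> by partial integration.\<close>

lemma tendsto_Im_primitive:
  assumes "0 < b" and \<theta>: "pi / 2 < \<theta>" "\<theta> \<le> pi"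
    and P: "\<And>w. (P has_field_derivative hankel_integrand b w) (at w)"
  shows "(\<lambda>n. Im (P (Complex (ln (real (Suc n))) \<theta>) - P 0)) \<longlonglongrightarrow> pi / Gamma b"
proof -
  define R :: "nat \<Rightarrow> real" where "R n = ln (real (Suc n))" for n
  have R: "filterlim R at_top sequentially" unfolding R_def by real_asymp
  have cos: "cos \<theta> < 0" using \<theta> by (intro cos_lt_zero_pi) auto
  have decay: "(\<lambda>n. exp (exp (R n) * cos \<theta> + m * R n)) \<longlonglongrightarrow> 0" for m
    using filterlim_compose[OF exp_exp_decay[of "- cos \<theta>" m] R] cos by (simp add: mult.commute)
  have "\<forall>b P. real n < b \<and> b \<le> real (Suc n) \<and> (\<forall>w. (P has_field_derivative hankel_integrand b w) (at w))
      \<longrightarrow> (\<lambda>n. Im (P (Complex (R n) \<theta>) - P 0)) \<longlonglongrightarrow> pi / Gamma b" for n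
  proof (induction n)
    case 0
    show ?case
    proof (intro allI impI)
      fix b P assume *: "real 0 < b \<and> b \<le> real (Suc 0) \<and> (\<forall>w. (P has_field_derivative hankel_integrand b w) (at w))"
      \<comment> \<open>Turning the ray costs a vertical piece at abscissa \<open>v\<close>. On it
        \<open>cos \<phi> \<le> cos \<theta> < 0\<close>, so the integrand decays doubly
        exponentially as \<open>v\<close> grows.\<close>
      have bd: "norm (P (Complex v pi) - P (Complex v \<theta>)) \<le> exp (exp v * cos \<theta> + (1 - b) * v) * (pi - \<theta>)" for v
        by (rule norm_vertical_increment_le[where f = "hankel_integrand b"])
           (use * \<theta> in \<open>auto simp: norm_hankel_integrand intro!: cos_monotone_0_pi_le\<close>)
      have "(\<lambda>n. P (Complex (R n) pi) - P (Complex (R n) \<theta>)) \<longlonglongrightarrow> 0"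
        by (rule Lim_null_comparison[OF _ tendsto_mult_left_zero[OF decay[of "1 - b"], of "pi - \<theta>"]]) (use bd in auto)
      from tendsto_diff[OF tendsto_Im_primitive_pi[of b P] tendsto_Im[OF this]] *
      show "(\<lambda>n. Im (P (Complex (R n) \<theta>) - P 0)) \<longlonglongrightarrow> pi / Gamma b"
        by (simp add: R_def)
    qed
  next
    case (Suc n)
    show ?case
    proof (intro allI impI)
      fix b P assume *: "real (Suc n) < b \<and> b \<le> real (Suc (Suc n)) \<and> (\<forall>w. (P has_field_derivative hankel_integrand b w) (at w))"
      define c where "c = b - 1"
      have c: "c > 0" "b = c + 1" using * by (auto simp: c_def)
      \<comment> \<open>The derivative of \<open>hankel_integrand b\<close> is the function itself
        times \<open>exp w - c\<close>. The factor \<open>exp w\<close> lowers the parameter from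
        \<open>b\<close> to \<open>c\<close>, and the term with \<open>- c\<close> is cancelled by
        the derivative of \<open>of_real c * P\<close>.\<close>
      define P' where "P' w = of_real c * P w + hankel_integrand b w" for w
      have "(P' has_field_derivative hankel_integrand c w) (at w)" for w
      proof -
        have "(P' has_field_derivative of_real c * hankel_integrand b w + hankel_integrand b w * (exp w + (1 - of_real b))) (at w)"
          unfolding P'_def
          by (rule DERIV_add[OF DERIV_cmult]) (use * in \<open>auto simp: hankel_integrand_def intro!: derivative_eq_intros\<close>)
        also have "of_real c * hankel_integrand b w + hankel_integrand b w * (exp w + (1 - of_real b)) = hankel_integrand c w"
          by (simp add: hankel_integrand_def c(2) exp_add exp_diff exp_minus field_simps)
        finally show ?thesis .
      qed
      moreover have "real n < c" "c \<le> real (Suc n)" using * c by auto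
      ultimately have lim: "(\<lambda>n. Im (P' (Complex (R n) \<theta>) - P' 0)) \<longlonglongrightarrow> pi / Gamma c"
        using Suc.IH by blast
      have "(\<lambda>n. hankel_integrand b (Complex (R n) \<theta>)) \<longlonglongrightarrow> 0"
        by (rule tendsto_norm_zero_cancel) (simp add: norm_hankel_integrand decay)
      from tendsto_divide[OF tendsto_diff[OF lim tendsto_Im[OF this]] tendsto_const[of c]]
      have "(\<lambda>n. (Im (P' (Complex (R n) \<theta>) - P' 0) - Im (hankel_integrand b (Complex (R n) \<theta>))) / c) \<longlonglongrightarrow> pi / Gamma c / c"
        using c by simp
      moreover have "(Im (P' (Complex (R n) \<theta>) - P' 0) - Im (hankel_integrand b (Complex (R n) \<theta>))) / c
          = Im (P (Complex (R n) \<theta>) - P 0)" for n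
        using c hankel_integrand_real[of b 0] by (simp add: P'_def field_simps complex_is_Real_iff)
      moreover have "Gamma b = c * Gamma c" using c Gamma_plus1[of c] by (simp add: nonpos_Ints_def)
      ultimately show "(\<lambda>n. Im (P (Complex (R n) \<theta>) - P 0)) \<longlonglongrightarrow> pi / Gamma b"
        by (simp add: mult.commute)
    qed
  qed
  moreover obtain n where "real n < b" "b \<le> real (Suc n)"
  proof
    show "real (nat (\<lceil>b\<rceil> - 1)) < b" "b \<le> real (Suc (nat (\<lceil>b\<rceil> - 1)))" using assms(1) by linarith+
  qed
  ultimately show ?thesis using P unfolding R_def by blast
qed

section \<open>Bounds for Mittag-Leffler functions on the negative half-line\<close>

text \<open>The norm is the distance between the point of modulus \<open>A\<close> and angle \<psi>
  and the point \<open>- x\<close>. It is at least the distance of \<open>- x\<close> from the line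
  of angle \<psi>, and at least the distance of the other point from the real axis. With \<psi> =
  \<alpha>\<theta> the first bound produces decay in \<open>x\<close>, the second a bound uniform in
  \<open>x\<close>.\<close>

lemma norm_scaled_cis_plus_ge:
  assumes "A \<ge> 0" "x \<ge> (0::real)"
  shows "\<bar>sin \<psi>\<bar> * x \<le> norm (of_real A * cis \<psi> + of_real x)"
    and "\<bar>sin \<psi>\<bar> * A \<le> norm (of_real A * cis \<psi> + of_real x)"
proof -
  have n: "norm (of_real A * cis \<psi> + of_real x) = sqrt ((A * cos \<psi> + x)\<^sup>2 + (A * sin \<psi>)\<^sup>2)"
    by (simp add: norm_complex_def)
  have "(A * cos \<psi> + x)\<^sup>2 + (A * sin \<psi>)\<^sup>2 = (A + x * cos \<psi>)\<^sup>2 + (sin \<psi> * x)\<^sup>2"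
    using sin_cos_squared_add[of \<psi>] by algebra
  then have "sqrt ((sin \<psi> * x)\<^sup>2) \<le> norm (of_real A * cis \<psi> + of_real x)"
    unfolding n by (intro real_sqrt_le_mono) simp
  then show "\<bar>sin \<psi>\<bar> * x \<le> norm (of_real A * cis \<psi> + of_real x)"
    using assms by (simp add: abs_mult)
  have "sqrt ((sin \<psi> * A)\<^sup>2) \<le> norm (of_real A * cis \<psi> + of_real x)"
    unfolding n by (intro real_sqrt_le_mono) (simp add: mult.commute)
  then show "\<bar>sin \<psi>\<bar> * A \<le> norm (of_real A * cis \<psi> + of_real x)"
    using assms by (simp add: abs_mult)
qed

lemma exp_mult_Complex: "exp (of_real \<alpha> * Complex v \<phi>) = of_real (exp (\<alpha> * v)) * cis (\<alpha> * \<phi>)"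
  by (simp add: exp_eq_polar)

text \<open>A zero would force \<open>\<alpha> * Im w\<close> to be an odd multiple of
  \<open>pi\<close>. The strip between the first poles is open and convex, so the integrand has a
  primitive on it.\<close>

lemma exp_plus_nonzero_strip:
  assumes "\<alpha> > 0" "x > (0::real)" "\<bar>Im w\<bar> < pi / \<alpha>"
  shows "exp (of_real \<alpha> * w) + of_real x \<noteq> 0"
proof
  assume 0: "exp (of_real \<alpha> * w) + of_real x = 0"
  let ?y = "\<alpha> * Im w"
  from 0 have "Im (exp (of_real \<alpha> * w) + of_real x) = 0" "Re (exp (of_real \<alpha> * w) + of_real x) = 0" by simp_all
  then have s: "sin ?y = 0" and c: "exp (\<alpha> * Re w) * cos ?y = - x" by (simp_all add: Im_exp Re_exp)
  have "\<bar>?y\<bar> < pi" using assms by (simp add: abs_mult field_simps)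
  moreover from this have "\<not> ?y > 0" "\<not> - ?y > 0"
    using s sin_gt_zero[of ?y] sin_gt_zero[of "- ?y"] by (auto simp: abs_less_iff)
  ultimately have "?y = 0" by linarith
  then show False using c assms exp_gt_zero[of "\<alpha> * Re w"] by simp
qed

text \<open>
  Here \<open>g\<close> is an antiderivative, bounded by \<open>K\<close>, of a majorant of the integrand
  \<open>F(w) = exp (e\<^sup>w + m w) / (e\<^bsup>\<alpha>w\<^esup> + x)\<close> on the line \<open>Im w = \<theta>\<close>. The partial sums of the Mittag-Leffler series
  are the contour integrals of \<open>F (1 - q\<^sup>N)\<close> with \<open>q(w) = -x e\<^bsup>-\<alpha>w\<^esup>\<close>. On a contour to the right of
  \<open>\<rho>\<close> one has \<open>\<bar>q\<bar> \<le> 1/2\<close>, while the contour of \<open>F\<close> alone can be shifted onto the line.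
\<close>

lemma mittag_leffler_partial_sum_bound:
  fixes \<alpha> m x \<theta> K :: real and g g' :: "real \<Rightarrow> real"
  defines "b \<equiv> 1 + \<alpha> - m"
  assumes \<alpha>: "1 < \<alpha>" and b: "b > 0" and m: "m > 0" and x: "x > 0"
    and \<theta>: "pi / 2 < \<theta>" "\<theta> < pi / \<alpha>"
    and g: "\<And>v. (g has_real_derivative g' v) (at v)" and K: "\<And>v. \<bar>g v\<bar> \<le> K"
    and g': "\<And>v. exp (exp v * cos \<theta> + m * v) / norm (of_real (exp (\<alpha> * v)) * cis (\<alpha> * \<theta>) + of_real x) \<le> g' v"
  shows "\<exists>B. \<forall>N. \<bar>pi * (\<Sum>k<N. (- x) ^ k / Gamma (\<alpha> * real k + b))\<bar> \<le> 2 * K + (1 / 2) ^ N * B"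
proof -
  define F where "F w = exp (exp w + of_real m * w) / (exp (of_real \<alpha> * w) + of_real x)" for w :: complex
  define S where "S = {w::complex. \<bar>Im w\<bar> < pi / \<alpha>}"
  have S_eq: "S = {w. Im w < pi / \<alpha>} \<inter> {w. Im w > - (pi / \<alpha>)}" by (auto simp: S_def)
  have S: "open S" "convex S"
    unfolding S_eq by (auto intro!: open_Int convex_Int open_halfspace_Im_lt open_halfspace_Im_gt
        convex_halfspace_Im_lt convex_halfspace_Im_gt)
  have nz: "exp (of_real \<alpha> * w) + of_real x \<noteq> 0" if "w \<in> S" for w
    using exp_plus_nonzero_strip[of \<alpha> x w] \<alpha> x that by (simp add: S_def)
  have "F holomorphic_on S"
    unfolding F_def using nz by (intro holomorphic_intros) auto
  then have contF: "continuous_on S F" by (rule holomorphic_on_imp_continuous_on)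
  obtain P where P: "\<And>w. w \<in> S \<Longrightarrow> (P has_field_derivative F w) (at w)"
    using holomorphic_convex_primitive'[OF S(2,1) \<open>F holomorphic_on S\<close>] at_within_open[OF _ S(1)] by metis
  define bk where "bk k = \<alpha> * real k + b" for k
  have "\<exists>P. \<forall>w. (P has_field_derivative hankel_integrand (bk k) w) (at w)" for k
    using hankel_integrand_has_primitive[of "bk k"] by metis
  then obtain p where p: "\<And>k w. (p k has_field_derivative hankel_integrand (bk k) w) (at w)" by metis
  have \<theta>0: "\<theta> > 0" using \<theta> pi_gt_zero by linarith
  have \<theta>pi: "\<theta> \<le> pi" using \<theta> \<alpha> pi_gt_zero
    by (smt (verit) divide_le_eq mult_less_cancel_left1)
  have seg: "Complex v \<phi> \<in> S" if "\<phi> \<in> {0..\<theta>}" for v \<phi>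
    using that \<theta> by (simp add: S_def)
  have realS: "of_real v \<in> S" for v using \<theta>0 \<theta> by (simp add: S_def)
  have Freal: "F (of_real v) \<in> \<real>" for v
  proof -
    have "F (of_real v) = of_real (exp (exp v + m * v) / (exp (\<alpha> * v) + x))"
      by (simp add: F_def flip: exp_of_real)
    then show ?thesis by simp
  qed
  have ImP: "Im (P (of_real v)) = Im (P (of_real u))" for u v
    by (rule Im_primitive_real_axis[where f = F]) (use P realS Freal in auto)
  have Imp: "Im (p k (of_real v)) = Im (p k 0)" for k v
    using Im_primitive_real_axis[of 0 v "p k" "hankel_integrand (bk k)"] p
    by (simp add: hankel_integrand_real)
  have normF: "norm (F (Complex v \<phi>)) = exp (exp v * cos \<phi> + m * v) / norm (of_real (exp (\<alpha> * v)) * cis (\<alpha> * \<phi>) + of_real x)" for v \<phi>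
    by (simp add: F_def norm_divide norm_exp_eq_Re Re_exp flip: exp_mult_Complex)
  have Fg: "norm (F (Complex v \<theta>)) \<le> g' v" for v
    using g'[of v] unfolding normF .
  \<comment> \<open>Increments along the line are dominated by those of \<open>C * g\<close>, which
    never exceed \<open>C * (2 * K)\<close> however long the segment is. This serves the contour
    integral of \<open>F\<close> with \<open>C = 1\<close> and the remainder with
    \<open>C = (1 / 2) ^ N\<close>.\<close>
  have horiz: "norm (Q (Complex v \<theta>) - Q (Complex u \<theta>)) \<le> C * (2 * K)"
    if Q: "\<And>v. (Q has_field_derivative D (Complex v \<theta>)) (at (Complex v \<theta>))" "u \<le> v"
      and D: "\<And>s. s \<ge> u \<Longrightarrow> norm (D (Complex s \<theta>)) \<le> C * g' s" and C: "C \<ge> 0" for Q D C u v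
  proof (cases "u = v")
    case False
    then have "norm ((\<lambda>s. Q (Complex s \<theta>)) v - (\<lambda>s. Q (Complex s \<theta>)) u) \<le> (\<lambda>s. C * g s) v - (\<lambda>s. C * g s) u"
    proof (intro differentiable_bound_general)
      show "continuous_on {u..v} (\<lambda>s. Q (Complex s \<theta>))"
        using has_vector_derivative_horizontal[OF Q(1)]
        by (auto intro!: continuous_at_imp_continuous_on has_vector_derivative_continuous)
      show "((\<lambda>s. C * g s) has_vector_derivative C * g' s) (at s)" for s
        using DERIV_cmult[OF g, of C s] by (simp add: has_real_derivative_iff_has_vector_derivative)
      then show "continuous_on {u..v} (\<lambda>s. C * g s)"
        by (auto intro!: continuous_at_imp_continuous_on has_vector_derivative_continuous)
      show "((\<lambda>s. Q (Complex s \<theta>)) has_vector_derivative D (Complex s \<theta>)) (at s)" for s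
        by (rule has_vector_derivative_horizontal[OF Q(1)])
    qed (use Q(2) D in auto)
    also have "\<dots> = C * (g v - g u)" by (simp add: algebra_simps)
    also have "\<dots> \<le> C * (2 * K)"
      using K[of u] K[of v] C by (intro mult_left_mono) linarith+
    finally show ?thesis by simp
  qed (use C K[of u] in auto)
  \<comment> \<open>The contour is led far to the left, up a vertical piece at abscissa
    \<open>l\<close>, and back along the line. The piece contributes less than \<open>e\<close>:
    there the denominator is at least \<open>x / 2\<close>, while the numerator tends to
    \<open>0\<close> because \<open>m > 0\<close>.\<close>
  have P_bound: "\<bar>Im (P (Complex v \<theta>) - P (of_real u))\<bar> \<le> 2 * K" for u v
  proof (rule field_le_epsilon)
    fix e :: real assume e: "e > 0"
    have "((\<lambda>l. exp (exp l + m * l) / (x / 2) * \<theta>) \<longlongrightarrow> 0) at_bot"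
      using m x by real_asymp
    then have "eventually (\<lambda>l. exp (exp l + m * l) / (x / 2) * \<theta> < e) at_bot"
      using e by (rule order_tendstoD)
    moreover have "((\<lambda>l. exp (\<alpha> * l)) \<longlongrightarrow> 0) at_bot" using \<alpha> by real_asymp
    then have "eventually (\<lambda>l. exp (\<alpha> * l) < x / 2) at_bot"
      by (rule order_tendstoD) (use x in simp)
    moreover have "eventually (\<lambda>l. l \<le> v) at_bot" by (rule eventually_le_at_bot)
    ultimately have "eventually (\<lambda>l. exp (exp l + m * l) / (x / 2) * \<theta> < e \<and> exp (\<alpha> * l) < x / 2 \<and> l \<le> v) at_bot"
      by eventually_elim simp
    then obtain l where l: "exp (exp l + m * l) / (x / 2) * \<theta> < e" "exp (\<alpha> * l) < x / 2" "l \<le> v"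
      using eventually_happens by fastforce
    have "norm (P (Complex l \<theta>) - P (Complex l 0)) \<le> exp (exp l + m * l) / (x / 2) * (\<theta> - 0)"
    proof (rule norm_vertical_increment_le[where f = F])
      fix \<phi> assume "\<phi> \<in> {0..\<theta>}"
      show "norm (F (Complex l \<phi>)) \<le> exp (exp l + m * l) / (x / 2)"
        unfolding normF
      proof (rule frac_le)
        show "exp (exp l * cos \<phi> + m * l) \<le> exp (exp l + m * l)" by (simp add: mult_left_le)
        have "norm (complex_of_real x) - norm (- (of_real (exp (\<alpha> * l)) * cis (\<alpha> * \<phi>)))
            \<le> norm (complex_of_real x - (- (of_real (exp (\<alpha> * l)) * cis (\<alpha> * \<phi>))))"
          by (rule norm_triangle_ineq2)
        then have "x - exp (\<alpha> * l) \<le> norm (of_real (exp (\<alpha> * l)) * cis (\<alpha> * \<phi>) + complex_of_real x)"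
          using x by (simp add: norm_mult add.commute)
        then show "x / 2 \<le> norm (of_real (exp (\<alpha> * l)) * cis (\<alpha> * \<phi>) + complex_of_real x)"
          using l(2) by linarith
      qed (use x in auto)
    qed (use P seg \<theta>0 in auto)
    then have A: "\<bar>Im (P (Complex l \<theta>) - P (of_real l))\<bar> < e"
      using l(1) abs_Im_le_cmod[of "P (Complex l \<theta>) - P (of_real l)"]
      by (simp add: Complex_eq)
    have "norm (P (Complex v \<theta>) - P (Complex l \<theta>)) \<le> 1 * (2 * K)"
      by (rule horiz[where D = F]) (use P seg \<theta>0 Fg l in auto)
    then have "\<bar>Im (P (Complex v \<theta>) - P (Complex l \<theta>))\<bar> \<le> 2 * K"
      using abs_Im_le_cmod[of "P (Complex v \<theta>) - P (Complex l \<theta>)"] by linarith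
    then show "\<bar>Im (P (Complex v \<theta>) - P (of_real u))\<bar> \<le> 2 * K + e"
      using A ImP[of l u] by simp
  qed
  \<comment> \<open>The abscissa with \<open>exp (\<alpha> * \<rho>) = 2 * x\<close>, where
    \<open>norm (q w)\<close> is exactly \<open>1 / 2\<close>.\<close>
  define \<rho> where "\<rho> = ln (2 * x) / \<alpha>"
  define q where "q w = - of_real x * exp (- of_real \<alpha> * w)" for w :: complex
  have q: "norm (q w) \<le> 1 / 2" if "Re w \<ge> \<rho>" for w
  proof -
    have "ln (2 * x) \<le> \<alpha> * Re w" using that \<alpha> by (simp add: \<rho>_def field_simps)
    then have "2 * x \<le> exp (\<alpha> * Re w)" using x by (metis exp_le_cancel_iff exp_ln mult_pos_pos zero_less_numeral)
    moreover have "norm (q w) = x * exp (- (\<alpha> * Re w))"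
      using x by (simp add: q_def norm_mult norm_exp_eq_Re)
    ultimately show ?thesis by (simp add: exp_minus inverse_eq_divide pos_divide_le_eq)
  qed
  \<comment> \<open>A primitive of the remainder \<open>F w * q w ^ N\<close>. The terms of the sum
    differentiate to a geometric progression in \<open>q w\<close>, and
    \<open>exp (\<alpha> * w) * (1 - q w)\<close> is the denominator of \<open>F\<close>.\<close>
  define Q where "Q N w = P w - (\<Sum>k<N. (- of_real x) ^ k * p k w)" for N w
  have Qd: "(Q N has_field_derivative F w * q w ^ N) (at w)" if w: "w \<in> S" for N w
  proof -
    have "(Q N has_field_derivative F w - (\<Sum>k<N. (- of_real x) ^ k * hankel_integrand (bk k) w)) (at w)"
      unfolding Q_def by (intro DERIV_diff DERIV_sum DERIV_cmult P w p)
    moreover have "(\<Sum>k<N. (- of_real x) ^ k * hankel_integrand (bk k) w) = F w * (1 - q w ^ N)"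
    proof -
      have e: "(- of_real x) ^ k * hankel_integrand (bk k) w
          = exp (exp w + of_real m * w) / exp (of_real \<alpha> * w) * q w ^ k" for k
      proof -
        have "exp w + (1 - of_real (bk k)) * w = (exp w + of_real m * w) - of_real \<alpha> * w + of_nat k * (- of_real \<alpha> * w)"
          by (simp add: bk_def b_def algebra_simps)
        then have "hankel_integrand (bk k) w = exp (exp w + of_real m * w) / exp (of_real \<alpha> * w) * exp (- of_real \<alpha> * w) ^ k"
          unfolding hankel_integrand_def by (simp only: exp_add exp_diff exp_of_nat_mult)
        then show ?thesis by (simp only: q_def power_mult_distrib ac_simps)
      qed
      have 1: "1 - q w = (exp (of_real \<alpha> * w) + of_real x) / exp (of_real \<alpha> * w)"
        by (simp add: q_def exp_minus field_simps)
      then have ne: "1 - q w \<noteq> 0" using nz[OF w] by simp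
      have "(\<Sum>k<N. (- of_real x) ^ k * hankel_integrand (bk k) w)
          = exp (exp w + of_real m * w) / exp (of_real \<alpha> * w) * (\<Sum>k<N. q w ^ k)"
        by (simp add: e sum_distrib_left)
      also have "(\<Sum>k<N. q w ^ k) = (1 - q w ^ N) / (1 - q w)"
        using ne by (simp add: sum_gp_strict)
      also have "exp (exp w + of_real m * w) / exp (of_real \<alpha> * w) * ((1 - q w ^ N) / (1 - q w)) = F w * (1 - q w ^ N)"
      proof -
        have "E / a * (u / (d / a)) = E / d * u" if "a \<noteq> 0" "d \<noteq> 0" for E a u d :: complex
          using that by (simp add: field_simps)
        then show ?thesis unfolding 1 F_def using nz[OF w] by simp
      qed
      finally show ?thesis .
    qed
    ultimately show ?thesis by (simp add: right_diff_distrib)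
  qed
  have R_bound: "norm (F w * q w ^ N) \<le> (1 / 2) ^ N * norm (F w)" if "Re w \<ge> \<rho>" for w N
    using power_mono[OF q[OF that], of N]
    by (simp add: norm_mult norm_power mult.commute[of "norm (F w)"] mult_right_mono)
  \<comment> \<open>The bound \<open>M\<close> depends on \<open>x\<close>. It enters only through
    \<open>B\<close>, with the factor \<open>(1 / 2) ^ N\<close>, so that \<open>K\<close> alone
    survives as \<open>N\<close> grows.\<close>
  have "compact (Complex \<rho> ` {0..\<theta>})"
    by (rule compact_continuous_image) (auto intro!: continuous_intros simp: Complex_eq)
  moreover have "continuous_on (Complex \<rho> ` {0..\<theta>}) F"
    by (rule continuous_on_subset[OF contF]) (use seg in auto)
  ultimately have "bounded (F ` Complex \<rho> ` {0..\<theta>})"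
    using compact_continuous_image compact_imp_bounded by blast
  then obtain M where M: "\<And>\<phi>. \<phi> \<in> {0..\<theta>} \<Longrightarrow> norm (F (Complex \<rho> \<phi>)) \<le> M"
    unfolding bounded_iff by (metis imageI)
  define R :: "nat \<Rightarrow> real" where "R n = ln (real (Suc n))" for n
  have R: "filterlim R at_top sequentially" unfolding R_def by real_asymp
  show ?thesis
  proof (intro exI allI)
    fix N
    let ?B = "2 * K + M * \<theta>"
    have Q_bound: "norm (Q N (Complex v \<theta>) - Q N (of_real \<rho>)) \<le> (1 / 2) ^ N * ?B" if v: "v \<ge> \<rho>" for v
    proof -
      have "norm (Q N (Complex v \<theta>) - Q N (Complex \<rho> \<theta>)) \<le> (1 / 2) ^ N * (2 * K)"
      proof (rule horiz[where D = "\<lambda>w. F w * q w ^ N"])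
        show "norm (F (Complex s \<theta>) * q (Complex s \<theta>) ^ N) \<le> (1 / 2) ^ N * g' s" if "s \<ge> \<rho>" for s
          by (rule order_trans[OF R_bound mult_left_mono[OF Fg]]) (use that in auto)
      qed (use Qd seg \<theta>0 v in auto)
      moreover have "norm (Q N (Complex \<rho> \<theta>) - Q N (Complex \<rho> 0)) \<le> ((1 / 2) ^ N * M) * (\<theta> - 0)"
      proof (rule norm_vertical_increment_le[where f = "\<lambda>w. F w * q w ^ N"])
        show "norm (F (Complex \<rho> \<phi>) * q (Complex \<rho> \<phi>) ^ N) \<le> (1 / 2) ^ N * M" if "\<phi> \<in> {0..\<theta>}" for \<phi>
          by (rule order_trans[OF R_bound mult_left_mono[OF M[OF that]]]) auto
      qed (use Qd seg \<theta>0 in auto)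
      moreover have "norm (Q N (Complex v \<theta>) - Q N (of_real \<rho>))
          \<le> norm (Q N (Complex v \<theta>) - Q N (Complex \<rho> \<theta>)) + norm (Q N (Complex \<rho> \<theta>) - Q N (Complex \<rho> 0))"
        by (rule order_trans[OF _ norm_triangle_ineq]) (simp add: Complex_eq)
      ultimately show ?thesis by (simp add: algebra_simps)
    qed
    have fin: "\<bar>\<Sum>k<N. (- x) ^ k * Im (p k (Complex v \<theta>) - p k 0)\<bar> \<le> 2 * K + (1 / 2) ^ N * ?B" if "v \<ge> \<rho>" for v
    proof -
      have "Im ((- of_real x) ^ k * z) = (- x) ^ k * Im z" for k z
      proof -
        have "(- complex_of_real x) ^ k = of_real ((- x) ^ k)" by simp
        then show ?thesis by (simp only: times_complex.sel Re_complex_of_real Im_complex_of_real)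
      qed
      then have "Im (Q N w) = Im (P w) - (\<Sum>k<N. (- x) ^ k * Im (p k w))" for w
        by (simp add: Q_def)
      then have "(\<Sum>k<N. (- x) ^ k * Im (p k (Complex v \<theta>) - p k 0))
          = Im (P (Complex v \<theta>) - P (of_real \<rho>)) - Im (Q N (Complex v \<theta>) - Q N (of_real \<rho>))"
        by (simp add: Imp right_diff_distrib sum_subtractf)
      then show ?thesis
        using P_bound[of v \<rho>] Q_bound[OF that] abs_Im_le_cmod[of "Q N (Complex v \<theta>) - Q N (of_real \<rho>)"]
        by linarith
    qed
    have "(\<lambda>n. \<bar>\<Sum>k<N. (- x) ^ k * Im (p k (Complex (R n) \<theta>) - p k 0)\<bar>)
        \<longlonglongrightarrow> \<bar>\<Sum>k<N. (- x) ^ k * (pi / Gamma (bk k))\<bar>"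
      unfolding R_def
    proof (intro tendsto_intros)
      fix k
      show "(\<lambda>n. Im (p k (Complex (ln (real (Suc n))) \<theta>) - p k 0)) \<longlonglongrightarrow> pi / Gamma (bk k)"
        by (rule tendsto_Im_primitive[OF _ \<theta>(1) \<theta>pi p]) (use \<alpha> b in \<open>auto simp: bk_def intro: add_nonneg_pos\<close>)
    qed
    moreover have "eventually (\<lambda>n. R n \<ge> \<rho>) sequentially"
      using R by (simp add: filterlim_at_top)
    then have "eventually (\<lambda>n. \<bar>\<Sum>k<N. (- x) ^ k * Im (p k (Complex (R n) \<theta>) - p k 0)\<bar> \<le> 2 * K + (1 / 2) ^ N * ?B) sequentially"
      by eventually_elim (rule fin)
    ultimately have "\<bar>\<Sum>k<N. (- x) ^ k * (pi / Gamma (bk k))\<bar> \<le> 2 * K + (1 / 2) ^ N * ?B"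
      by (rule tendsto_upperbound) simp
    then show "\<bar>pi * (\<Sum>k<N. (- x) ^ k / Gamma (\<alpha> * real k + b))\<bar> \<le> 2 * K + (1 / 2) ^ N * ?B"
      by (simp add: bk_def sum_distrib_left mult.commute)
  qed
qed

text \<open>The interval is nonempty because \<alpha> < 2, and its midpoint is taken. On the line at
  height \<theta>, \<open>cos \<theta> < 0\<close> makes \<open>exp (exp w)\<close> decay, and
  \<open>sin (\<alpha> * \<theta>) > 0\<close> keeps the denominator away from zero.\<close>

lemma exists_ray_angle:
  assumes "1 < \<alpha>" "\<alpha> < (2::real)"
  obtains \<theta> where "pi / 2 < \<theta>" "\<theta> < pi / \<alpha>" "cos \<theta> < 0" "sin (\<alpha> * \<theta>) > 0"
proof
  define p where "p = pi / \<alpha>"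
  let ?t = "(pi / 2 + p) / 2"
  have lt: "pi / 2 < p" "p < pi" using assms by (auto simp: p_def field_simps)
  have 1: "pi / 2 < ?t" "?t < p" using lt by simp_all
  show "pi / 2 < ?t" "?t < pi / \<alpha>" using 1 by (simp_all add: p_def)
  show "cos ?t < 0" using lt 1 by (intro cos_lt_zero_pi) auto
  have "\<alpha> * ?t < \<alpha> * p" using 1(2) assms by (intro mult_strict_left_mono) auto
  then have "\<alpha> * ?t < pi" using assms by (simp add: p_def)
  moreover have "0 < \<alpha> * ?t" using 1(1) assms pi_gt_zero by (intro mult_pos_pos) linarith+
  ultimately show "sin (\<alpha> * ?t) > 0" by (intro sin_gt_zero)
qed

text \<open>This is the case \<open>m = 1\<close>. With the denominator bounded below by
  \<open>s * x\<close>, the majorant \<open>exp (v - c * exp v) / (s * x)\<close> has an elementary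
  antiderivative, and its factor \<open>1 / x\<close> is the decay. The constant \<open>K\<close> is
  uniform in \<open>x\<close>; \<open>B\<close> may depend on \<open>x\<close>, as its term vanishes
  in the limit.\<close>

lemma mittag_leffler_decay_partial:
  assumes "1 < \<alpha>" "\<alpha> < 2"
  obtains K where "K > 0" and "\<And>x. x > 0 \<Longrightarrow> \<exists>B. \<forall>N.
      \<bar>\<Sum>k<N. (- x) ^ k / Gamma (\<alpha> * real k + \<alpha>)\<bar> \<le> K / x + (1 / 2) ^ N * B"
proof -
  obtain \<theta> where \<theta>: "pi / 2 < \<theta>" "\<theta> < pi / \<alpha>" "cos \<theta> < 0" "sin (\<alpha> * \<theta>) > 0"
    using exists_ray_angle[OF assms] .
  define c where "c = - cos \<theta>"
  define s where "s = sin (\<alpha> * \<theta>)"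
  have cs: "c > 0" "s > 0" using \<theta> by (auto simp: c_def s_def)
  show ?thesis
  proof
    show "2 * (1 / (c * s)) / pi > 0" using cs by simp
    fix x :: real assume x: "x > 0"
    define g where "g v = - exp (- (c * exp v)) / (c * s * x)" for v
    define g' where "g' v = exp (v - c * exp v) / (s * x)" for v
    have "(g has_real_derivative g' v) (at v)" for v
      unfolding g_def g'_def using cs x
      by (auto intro!: derivative_eq_intros simp: exp_diff exp_minus field_simps)
    moreover have "\<bar>g v\<bar> \<le> 1 / (c * s * x)" for v
      using cs x by (auto simp: g_def abs_mult intro!: divide_right_mono)
    moreover have "exp (exp v * cos \<theta> + 1 * v) / norm (of_real (exp (\<alpha> * v)) * cis (\<alpha> * \<theta>) + complex_of_real x) \<le> g' v" for v
      unfolding g'_def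
      by (rule frac_le) (use cs x norm_scaled_cis_plus_ge(1)[of "exp (\<alpha> * v)" x "\<alpha> * \<theta>"] in
          \<open>auto simp: s_def c_def mult.commute\<close>)
    ultimately have "\<exists>B. \<forall>N. \<bar>pi * (\<Sum>k<N. (- x) ^ k / Gamma (\<alpha> * real k + (1 + \<alpha> - 1)))\<bar>
        \<le> 2 * (1 / (c * s * x)) + (1 / 2) ^ N * B"
      by (intro mittag_leffler_partial_sum_bound[where g = g and g' = g' and \<theta> = \<theta>]) (use assms \<theta> x in auto)
    then obtain B where "\<And>N. \<bar>pi * (\<Sum>k<N. (- x) ^ k / Gamma (\<alpha> * real k + (1 + \<alpha> - 1)))\<bar>
        \<le> 2 * (1 / (c * s * x)) + (1 / 2) ^ N * B" by blast
    then have "\<bar>\<Sum>k<N. (- x) ^ k / Gamma (\<alpha> * real k + \<alpha>)\<bar> \<le> 2 * (1 / (c * s)) / pi / x + (1 / 2) ^ N * (B / pi)" for N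
      using x cs by (simp add: abs_mult field_simps)
    then show "\<exists>B. \<forall>N. \<bar>\<Sum>k<N. (- x) ^ k / Gamma (\<alpha> * real k + \<alpha>)\<bar> \<le> 2 * (1 / (c * s)) / pi / x + (1 / 2) ^ N * B"
      by blast
  qed
qed

text \<open>This is the case \<open>m = 2\<close>. The lower bound
  \<open>s * exp (\<alpha> * v)\<close> for the denominator eliminates \<open>x\<close> and leaves
  \<open>exp (\<kappa> * v - c * exp v) / s\<close> with \<open>\<kappa> = 2 - \<alpha> > 0\<close>,
  which is integrable at both ends.\<close>

lemma mittag_leffler_bounded_partial:
  assumes "1 < \<alpha>" "\<alpha> < 2"
  obtains K where "K > 0" and "\<And>x. x > 0 \<Longrightarrow> \<exists>B. \<forall>N.
      \<bar>\<Sum>k<N. (- x) ^ k / Gamma (\<alpha> * real k + (\<alpha> - 1))\<bar> \<le> K + (1 / 2) ^ N * B"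
proof -
  obtain \<theta> where \<theta>: "pi / 2 < \<theta>" "\<theta> < pi / \<alpha>" "cos \<theta> < 0" "sin (\<alpha> * \<theta>) > 0"
    using exists_ray_angle[OF assms] .
  define c where "c = - cos \<theta>"
  define s where "s = sin (\<alpha> * \<theta>)"
  define \<kappa> where "\<kappa> = 2 - \<alpha>"
  have cs: "c > 0" "s > 0" "\<kappa> > 0" "\<kappa> < 1" using \<theta> assms by (auto simp: c_def s_def \<kappa>_def)
  show ?thesis
  proof
    show "2 * (exp c / (c * \<kappa> * s)) / pi > 0" using cs by simp
    fix x :: real assume x: "x > 0"
    define g where "g v = - exp c * exp (- (c * exp (\<kappa> * v))) / (c * \<kappa> * s)" for v
    define g' where "g' v = exp (c + \<kappa> * v - c * exp (\<kappa> * v)) / s" for v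
    have "(g has_real_derivative g' v) (at v)" for v
      unfolding g_def g'_def using cs x
      by (auto intro!: derivative_eq_intros simp: exp_diff exp_minus exp_add field_simps)
    moreover have "\<bar>g v\<bar> \<le> exp c / (c * \<kappa> * s)" for v
      using cs x by (auto simp: g_def abs_mult intro!: divide_right_mono)
    moreover have "exp (exp v * cos \<theta> + 2 * v) / norm (of_real (exp (\<alpha> * v)) * cis (\<alpha> * \<theta>) + complex_of_real x) \<le> g' v" for v
    proof -
      \<comment> \<open>Trading \<open>exp v\<close> for \<open>exp (\<kappa> * v)\<close> in the
        exponent turns the majorant into the derivative of an elementary function, at the price of
        the factor \<open>exp c\<close>.\<close>
      have "exp (\<kappa> * v) \<le> 1 + exp v"
      proof (cases "v \<ge> 0")
        case True
        then have "exp (\<kappa> * v) \<le> exp v" using cs by (simp add: mult_left_le_one_le)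
        then show ?thesis by linarith
      next
        case False
        then have "exp (\<kappa> * v) \<le> exp 0" using cs by (subst exp_le_cancel_iff) (simp add: mult_nonneg_nonpos)
        then show ?thesis using exp_gt_zero[of v] by (simp add: less_imp_le add_increasing2)
      qed
      then have "c * exp (\<kappa> * v) \<le> c * (1 + exp v)" using cs by (intro mult_left_mono) auto
      then have le: "exp v * cos \<theta> + \<kappa> * v \<le> c + \<kappa> * v - c * exp (\<kappa> * v)"
        by (simp add: c_def algebra_simps)
      have "exp (exp v * cos \<theta> + 2 * v) / norm (of_real (exp (\<alpha> * v)) * cis (\<alpha> * \<theta>) + complex_of_real x)
          \<le> exp (exp v * cos \<theta> + 2 * v) / (s * exp (\<alpha> * v))"
        by (rule frac_le) (use cs x norm_scaled_cis_plus_ge(2)[of "exp (\<alpha> * v)" x "\<alpha> * \<theta>"] in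
            \<open>auto simp: s_def\<close>)
      also have "\<dots> = exp (exp v * cos \<theta> + 2 * v - \<alpha> * v) / s"
        unfolding exp_diff by (simp add: field_simps)
      also have "exp v * cos \<theta> + 2 * v - \<alpha> * v = exp v * cos \<theta> + \<kappa> * v"
        by (simp add: \<kappa>_def algebra_simps)
      also have "exp (exp v * cos \<theta> + \<kappa> * v) / s \<le> g' v"
        unfolding g'_def using le cs by (intro divide_right_mono) auto
      finally show ?thesis .
    qed
    ultimately have "\<exists>B. \<forall>N. \<bar>pi * (\<Sum>k<N. (- x) ^ k / Gamma (\<alpha> * real k + (1 + \<alpha> - 2)))\<bar>
        \<le> 2 * (exp c / (c * \<kappa> * s)) + (1 / 2) ^ N * B"
      by (intro mittag_leffler_partial_sum_bound[where g = g and g' = g' and \<theta> = \<theta>]) (use assms \<theta> x in auto)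
    then obtain B where "\<And>N. \<bar>pi * (\<Sum>k<N. (- x) ^ k / Gamma (\<alpha> * real k + (1 + \<alpha> - 2)))\<bar>
        \<le> 2 * (exp c / (c * \<kappa> * s)) + (1 / 2) ^ N * B" by blast
    moreover have "1 + \<alpha> - 2 = \<alpha> - 1" by simp
    ultimately have "\<bar>\<Sum>k<N. (- x) ^ k / Gamma (\<alpha> * real k + (\<alpha> - 1))\<bar> \<le> 2 * (exp c / (c * \<kappa> * s)) / pi + (1 / 2) ^ N * (B / pi)" for N
      using x cs by (simp add: abs_mult field_simps)
    then show "\<exists>B. \<forall>N. \<bar>\<Sum>k<N. (- x) ^ k / Gamma (\<alpha> * real k + (\<alpha> - 1))\<bar> \<le> 2 * (exp c / (c * \<kappa> * s)) / pi + (1 / 2) ^ N * B"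
      by blast
  qed
qed

text \<open>Single terms are differences of consecutive partial sums, hence bounded at some
  \<open>x > \<bar>z\<bar>\<close>; Abel's lemma then gives absolute convergence at
  \<open>z\<close>. So the contour bounds also settle convergence.\<close>

lemma mittag_leffler_summableI:
  assumes "\<And>x. x > 0 \<Longrightarrow> \<exists>D B. \<forall>N. \<bar>\<Sum>k<N. (- x) ^ k / Gamma (\<alpha> * real k + b)\<bar> \<le> D + (1 / 2) ^ N * (B::real)"
  shows "summable (\<lambda>k. (1 / Gamma (\<alpha> * real k + b)) * z ^ k)"
proof -
  define x where "x = \<bar>z\<bar> + 1"
  have x: "x > 0" "\<bar>z\<bar> < x" by (auto simp: x_def)
  obtain D B where DB: "\<And>N. \<bar>\<Sum>k<N. (- x) ^ k / Gamma (\<alpha> * real k + b)\<bar> \<le> D + (1 / 2) ^ N * B"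
    using assms[OF x(1)] by blast
  have DB': "\<bar>\<Sum>k<N. (- x) ^ k / Gamma (\<alpha> * real k + b)\<bar> \<le> D + \<bar>B\<bar>" for N
  proof -
    have "(1 / 2) ^ N * B \<le> 1 * \<bar>B\<bar>"
      by (intro order_trans[OF mult_left_mono[OF abs_ge_self] mult_right_mono] power_le_one) auto
    then show ?thesis using DB[of N] by linarith
  qed
  have "norm (1 / Gamma (\<alpha> * real k + b)) * x ^ k \<le> 2 * (D + \<bar>B\<bar>)" for k
  proof -
    have "norm (1 / Gamma (\<alpha> * real k + b)) * x ^ k = \<bar>(- x) ^ k / Gamma (\<alpha> * real k + b)\<bar>"
      using x by (simp add: abs_mult power_abs)
    also have "\<dots> \<le> 2 * (D + \<bar>B\<bar>)"
    proof -
      have "\<bar>t\<bar> \<le> 2 * E" if "\<bar>S\<bar> \<le> E" "\<bar>S + t\<bar> \<le> E" for S t E :: real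
        using that by linarith
      from this[OF DB'[of k] DB'[of "Suc k", unfolded sum.lessThan_Suc]] show ?thesis .
    qed
    finally show ?thesis .
  qed
  from Abel_lemma[OF _ x(2) this]
  have "summable (\<lambda>k. norm (1 / Gamma (\<alpha> * real k + b)) * \<bar>z\<bar> ^ k)" by simp
  then have "summable (\<lambda>k. norm ((1 / Gamma (\<alpha> * real k + b)) * z ^ k))"
    by (simp add: norm_mult power_abs abs_mult)
  then show ?thesis by (rule summable_norm_cancel)
qed

lemma abs_mittag_leffler_leI:
  assumes "summable (\<lambda>k. (1 / Gamma (\<alpha> * real k + b)) * (- x) ^ k)"
    and "\<And>N. \<bar>\<Sum>k<N. (- x) ^ k / Gamma (\<alpha> * real k + b)\<bar> \<le> D + (1 / 2) ^ N * B"
  shows "\<bar>mittag_leffler \<alpha> b (- x)\<bar> \<le> D"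
proof -
  have "(\<lambda>N. \<Sum>k<N. (- x) ^ k / Gamma (\<alpha> * real k + b)) \<longlonglongrightarrow> mittag_leffler \<alpha> b (- x)"
    unfolding mittag_leffler_def using assms(1) by (intro summable_LIMSEQ) simp
  then have "(\<lambda>N. \<bar>\<Sum>k<N. (- x) ^ k / Gamma (\<alpha> * real k + b)\<bar>) \<longlonglongrightarrow> \<bar>mittag_leffler \<alpha> b (- x)\<bar>"
    by (rule tendsto_rabs)
  moreover have "(\<lambda>N. D + (1 / 2) ^ N * B) \<longlonglongrightarrow> D + 0 * B"
    by (intro tendsto_intros LIMSEQ_power_zero) auto
  ultimately show ?thesis using assms(2) by (intro LIMSEQ_le) auto
qed

lemma mittag_leffler_summable:
  assumes "1 < \<alpha>" "\<alpha> < 2"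
  shows "summable (\<lambda>k. (1 / Gamma (\<alpha> * real k + \<alpha>)) * z ^ k)"
    and "summable (\<lambda>k. (1 / Gamma (\<alpha> * real k + (\<alpha> - 1))) * z ^ k)"
proof -
  obtain K where "\<And>x. x > 0 \<Longrightarrow> \<exists>B. \<forall>N.
      \<bar>\<Sum>k<N. (- x) ^ k / Gamma (\<alpha> * real k + \<alpha>)\<bar> \<le> K / x + (1 / 2) ^ N * B"
    using mittag_leffler_decay_partial[OF assms] by blast
  then show "summable (\<lambda>k. (1 / Gamma (\<alpha> * real k + \<alpha>)) * z ^ k)"
    by (intro mittag_leffler_summableI) blast
  obtain K where "\<And>x. x > 0 \<Longrightarrow> \<exists>B. \<forall>N.
      \<bar>\<Sum>k<N. (- x) ^ k / Gamma (\<alpha> * real k + (\<alpha> - 1))\<bar> \<le> K + (1 / 2) ^ N * B"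
    using mittag_leffler_bounded_partial[OF assms] by blast
  then show "summable (\<lambda>k. (1 / Gamma (\<alpha> * real k + (\<alpha> - 1))) * z ^ k)"
    by (intro mittag_leffler_summableI) blast
qed

text \<open>Termwise, the identity is the functional equation of \<open>Gamma\<close> at \<alpha>k +
  \<alpha> - 1. It says that r^(\<alpha>-1) E_{\<alpha>,\<alpha>}(-L r^\<alpha>) has the derivative
  r^(\<alpha>-2) E_{\<alpha>,\<alpha>-1}(-L r^\<alpha>), which is where the second parameter
  \<alpha> - 1 comes from.\<close>

lemma mittag_leffler_has_derivative:
  assumes "1 < \<alpha>" "\<alpha> < 2"
  obtains E' where "\<And>z. (mittag_leffler \<alpha> \<alpha> has_real_derivative E' z) (at z)"
    and "\<And>z. (\<alpha> - 1) * mittag_leffler \<alpha> \<alpha> z + \<alpha> * z * E' z = mittag_leffler \<alpha> (\<alpha> - 1) z"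
proof -
  define c where "c k = 1 / Gamma (\<alpha> * real k + \<alpha>)" for k
  have sm: "summable (\<lambda>k. c k * z ^ k)" for z
    using mittag_leffler_summable(1)[OF assms] unfolding c_def .
  have mlf: "mittag_leffler \<alpha> \<alpha> = (\<lambda>z. \<Sum>k. c k * z ^ k)"
    unfolding mittag_leffler_def c_def by simp
  show ?thesis
  proof
    fix z
    show "(mittag_leffler \<alpha> \<alpha> has_real_derivative (\<Sum>k. diffs c k * z ^ k)) (at z)"
      unfolding mlf by (rule termdiffs_strong_converges_everywhere[OF sm])
    have "summable (\<lambda>k. diffs c k * z ^ k)"
      by (rule termdiff_converges_all[OF sm])
    from diffs_equiv[OF this]
    have "(\<lambda>k. \<alpha> * z * (real k * c k * z ^ (k - Suc 0))) sums (\<alpha> * z * (\<Sum>k. diffs c k * z ^ k))"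
      by (intro sums_mult) simp
    moreover have "(\<lambda>k. (\<alpha> - 1) * (c k * z ^ k)) sums ((\<alpha> - 1) * mittag_leffler \<alpha> \<alpha> z)"
      unfolding mlf using sm by (intro sums_mult summable_sums)
    ultimately have "(\<lambda>k. (\<alpha> - 1) * (c k * z ^ k) + \<alpha> * z * (real k * c k * z ^ (k - Suc 0)))
        sums ((\<alpha> - 1) * mittag_leffler \<alpha> \<alpha> z + \<alpha> * z * (\<Sum>k. diffs c k * z ^ k))"
      by (intro sums_add)
    moreover have "(\<alpha> - 1) * (c k * z ^ k) + \<alpha> * z * (real k * c k * z ^ (k - Suc 0))
        = z ^ k / Gamma (\<alpha> * real k + (\<alpha> - 1))" for k
    proof -
      have pos: "\<alpha> * real k + (\<alpha> - 1) > 0" using assms by (intro add_nonneg_pos) auto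
      then have "Gamma ((\<alpha> * real k + (\<alpha> - 1)) + 1) = (\<alpha> * real k + (\<alpha> - 1)) * Gamma (\<alpha> * real k + (\<alpha> - 1))"
        by (intro Gamma_plus1) (auto elim!: nonpos_Ints_cases)
      then have G: "Gamma (\<alpha> * real k + \<alpha>) = (\<alpha> * real k + (\<alpha> - 1)) * Gamma (\<alpha> * real k + (\<alpha> - 1))"
        by (simp add: algebra_simps)
      have "\<alpha> * z * (real k * c k * z ^ (k - Suc 0)) = \<alpha> * real k * (c k * z ^ k)"
        by (cases k) auto
      then have "(\<alpha> - 1) * (c k * z ^ k) + \<alpha> * z * (real k * c k * z ^ (k - Suc 0))
          = (\<alpha> * real k + (\<alpha> - 1)) * c k * z ^ k" by (simp add: algebra_simps)
      also have "(\<alpha> * real k + (\<alpha> - 1)) * c k = 1 / Gamma (\<alpha> * real k + (\<alpha> - 1))"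
        unfolding c_def G using pos by simp
      finally show ?thesis by simp
    qed
    ultimately show "(\<alpha> - 1) * mittag_leffler \<alpha> \<alpha> z + \<alpha> * z * (\<Sum>k. diffs c k * z ^ k) = mittag_leffler \<alpha> (\<alpha> - 1) z"
      unfolding mittag_leffler_def by (simp add: sums_iff)
  qed
qed

text \<open>The exponent (\<alpha> - 1) / \<alpha> lies strictly between 0 and 1. For
  \<open>x > 1\<close> the decay \<open>K / x\<close> therefore absorbs the power; for
  \<open>x \<le> 1\<close> the power is at most 1 and continuity on a compact interval
  suffices.\<close>

lemma mittag_leffler_bounds:
  assumes "1 < \<alpha>" "\<alpha> < 2"
  obtains C where "C > 0"
    and "\<And>x. x > 0 \<Longrightarrow> x powr ((\<alpha> - 1) / \<alpha>) * \<bar>mittag_leffler \<alpha> \<alpha> (- x)\<bar> \<le> C"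
    and "\<And>x. x > 0 \<Longrightarrow> \<bar>mittag_leffler \<alpha> (\<alpha> - 1) (- x)\<bar> \<le> C"
proof -
  obtain K where K: "K > 0" "\<And>x. x > 0 \<Longrightarrow> \<exists>B. \<forall>N.
      \<bar>\<Sum>k<N. (- x) ^ k / Gamma (\<alpha> * real k + \<alpha>)\<bar> \<le> K / x + (1 / 2) ^ N * B"
    using mittag_leffler_decay_partial[OF assms] by blast
  obtain K' where K': "K' > 0" "\<And>x. x > 0 \<Longrightarrow> \<exists>B. \<forall>N.
      \<bar>\<Sum>k<N. (- x) ^ k / Gamma (\<alpha> * real k + (\<alpha> - 1))\<bar> \<le> K' + (1 / 2) ^ N * B"
    using mittag_leffler_bounded_partial[OF assms] by blast
  obtain E' where E': "\<And>z. (mittag_leffler \<alpha> \<alpha> has_real_derivative E' z) (at z)"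
    using mittag_leffler_has_derivative[OF assms] by metis
  then have "continuous_on {-1..0} (mittag_leffler \<alpha> \<alpha>)"
    by (meson DERIV_isCont continuous_at_imp_continuous_on)
  then have "bounded (mittag_leffler \<alpha> \<alpha> ` {-1..0})"
    by (intro compact_imp_bounded compact_continuous_image) auto
  then obtain D where D: "\<And>z. z \<in> {-1..0} \<Longrightarrow> \<bar>mittag_leffler \<alpha> \<alpha> z\<bar> \<le> D"
    unfolding bounded_iff by (metis imageI real_norm_def)
  have ED: "\<bar>mittag_leffler \<alpha> \<alpha> (- x)\<bar> \<le> K / x" if "x > 0" for x
    using K(2)[OF that] abs_mittag_leffler_leI[OF mittag_leffler_summable(1)[OF assms]] by blast
  have EB: "\<bar>mittag_leffler \<alpha> (\<alpha> - 1) (- x)\<bar> \<le> K'" if "x > 0" for x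
    using K'(2)[OF that] abs_mittag_leffler_leI[OF mittag_leffler_summable(2)[OF assms]] by blast
  have exps: "0 < (\<alpha> - 1) / \<alpha>" "(\<alpha> - 1) / \<alpha> < 1" using assms by (auto simp: field_simps)
  show ?thesis
  proof
    show "K + K' + \<bar>D\<bar> > 0" using K K' by linarith
    fix x :: real assume x: "x > 0"
    show "\<bar>mittag_leffler \<alpha> (\<alpha> - 1) (- x)\<bar> \<le> K + K' + \<bar>D\<bar>" using EB[OF x] K(1) by linarith
    show "x powr ((\<alpha> - 1) / \<alpha>) * \<bar>mittag_leffler \<alpha> \<alpha> (- x)\<bar> \<le> K + K' + \<bar>D\<bar>"
    proof (cases "x \<le> 1")
      case True
      have "x powr ((\<alpha> - 1) / \<alpha>) * \<bar>mittag_leffler \<alpha> \<alpha> (- x)\<bar> \<le> 1 * D"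
        using True x exps by (intro mult_mono D) (auto intro!: powr_le1)
      then show ?thesis using K(1) K'(1) by linarith
    next
      case False
      have "x powr ((\<alpha> - 1) / \<alpha>) * \<bar>mittag_leffler \<alpha> \<alpha> (- x)\<bar> \<le> x powr 1 * (K / x)"
        using False x exps by (intro mult_mono ED powr_mono) auto
      then show ?thesis using x K'(1) by simp
    qed
  qed
qed

section \<open>Kernel bounds uniform in the mode\<close>

lemma eigval_pos: "k \<ge> 1 \<Longrightarrow> eigval k > 0"
  by (simp add: eigval_def)

lemma continuous_on_mild_kernel:
  assumes "1 < \<alpha>" "\<alpha> < 2"
  shows "continuous_on {0..} (mild_kernel \<alpha> \<beta> k)"
proof -
  obtain E' where E': "\<And>z. (mittag_leffler \<alpha> \<alpha> has_real_derivative E' z) (at z)"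
    using mittag_leffler_has_derivative[OF assms] by metis
  have E: "continuous_on UNIV (mittag_leffler \<alpha> \<alpha>)"
    by (meson E' DERIV_isCont continuous_at_imp_continuous_on)
  show ?thesis
    unfolding mild_kernel_def
    by (intro continuous_intros continuous_on_compose2[OF E] continuous_on_powr') (use assms in auto)
qed

text \<open>With \<open>x = eigval k powr \<beta> * r powr \<alpha>\<close> the factor
  \<open>r powr (\<alpha> - 1)\<close> equals \<open>x powr ((\<alpha> - 1) / \<alpha>)\<close>
  times the stated power of the eigenvalue, and the rest is bounded. For increments, the derivative
  is at most \<open>K * y powr (\<alpha> - 2)\<close> in modulus for every \<open>k\<close>;
  integrating this gives the summand \<open>K / (\<alpha> - 1)\<close> of \<open>C\<close>.\<close>

lemma mild_kernel_bounds:
  assumes "1 < \<alpha>" "\<alpha> < 2"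
  obtains C where "C > 0"
    and "\<And>k r. k \<ge> 1 \<Longrightarrow> r \<ge> 0 \<Longrightarrow> \<bar>mild_kernel \<alpha> \<beta> k r\<bar> \<le> C * eigval k powr (- (\<beta> * (\<alpha> - 1) / \<alpha>))"
    and "\<And>k r s. k \<ge> 1 \<Longrightarrow> 0 \<le> s \<Longrightarrow> s \<le> r \<Longrightarrow>
        \<bar>mild_kernel \<alpha> \<beta> k r - mild_kernel \<alpha> \<beta> k s\<bar> \<le> C * (r powr (\<alpha> - 1) - s powr (\<alpha> - 1))"
proof -
  obtain K where K: "K > 0" "\<And>x. x > 0 \<Longrightarrow> x powr ((\<alpha> - 1) / \<alpha>) * \<bar>mittag_leffler \<alpha> \<alpha> (- x)\<bar> \<le> K"
    "\<And>x. x > 0 \<Longrightarrow> \<bar>mittag_leffler \<alpha> (\<alpha> - 1) (- x)\<bar> \<le> K"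
    using mittag_leffler_bounds[OF assms] by metis
  obtain E' where E': "\<And>z. (mittag_leffler \<alpha> \<alpha> has_real_derivative E' z) (at z)"
    "\<And>z. (\<alpha> - 1) * mittag_leffler \<alpha> \<alpha> z + \<alpha> * z * E' z = mittag_leffler \<alpha> (\<alpha> - 1) z"
    using mittag_leffler_has_derivative[OF assms] by metis
  define C where "C = K + K / (\<alpha> - 1)"
  have C: "C > 0" "C \<ge> K" "C \<ge> K / (\<alpha> - 1)"
    using K(1) assms by (auto simp: C_def intro: add_pos_pos)
  show ?thesis
  proof
    show "C > 0" by fact
    fix k :: nat and r :: real assume k: "k \<ge> 1" and r: "r \<ge> 0"
    let ?L = "eigval k powr \<beta>"
    have L: "?L > 0" using eigval_pos[OF k] by simp
    show "\<bar>mild_kernel \<alpha> \<beta> k r\<bar> \<le> C * eigval k powr (- (\<beta> * (\<alpha> - 1) / \<alpha>))"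
    proof (cases "r = 0")
      case False
      then have r0: "r > 0" using r by simp
      let ?x = "?L * r powr \<alpha>"
      have x: "?x > 0" using L r0 by simp
      have "?x powr ((\<alpha> - 1) / \<alpha>) = eigval k powr (\<beta> * (\<alpha> - 1) / \<alpha>) * r powr (\<alpha> - 1)"
        using L r0 assms by (simp add: powr_mult powr_powr)
      then have "r powr (\<alpha> - 1) = ?x powr ((\<alpha> - 1) / \<alpha>) * eigval k powr (- (\<beta> * (\<alpha> - 1) / \<alpha>))"
        using eigval_pos[OF k] by (simp add: powr_minus field_simps)
      then have "\<bar>mild_kernel \<alpha> \<beta> k r\<bar> = (?x powr ((\<alpha> - 1) / \<alpha>) * \<bar>mittag_leffler \<alpha> \<alpha> (- ?x)\<bar>) * eigval k powr (- (\<beta> * (\<alpha> - 1) / \<alpha>))"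
        by (simp add: mild_kernel_def abs_mult)
      also have "\<dots> \<le> C * eigval k powr (- (\<beta> * (\<alpha> - 1) / \<alpha>))"
        using K(2)[OF x] C by (intro mult_right_mono) auto
      finally show ?thesis .
    qed (use C in \<open>simp add: mild_kernel_def\<close>)
  next
    fix k :: nat and r s :: real assume k: "k \<ge> 1" and s: "0 \<le> s" "s \<le> r"
    let ?L = "eigval k powr \<beta>"
    have L: "?L > 0" using eigval_pos[OF k] by simp
    have der: "(mild_kernel \<alpha> \<beta> k has_real_derivative y powr (\<alpha> - 2) * mittag_leffler \<alpha> (\<alpha> - 1) (- (?L * y powr \<alpha>))) (at y)"
      if y: "y > 0" for y
    proof -
      let ?z = "\<lambda>y. - (?L * y powr \<alpha>)"
      have "((\<lambda>y. y powr (\<alpha> - 1) * mittag_leffler \<alpha> \<alpha> (?z y)) has_real_derivative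
          (\<alpha> - 1) * y powr (\<alpha> - 1 - 1) * mittag_leffler \<alpha> \<alpha> (?z y)
          + E' (?z y) * (- (?L * (\<alpha> * y powr (\<alpha> - 1)))) * y powr (\<alpha> - 1)) (at y)"
        using y by (intro DERIV_mult DERIV_chain2[OF E'(1)] DERIV_minus DERIV_cmult has_real_derivative_powr)
      moreover have "(\<alpha> - 1) * y powr (\<alpha> - 1 - 1) * mittag_leffler \<alpha> \<alpha> (?z y)
          + E' (?z y) * (- (?L * (\<alpha> * y powr (\<alpha> - 1)))) * y powr (\<alpha> - 1)
          = y powr (\<alpha> - 2) * ((\<alpha> - 1) * mittag_leffler \<alpha> \<alpha> (?z y) + \<alpha> * ?z y * E' (?z y))"
      proof -
        have "y powr (\<alpha> - 1) * y powr (\<alpha> - 1) = y powr (\<alpha> - 2) * y powr \<alpha>"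
          by (simp flip: powr_add)
        then show ?thesis by (simp add: algebra_simps)
      qed
      ultimately show ?thesis unfolding E'(2) mild_kernel_def by simp
    qed
    show "\<bar>mild_kernel \<alpha> \<beta> k r - mild_kernel \<alpha> \<beta> k s\<bar> \<le> C * (r powr (\<alpha> - 1) - s powr (\<alpha> - 1))"
    proof (cases "s = r")
      case False
      then have "norm (mild_kernel \<alpha> \<beta> k r - mild_kernel \<alpha> \<beta> k s)
          \<le> (\<lambda>y. K / (\<alpha> - 1) * y powr (\<alpha> - 1)) r - (\<lambda>y. K / (\<alpha> - 1) * y powr (\<alpha> - 1)) s"
      proof (intro differentiable_bound_general)
        show "continuous_on {s..r} (mild_kernel \<alpha> \<beta> k)"
          by (rule continuous_on_subset[OF continuous_on_mild_kernel[OF assms]]) (use s in auto)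
        show "continuous_on {s..r} (\<lambda>y. K / (\<alpha> - 1) * y powr (\<alpha> - 1))"
          by (intro continuous_intros continuous_on_powr') (use s assms in auto)
        fix y assume "s < y" "y < r"
        then have y: "y > 0" using s by simp
        show "(mild_kernel \<alpha> \<beta> k has_vector_derivative y powr (\<alpha> - 2) * mittag_leffler \<alpha> (\<alpha> - 1) (- (?L * y powr \<alpha>))) (at y)"
          using der[OF y] by (simp add: has_real_derivative_iff_has_vector_derivative)
        have "((\<lambda>y. K / (\<alpha> - 1) * y powr (\<alpha> - 1)) has_real_derivative K / (\<alpha> - 1) * ((\<alpha> - 1) * y powr (\<alpha> - 1 - 1))) (at y)"
          using y by (intro DERIV_cmult has_real_derivative_powr)
        also have "K / (\<alpha> - 1) * ((\<alpha> - 1) * y powr (\<alpha> - 1 - 1)) = y powr (\<alpha> - 2) * K"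
          using assms by (simp add: field_simps)
        finally show "((\<lambda>y. K / (\<alpha> - 1) * y powr (\<alpha> - 1)) has_vector_derivative y powr (\<alpha> - 2) * K) (at y)"
          by (simp add: has_real_derivative_iff_has_vector_derivative)
        show "norm (y powr (\<alpha> - 2) * mittag_leffler \<alpha> (\<alpha> - 1) (- (?L * y powr \<alpha>))) \<le> y powr (\<alpha> - 2) * K"
          using K(3)[of "?L * y powr \<alpha>"] L y by (auto simp: abs_mult intro!: mult_left_mono)
      qed (use s in auto)
      also have "\<dots> = K / (\<alpha> - 1) * (r powr (\<alpha> - 1) - s powr (\<alpha> - 1))"
        by (simp add: algebra_simps)
      also have "\<dots> \<le> C * (r powr (\<alpha> - 1) - s powr (\<alpha> - 1))"
        using C s assms by (intro mult_right_mono) (auto intro!: powr_mono2)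
      finally show ?thesis by simp
    qed simp
  qed
qed

section \<open>The It\^o isometry\<close>

lemma has_bochner_integral_indicator_product:
  fixes a b c d :: real
  shows "has_bochner_integral lborel (\<lambda>s. indicator {a<..b} s * indicator {c<..d} s :: real) (max 0 (min b d - max a c))"
proof -
  have "(\<lambda>s. indicator {a<..b} s * indicator {c<..d} s :: real) = indicator {max a c<..min b d}"
    by (auto simp: fun_eq_iff indicator_def)
  moreover have "has_bochner_integral lborel (indicator {max a c<..min b d} :: real \<Rightarrow> real) (measure lborel {max a c<..min b d})"
    by (rule has_bochner_integral_real_indicator)
      (auto intro: emeasure_bounded_finite[unfolded infinity_ennreal_def])
  moreover have "measure lborel {max a c<..min b d} = max 0 (min b d - max a c)"
    by (cases "max a c \<le> min b d") auto
  ultimately show ?thesis by simp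
qed

text \<open>The intervals may overlap, and the \<open>max 0\<close> terms are the lengths of their
  intersections. The second moment of a sum of weighted Wiener increments is the same quadratic form
  with expectations of products of weights; that the form is nonnegative is seen from the
  integral.\<close>

lemma step_function_square_integral:
  fixes a b c :: "'j \<Rightarrow> real"
  assumes "finite J"
  defines "I \<equiv> \<Sum>i\<in>J. \<Sum>j\<in>J. c i * c j * max 0 (min (b i) (b j) - max (a i) (a j))"
  shows "(\<integral>\<^sup>+s. ennreal ((\<Sum>j\<in>J. c j * indicator {a j<..b j} s)\<^sup>2) \<partial>lborel) = ennreal I" and "I \<ge> 0"
proof -
  have eq: "(\<Sum>j\<in>J. c j * indicator {a j<..b j} s)\<^sup>2
      = (\<Sum>i\<in>J. \<Sum>j\<in>J. c i * c j * (indicator {a i<..b i} s * indicator {a j<..b j} s))" for s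
    by (simp add: power2_eq_square sum_product ac_simps)
  have I: "has_bochner_integral lborel (\<lambda>s. (\<Sum>j\<in>J. c j * indicator {a j<..b j} s)\<^sup>2) I"
    unfolding eq I_def
    by (intro has_bochner_integral_sum has_bochner_integral_mult_right has_bochner_integral_indicator_product)
  then show "(\<integral>\<^sup>+s. ennreal ((\<Sum>j\<in>J. c j * indicator {a j<..b j} s)\<^sup>2) \<partial>lborel) = ennreal I"
    by (subst nn_integral_eq_integral) (auto simp: has_bochner_integral_iff)
  show "I \<ge> 0"
    using I Bochner_Integration.integral_nonneg[of lborel "\<lambda>s. (\<Sum>j\<in>J. c j * indicator {a j<..b j} s)\<^sup>2"]
    by (auto simp: has_bochner_integral_iff)
qed

locale wiener = prob_space M for M :: "'a measure" +
  fixes F :: "real \<Rightarrow> 'a measure" and W :: "real \<Rightarrow> 'a \<Rightarrow> real"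
  assumes filtration: "filtration (space M) F"
    and subalgebra: "\<And>t. subalgebra M (F t)"
    and wiener: "wiener_process M F W"
begin

lemma measurable_F_mono:
  assumes "s \<le> t" "f \<in> borel_measurable (F s)"
  shows "f \<in> borel_measurable (F t)"
proof -
  interpret filtration "space M" F by (rule filtration)
  have "borel_measurable (F s) \<subseteq> borel_measurable (F t)"
    using sets_F_mono[OF assms(1)] by (intro measurable_mono) (auto simp: space_F)
  then show ?thesis using assms(2) by auto
qed

lemma measurable_F_imp: "f \<in> borel_measurable (F s) \<Longrightarrow> f \<in> borel_measurable M"
  using measurable_from_subalg[OF subalgebra] .

lemma W_measurable_F: "0 \<le> s \<Longrightarrow> s \<le> t \<Longrightarrow> W s \<in> borel_measurable (F t)"
  using wiener measurable_F_mono[of s t "W s"] by (auto simp: wiener_process_def)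

lemma W_measurable: "0 \<le> s \<Longrightarrow> W s \<in> borel_measurable M"
  using W_measurable_F[of s s] measurable_F_imp by blast

text \<open>\<open>wiener_process\<close> asserts independence of \<open>F s\<close> from the
  preimages under the increment. Both families are stable under intersection, so it extends to the
  sigma-algebras that they generate, as independence of random variables requires.\<close>

lemma indep_increment:
  assumes "0 \<le> s" "s < t" and Z: "Z \<in> borel_measurable (F s)"
  shows "indep_var borel Z borel (\<lambda>\<omega>. W t \<omega> - W s \<omega>)"
proof -
  interpret filtration "space M" F by (rule filtration)
  let ?D = "\<lambda>\<omega>. W t \<omega> - W s \<omega>"
  let ?G = "{?D -` A \<inter> space M | A. A \<in> sets borel}"
  have "indep_set (sets (F s)) ?G"
    using wiener assms(1,2) by (auto simp: wiener_process_def)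
  moreover have "Int_stable ?G"
    unfolding Int_stable_def
  proof (intro ballI)
    fix a b assume "a \<in> ?G" "b \<in> ?G"
    then obtain A B where "a = ?D -` A \<inter> space M" "b = ?D -` B \<inter> space M" "A \<in> sets borel" "B \<in> sets borel"
      by auto
    then show "a \<inter> b \<in> ?G" by (intro CollectI exI[of _ "A \<inter> B"]) auto
  qed
  ultimately have ind: "indep_set (sigma_sets (space M) (sets (F s))) (sigma_sets (space M) ?G)"
    by (intro indep_set_sigma_sets sets.Int_stable)
  have "{Z -` A \<inter> space M | A. A \<in> sets borel} \<subseteq> sets (F s)"
    using measurable_sets[OF Z] by (auto simp: space_F)
  then have "sigma_sets (space M) {Z -` A \<inter> space M | A. A \<in> sets borel} \<subseteq> sigma_sets (space M) (sets (F s))"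
    by (rule sigma_sets_mono')
  then have "indep_set (sigma_sets (space M) {Z -` A \<inter> space M | A. A \<in> sets borel}) (sigma_sets (space M) ?G)"
    using ind unfolding indep_sets2_eq by blast
  moreover have "?D \<in> borel_measurable M"
    using assms by (intro borel_measurable_diff W_measurable) auto
  ultimately show ?thesis
    using measurable_F_imp[OF Z] unfolding indep_var_eq by auto
qed

lemma increment_moments:
  assumes "0 \<le> s" "s < t"
  shows "integrable M (\<lambda>\<omega>. W t \<omega> - W s \<omega>)" "expectation (\<lambda>\<omega>. W t \<omega> - W s \<omega>) = 0"
    and "integrable M (\<lambda>\<omega>. (W t \<omega> - W s \<omega>)\<^sup>2)" "expectation (\<lambda>\<omega>. (W t \<omega> - W s \<omega>)\<^sup>2) = t - s"
proof -
  have D: "distributed M lborel (\<lambda>\<omega>. W t \<omega> - W s \<omega>) (\<lambda>x. ennreal (normal_density 0 (sqrt (t - s)) x))"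
    using wiener assms by (auto simp: wiener_process_def)
  have pos: "sqrt (t - s) > 0" using assms by simp
  show "integrable M (\<lambda>\<omega>. W t \<omega> - W s \<omega>)"
    using distributed_integrable[OF D, of "\<lambda>x. x"] integrable_normal_moment_nz_1[OF pos, of 0] by simp
  show "integrable M (\<lambda>\<omega>. (W t \<omega> - W s \<omega>)\<^sup>2)"
    using distributed_integrable[OF D, of "\<lambda>x. x\<^sup>2"] integrable_normal_moment[OF pos, of 0 2] by simp
  show e: "expectation (\<lambda>\<omega>. W t \<omega> - W s \<omega>) = 0"
    by (rule normal_distributed_expectation[OF pos D])
  show "expectation (\<lambda>\<omega>. (W t \<omega> - W s \<omega>)\<^sup>2) = t - s"
    using normal_distributed_variance[OF pos D] assms unfolding e by simp
qed

lemma increment_expectation: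
  assumes "0 \<le> s" "s \<le> t" and Z: "Z \<in> borel_measurable (F s)" "integrable M Z"
  shows "integrable M (\<lambda>\<omega>. Z \<omega> * (W t \<omega> - W s \<omega>))" (is ?A)
    and "expectation (\<lambda>\<omega>. Z \<omega> * (W t \<omega> - W s \<omega>)) = 0" (is ?B)
    and "integrable M (\<lambda>\<omega>. Z \<omega> * (W t \<omega> - W s \<omega>)\<^sup>2)" (is ?C)
    and "expectation (\<lambda>\<omega>. Z \<omega> * (W t \<omega> - W s \<omega>)\<^sup>2) = expectation Z * (t - s)" (is ?D)
proof -
  have "?A \<and> ?B \<and> ?C \<and> ?D"
  \<comment> \<open>\<open>wiener_process\<close> speaks of \<open>s < t\<close> only; for
    \<open>s = t\<close> the increment is \<open>0\<close>.\<close>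
  proof (cases "s = t")
    case False
    then have st: "s < t" using assms by simp
    note ind = indep_increment[OF assms(1) st Z(1)]
    note mom = increment_moments[OF assms(1) st]
    have "indep_var borel (id \<circ> Z) borel ((\<lambda>x. x\<^sup>2) \<circ> (\<lambda>\<omega>. W t \<omega> - W s \<omega>))"
      by (rule indep_var_compose[OF ind]) auto
    then have ind2: "indep_var borel Z borel (\<lambda>\<omega>. (W t \<omega> - W s \<omega>)\<^sup>2)"
      by (simp add: o_def)
    show ?thesis
      using indep_var_integrable[OF ind Z(2) mom(1)] indep_var_lebesgue_integral[OF ind Z(2) mom(1)]
        indep_var_integrable[OF ind2 Z(2) mom(3)] indep_var_lebesgue_integral[OF ind2 Z(2) mom(3)]
      by (simp add: mom)
  qed simp
  then show ?A ?B ?C ?D by blast+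
qed

text \<open>The excess \<open>W q - W p\<close> has mean zero and is independent of
  \<open>F p\<close>, so only the square of the common part contributes.\<close>

lemma increment_covariance_common_start:
  assumes "0 \<le> c" "c \<le> p" "p \<le> q" and Z: "Z \<in> borel_measurable (F c)" "integrable M Z"
  shows "integrable M (\<lambda>\<omega>. Z \<omega> * ((W p \<omega> - W c \<omega>) * (W q \<omega> - W c \<omega>)))"
    and "expectation (\<lambda>\<omega>. Z \<omega> * ((W p \<omega> - W c \<omega>) * (W q \<omega> - W c \<omega>))) = expectation Z * (p - c)"
proof -
  note 1 = increment_expectation[OF assms(1,2) Z]
  have "(\<lambda>\<omega>. Z \<omega> * (W p \<omega> - W c \<omega>)) \<in> borel_measurable (F p)"
    using assms by (intro borel_measurable_times borel_measurable_diff W_measurable_F measurable_F_mono[OF _ Z(1)]) auto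
  note 2 = increment_expectation(1,2)[OF _ assms(3) this 1(1)]
  have p: "0 \<le> p" using assms by simp
  have eq: "Z \<omega> * ((W p \<omega> - W c \<omega>) * (W q \<omega> - W c \<omega>))
      = Z \<omega> * (W p \<omega> - W c \<omega>)\<^sup>2 + Z \<omega> * (W p \<omega> - W c \<omega>) * (W q \<omega> - W p \<omega>)" for \<omega>
    by (simp add: algebra_simps power2_eq_square)
  show "integrable M (\<lambda>\<omega>. Z \<omega> * ((W p \<omega> - W c \<omega>) * (W q \<omega> - W c \<omega>)))"
    unfolding eq using 1 2 p by (intro Bochner_Integration.integrable_add) auto
  show "expectation (\<lambda>\<omega>. Z \<omega> * ((W p \<omega> - W c \<omega>) * (W q \<omega> - W c \<omega>))) = expectation Z * (p - c)"
    unfolding eq using 1 2 p by (subst Bochner_Integration.integral_add) auto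
qed

lemma integrable_bounded:
  assumes "f \<in> borel_measurable M" "\<And>\<omega>. \<omega> \<in> space M \<Longrightarrow> \<bar>f \<omega>\<bar> \<le> (B::real)"
  shows "integrable M f"
  by (rule integrable_const_bound[of _ B]) (use assms in auto)

text \<open>The interval that starts first is cut at \<open>min b c\<close>. The part before
  \<open>c\<close>, multiplied by both weights, is measurable at time \<open>c\<close>, so its
  product with the other increment has mean zero. What remains, if anything, starts at
  \<open>c\<close> like the other interval.\<close>

lemma increment_covariance:
  assumes ab: "0 \<le> a" "a \<le> b" and cd: "0 \<le> c" "c \<le> d" and ac: "a \<le> c"
    and h: "h \<in> borel_measurable (F a)" "\<And>\<omega>. \<omega> \<in> space M \<Longrightarrow> \<bar>h \<omega>\<bar> \<le> B"
    and k: "k \<in> borel_measurable (F c)" "\<And>\<omega>. \<omega> \<in> space M \<Longrightarrow> \<bar>k \<omega>\<bar> \<le> B'"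
  shows "integrable M (\<lambda>\<omega>. h \<omega> * (W b \<omega> - W a \<omega>) * (k \<omega> * (W d \<omega> - W c \<omega>)))"
    and "expectation (\<lambda>\<omega>. h \<omega> * (W b \<omega> - W a \<omega>) * (k \<omega> * (W d \<omega> - W c \<omega>)))
       = expectation (\<lambda>\<omega>. h \<omega> * k \<omega>) * max 0 (min b d - max a c)"
proof -
  let ?x = "min b c"
  have hc: "h \<in> borel_measurable (F c)" by (rule measurable_F_mono[OF ac h(1)])
  have hk: "(\<lambda>\<omega>. h \<omega> * k \<omega>) \<in> borel_measurable (F c)" using hc k(1) by simp
  have bd: "\<bar>h \<omega> * k \<omega>\<bar> \<le> B * B'" if "\<omega> \<in> space M" for \<omega>
    unfolding abs_mult using h(2)[OF that] k(2)[OF that] by (intro mult_mono) auto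
  have int_hk: "integrable M (\<lambda>\<omega>. h \<omega> * k \<omega>)"
    using measurable_F_imp[OF hk] bd by (rule integrable_bounded)
  have x: "a \<le> ?x" "0 \<le> ?x" "?x \<le> c" using ab ac by auto
  have int1: "integrable M (\<lambda>\<omega>. h \<omega> * k \<omega> * (W ?x \<omega> - W a \<omega>))"
  proof -
    have "integrable M (\<lambda>\<omega>. 1 * (W ?x \<omega> - W a \<omega>))"
      by (rule increment_expectation) (use ab x in auto)
    then have "integrable M (\<lambda>\<omega>. (B * B') * (W ?x \<omega> - W a \<omega>))" by (intro integrable_mult_right) simp
    then show ?thesis
    proof (rule Bochner_Integration.integrable_bound)
      show "(\<lambda>\<omega>. h \<omega> * k \<omega> * (W ?x \<omega> - W a \<omega>)) \<in> borel_measurable M"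
        using measurable_F_imp[OF hk] W_measurable[OF x(2)] W_measurable[OF ab(1)] by simp
      show "AE \<omega> in M. norm (h \<omega> * k \<omega> * (W ?x \<omega> - W a \<omega>)) \<le> norm (B * B' * (W ?x \<omega> - W a \<omega>))"
      proof (intro AE_I2)
        fix \<omega> assume "\<omega> \<in> space M"
        from order_trans[OF bd[OF this] abs_ge_self]
        show "norm (h \<omega> * k \<omega> * (W ?x \<omega> - W a \<omega>)) \<le> norm (B * B' * (W ?x \<omega> - W a \<omega>))"
          unfolding real_norm_def abs_mult[of _ "W ?x \<omega> - W a \<omega>"] by (rule mult_right_mono) simp
      qed
    qed
  qed
  have m1: "(\<lambda>\<omega>. h \<omega> * k \<omega> * (W ?x \<omega> - W a \<omega>)) \<in> borel_measurable (F c)"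
    by (rule borel_measurable_times[OF hk borel_measurable_diff[OF W_measurable_F W_measurable_F]])
      (use ab x ac in auto)
  note P2 = increment_expectation(1,2)[OF cd m1 int1]
  have "integrable M (\<lambda>\<omega>. h \<omega> * (W b \<omega> - W a \<omega>) * (k \<omega> * (W d \<omega> - W c \<omega>))) \<and>
    expectation (\<lambda>\<omega>. h \<omega> * (W b \<omega> - W a \<omega>) * (k \<omega> * (W d \<omega> - W c \<omega>)))
       = expectation (\<lambda>\<omega>. h \<omega> * k \<omega>) * max 0 (min b d - max a c)"
  proof (cases "b \<le> c")
    case True
    then have "?x = b" by simp
    moreover have "max 0 (min b d - max a c) = 0" using True ac by simp
    moreover have eq: "h \<omega> * (W b \<omega> - W a \<omega>) * (k \<omega> * (W d \<omega> - W c \<omega>)) = h \<omega> * k \<omega> * (W b \<omega> - W a \<omega>) * (W d \<omega> - W c \<omega>)" for \<omega>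
      by simp
    ultimately show ?thesis unfolding eq using P2 by simp
  next
    case False
    then have xc: "?x = c" by simp
    have P1: "integrable M (\<lambda>\<omega>. h \<omega> * k \<omega> * ((W b \<omega> - W c \<omega>) * (W d \<omega> - W c \<omega>)))
      \<and> expectation (\<lambda>\<omega>. h \<omega> * k \<omega> * ((W b \<omega> - W c \<omega>) * (W d \<omega> - W c \<omega>))) = expectation (\<lambda>\<omega>. h \<omega> * k \<omega>) * (min b d - c)"
    proof (cases "b \<le> d")
      case True
      then show ?thesis
        using increment_covariance_common_start[OF cd(1) _ True hk int_hk] False by simp
    next
      case F: False
      then show ?thesis
        using increment_covariance_common_start[OF cd(1) cd(2) _ hk int_hk, of b] by (simp add: mult.commute)
    qed
    have o: "max 0 (min b d - max a c) = min b d - c" using False cd ac by simp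
    have eq: "h \<omega> * (W b \<omega> - W a \<omega>) * (k \<omega> * (W d \<omega> - W c \<omega>))
        = h \<omega> * k \<omega> * (W c \<omega> - W a \<omega>) * (W d \<omega> - W c \<omega>) + h \<omega> * k \<omega> * ((W b \<omega> - W c \<omega>) * (W d \<omega> - W c \<omega>))" for \<omega>
      by (simp add: algebra_simps)
    show ?thesis unfolding eq o using P1 P2 unfolding xc
      by (simp add: Bochner_Integration.integral_add)
  qed
  then show "integrable M (\<lambda>\<omega>. h \<omega> * (W b \<omega> - W a \<omega>) * (k \<omega> * (W d \<omega> - W c \<omega>)))"
    "expectation (\<lambda>\<omega>. h \<omega> * (W b \<omega> - W a \<omega>) * (k \<omega> * (W d \<omega> - W c \<omega>)))
       = expectation (\<lambda>\<omega>. h \<omega> * k \<omega>) * max 0 (min b d - max a c)" by blast+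
qed

text \<open>Overlapping intervals are allowed so that step processes on unrelated partitions can be
  subtracted without a common refinement. After expansion both sides are the same sum over pairs, of
  the mean product of two weights times the length of the intersection.\<close>

lemma ito_isometry_elementary:
  fixes h :: "'j \<Rightarrow> 'a \<Rightarrow> real" and a b :: "'j \<Rightarrow> real"
  assumes fin: "finite J" and ab: "\<And>j. j \<in> J \<Longrightarrow> 0 \<le> a j \<and> a j \<le> b j"
    and h: "\<And>j. j \<in> J \<Longrightarrow> h j \<in> borel_measurable (F (a j))"
    and bd: "\<And>j. j \<in> J \<Longrightarrow> \<exists>B. \<forall>\<omega>\<in>space M. \<bar>h j \<omega>\<bar> \<le> B"
  shows "(\<integral>\<^sup>+\<omega>. ennreal ((\<Sum>j\<in>J. h j \<omega> * (W (b j) \<omega> - W (a j) \<omega>))\<^sup>2) \<partial>M)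
    = (\<integral>\<^sup>+\<omega>. (\<integral>\<^sup>+s. ennreal ((\<Sum>j\<in>J. h j \<omega> * indicator {a j<..b j} s)\<^sup>2) \<partial>lborel) \<partial>M)"
proof -
  let ?o = "\<lambda>i j. max 0 (min (b i) (b j) - max (a i) (a j))"
  let ?t = "\<lambda>i j \<omega>. h i \<omega> * (W (b i) \<omega> - W (a i) \<omega>) * (h j \<omega> * (W (b j) \<omega> - W (a j) \<omega>))"
  have cov: "integrable M (?t i j) \<and> expectation (?t i j) = expectation (\<lambda>\<omega>. h i \<omega> * h j \<omega>) * ?o i j"
    if ij: "i \<in> J" "j \<in> J" for i j
  proof -
    obtain B B' where B: "\<And>\<omega>. \<omega> \<in> space M \<Longrightarrow> \<bar>h i \<omega>\<bar> \<le> B" "\<And>\<omega>. \<omega> \<in> space M \<Longrightarrow> \<bar>h j \<omega>\<bar> \<le> B'"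
      using bd[OF ij(1)] bd[OF ij(2)] by blast
    show ?thesis
    proof (cases "a i \<le> a j")
      case True
      then show ?thesis
        using increment_covariance[of "a i" "b i" "a j" "b j" "h i" B "h j" B'] ab ij h B by blast
    next
      case False
      then have "integrable M (?t j i) \<and> expectation (?t j i) = expectation (\<lambda>\<omega>. h j \<omega> * h i \<omega>) * ?o j i"
        using increment_covariance[of "a j" "b j" "a i" "b i" "h j" B' "h i" B] ab ij h B by auto
      moreover have "?t j i = ?t i j" "(\<lambda>\<omega>. h j \<omega> * h i \<omega>) = (\<lambda>\<omega>. h i \<omega> * h j \<omega>)" "?o j i = ?o i j"
        by (auto simp: fun_eq_iff ac_simps min.commute max.commute)
      ultimately show ?thesis by simp
    qed
  qed
  have int_h: "integrable M (\<lambda>\<omega>. h i \<omega> * h j \<omega>)" if ij: "i \<in> J" "j \<in> J" for i j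
  proof -
    obtain B B' where B: "\<And>\<omega>. \<omega> \<in> space M \<Longrightarrow> \<bar>h i \<omega>\<bar> \<le> B" "\<And>\<omega>. \<omega> \<in> space M \<Longrightarrow> \<bar>h j \<omega>\<bar> \<le> B'"
      using bd[OF ij(1)] bd[OF ij(2)] by blast
    show ?thesis
      using measurable_F_imp[OF h[OF ij(1)]] measurable_F_imp[OF h[OF ij(2)]] B
      by (intro integrable_bounded[of _ "B * B'"]) (force simp: abs_mult intro!: mult_mono)+
  qed
  have sq: "(\<Sum>j\<in>J. f j)\<^sup>2 = (\<Sum>i\<in>J. \<Sum>j\<in>J. f i * f j)" for f :: "'j \<Rightarrow> real"
    by (simp add: power2_eq_square sum_product)
  have "(\<integral>\<^sup>+\<omega>. ennreal ((\<Sum>j\<in>J. h j \<omega> * (W (b j) \<omega> - W (a j) \<omega>))\<^sup>2) \<partial>M)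
      = ennreal (expectation (\<lambda>\<omega>. (\<Sum>j\<in>J. h j \<omega> * (W (b j) \<omega> - W (a j) \<omega>))\<^sup>2))"
  proof (rule nn_integral_eq_integral)
    show "integrable M (\<lambda>\<omega>. (\<Sum>j\<in>J. h j \<omega> * (W (b j) \<omega> - W (a j) \<omega>))\<^sup>2)"
      unfolding sq using cov by (intro Bochner_Integration.integrable_sum) blast
  qed simp
  also have "expectation (\<lambda>\<omega>. (\<Sum>j\<in>J. h j \<omega> * (W (b j) \<omega> - W (a j) \<omega>))\<^sup>2)
      = (\<Sum>i\<in>J. \<Sum>j\<in>J. expectation (\<lambda>\<omega>. h i \<omega> * h j \<omega>) * ?o i j)"
    unfolding sq using cov by (simp add: Bochner_Integration.integral_sum)
  also have "\<dots> = expectation (\<lambda>\<omega>. \<Sum>i\<in>J. \<Sum>j\<in>J. h i \<omega> * h j \<omega> * ?o i j)"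
    using int_h by (simp add: Bochner_Integration.integral_sum)
  also have "ennreal \<dots> = (\<integral>\<^sup>+\<omega>. ennreal (\<Sum>i\<in>J. \<Sum>j\<in>J. h i \<omega> * h j \<omega> * ?o i j) \<partial>M)"
  proof (rule nn_integral_eq_integral[symmetric])
    show "integrable M (\<lambda>\<omega>. \<Sum>i\<in>J. \<Sum>j\<in>J. h i \<omega> * h j \<omega> * ?o i j)" using int_h by simp
  qed (auto intro: step_function_square_integral(2)[OF fin])
  also have "\<dots> = (\<integral>\<^sup>+\<omega>. (\<integral>\<^sup>+s. ennreal ((\<Sum>j\<in>J. h j \<omega> * indicator {a j<..b j} s)\<^sup>2) \<partial>lborel) \<partial>M)"
    by (simp add: step_function_square_integral(1)[OF fin])
  finally show ?thesis .
qed

text \<open>\<open>X\<close> is replaced by an approximating elementary integral, the isometry is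
  applied to the difference from the step sum, and then the elementary process is replaced by
  \<open>f\<close>. Each replacement costs a factor 2 on the square of what is kept; the
  approximation errors tend to zero, which leaves 4.\<close>

lemma ito_integral_step_error:
  fixes p q c :: "nat \<Rightarrow> real" and f :: "real \<Rightarrow> real"
  assumes X: "has_ito_integral M F W t (\<lambda>s \<omega>. f s) X"
    and pq: "\<And>i. i \<in> K \<Longrightarrow> 0 \<le> p i \<and> p i \<le> q i" and K: "finite K"
    and f: "(\<lambda>s. indicator {0..t} s * f s) \<in> borel_measurable borel"
  shows "(\<integral>\<^sup>+\<omega>. ennreal ((X \<omega> - (\<Sum>i\<in>K. c i * (W (q i) \<omega> - W (p i) \<omega>)))\<^sup>2) \<partial>M)
    \<le> 4 * (\<integral>\<^sup>+s. ennreal ((indicator {0..t} s * f s - (\<Sum>i\<in>K. c i * indicator {p i<..q i} s))\<^sup>2) \<partial>lborel)"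
    (is "?E \<le> 4 * ?R")
proof -
  let ?Y = "\<lambda>\<omega>. \<Sum>i\<in>K. c i * (W (q i) \<omega> - W (p i) \<omega>)"
  let ?B = "\<lambda>s. \<Sum>i\<in>K. c i * indicator {p i<..q i} s"
  let ?f = "\<lambda>s. indicator {0..t} s * f s"
  obtain m \<tau> h where el: "\<And>n. elementary_data M F t (m n) (\<tau> n) (h n)"
    and l1: "(\<lambda>n. \<integral>\<^sup>+ \<omega>. (\<integral>\<^sup>+ s. ennreal ((f s - elementary_process (m n) (\<tau> n) (h n) s \<omega>)\<^sup>2)
                 * indicator {0..t} s \<partial>lborel) \<partial>M) \<longlonglongrightarrow> 0"
    and l2: "(\<lambda>n. \<integral>\<^sup>+ \<omega>. ennreal ((X \<omega> - elementary_integral (m n) (\<tau> n) (h n) W \<omega>)\<^sup>2) \<partial>M) \<longlonglongrightarrow> 0"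
    and Xm [measurable]: "X \<in> borel_measurable M"
    using X unfolding has_ito_integral_def by auto
  let ?A = "\<lambda>n s \<omega>. elementary_process (m n) (\<tau> n) (h n) s \<omega>"
  let ?I = "\<lambda>n \<omega>. elementary_integral (m n) (\<tau> n) (h n) W \<omega>"
  let ?a = "\<lambda>n. \<integral>\<^sup>+ \<omega>. (\<integral>\<^sup>+ s. ennreal ((f s - ?A n s \<omega>)\<^sup>2) * indicator {0..t} s \<partial>lborel) \<partial>M"
  let ?b = "\<lambda>n. \<integral>\<^sup>+ \<omega>. ennreal ((X \<omega> - ?I n \<omega>)\<^sup>2) \<partial>M"
  note f [measurable]
  have sq: "ennreal ((x - z)\<^sup>2) \<le> 2 * ennreal ((x - y)\<^sup>2) + 2 * ennreal ((y - z)\<^sup>2)" for x y z :: real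
  proof -
    have "(x - z)\<^sup>2 \<le> 2 * (x - y)\<^sup>2 + 2 * (y - z)\<^sup>2"
      using zero_le_power2[of "(x - y) - (y - z)"] by (simp add: power2_eq_square algebra_simps)
    then have "ennreal ((x - z)\<^sup>2) \<le> ennreal (2 * (x - y)\<^sup>2 + 2 * (y - z)\<^sup>2)" by (rule ennreal_leI)
    then show ?thesis by (simp add: ennreal_mult)
  qed
  have bound: "?E \<le> 2 * ?b n + 4 * ?a n + 4 * ?R" for n
  proof -
    have \<tau>0: "0 \<le> \<tau> n 0" and \<tau>S: "\<And>j. j < m n \<Longrightarrow> \<tau> n j < \<tau> n (Suc j)" and \<tau>m: "\<tau> n (m n) \<le> t"
      and hF: "\<And>j. j < m n \<Longrightarrow> h n j \<in> borel_measurable (F (\<tau> n j))"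
      and hB: "\<And>j. j < m n \<Longrightarrow> \<exists>B. \<forall>\<omega>\<in>space M. \<bar>h n j \<omega>\<bar> \<le> B"
      using el[of n] unfolding elementary_data_def by auto
    have \<tau>pos: "j \<le> m n \<Longrightarrow> 0 \<le> \<tau> n j" for j
    proof (induction j)
      case (Suc j)
      then show ?case using \<tau>S[of j] by simp
    qed (use \<tau>0 in simp)
    have \<tau>le: "\<tau> n j \<le> t" if "j \<le> m n" for j
      using that
    proof (induction j rule: inc_induct)
      case (step j)
      then show ?case using \<tau>S[of j] by simp
    qed (use \<tau>m in simp)
    have [measurable]: "h n j \<in> borel_measurable M" if "j < m n" for j
      using measurable_F_imp[OF hF[OF that]] .
    have [measurable]: "W (\<tau> n j) \<in> borel_measurable M" if "j \<le> m n" for j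
      using W_measurable[OF \<tau>pos[OF that]] .
    have [measurable]: "W (p i) \<in> borel_measurable M" "W (q i) \<in> borel_measurable M" if "i \<in> K" for i
      using W_measurable pq[OF that] by auto
    have Im [measurable]: "?I n \<in> borel_measurable M"
      unfolding elementary_integral_def by (intro borel_measurable_sum) measurable
    have Ym [measurable]: "?Y \<in> borel_measurable M"
      by (intro borel_measurable_sum) measurable
    have Am [measurable]: "(\<lambda>x. ?A n (snd x) (fst x)) \<in> borel_measurable (M \<Otimes>\<^sub>M lborel)"
      unfolding elementary_process_def by (intro borel_measurable_sum) measurable
    have A1 [measurable]: "?A n s \<in> borel_measurable M" for s
      unfolding elementary_process_def by (intro borel_measurable_sum) measurable
    have A2 [measurable]: "(\<lambda>s. ?A n s \<omega>) \<in> borel_measurable borel" for \<omega>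
      unfolding elementary_process_def by (intro borel_measurable_sum) measurable
    have Bm [measurable]: "?B \<in> borel_measurable borel" by measurable
    have "?E \<le> (\<integral>\<^sup>+\<omega>. 2 * ennreal ((X \<omega> - ?I n \<omega>)\<^sup>2) + 2 * ennreal ((?I n \<omega> - ?Y \<omega>)\<^sup>2) \<partial>M)"
      by (intro nn_integral_mono sq)
    also have "\<dots> = 2 * ?b n + 2 * (\<integral>\<^sup>+\<omega>. ennreal ((?I n \<omega> - ?Y \<omega>)\<^sup>2) \<partial>M)"
      by (subst nn_integral_add) (auto simp: nn_integral_cmult)
    finally have E: "?E \<le> 2 * ?b n + 2 * (\<integral>\<^sup>+\<omega>. ennreal ((?I n \<omega> - ?Y \<omega>)\<^sup>2) \<partial>M)" .
    have "(\<integral>\<^sup>+\<omega>. ennreal ((?I n \<omega> - ?Y \<omega>)\<^sup>2) \<partial>M)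
        = (\<integral>\<^sup>+\<omega>. (\<integral>\<^sup>+s. ennreal ((?A n s \<omega> - ?B s)\<^sup>2) \<partial>lborel) \<partial>M)"
    proof -
      \<comment> \<open>The elementary process and the step function are merged into one indexed
        family, the latter with coefficients \<open>- c i\<close>, so that the isometry applies to
        their difference.\<close>
      let ?J = "{..<m n} <+> K"
      define H where "H j \<omega> = (case j of Inl j \<Rightarrow> h n j \<omega> | Inr i \<Rightarrow> - c i)" for j \<omega>
      define a where "a = case_sum (\<tau> n) p"
      define b where "b = case_sum (\<lambda>j. \<tau> n (Suc j)) q"
      have "(\<integral>\<^sup>+\<omega>. ennreal ((\<Sum>j\<in>?J. H j \<omega> * (W (b j) \<omega> - W (a j) \<omega>))\<^sup>2) \<partial>M)
        = (\<integral>\<^sup>+\<omega>. (\<integral>\<^sup>+s. ennreal ((\<Sum>j\<in>?J. H j \<omega> * indicator {a j<..b j} s)\<^sup>2) \<partial>lborel) \<partial>M)"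
      proof (rule ito_isometry_elementary)
        fix j assume j: "j \<in> ?J"
        then show "0 \<le> a j \<and> a j \<le> b j"
          using \<tau>pos \<tau>S pq by (auto simp: a_def b_def less_imp_le)
        show "H j \<in> borel_measurable (F (a j))"
          using j hF by (auto simp: H_def[abs_def] a_def)
        show "\<exists>B. \<forall>\<omega>\<in>space M. \<bar>H j \<omega>\<bar> \<le> B"
          using j hB by (auto simp: H_def)
      qed (use K in simp)
      moreover have "(\<Sum>j\<in>?J. H j \<omega> * (W (b j) \<omega> - W (a j) \<omega>)) = ?I n \<omega> - ?Y \<omega>" for \<omega>
        using K by (subst sum.Plus) (auto simp: H_def a_def b_def elementary_integral_def sum_negf)
      moreover have "(\<Sum>j\<in>?J. H j \<omega> * indicator {a j<..b j} s) = ?A n s \<omega> - ?B s" for s \<omega>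
        using K by (subst sum.Plus) (auto simp: H_def a_def b_def elementary_process_def sum_negf)
      ultimately show ?thesis by simp
    qed
    also have "\<dots> \<le> (\<integral>\<^sup>+\<omega>. 2 * (\<integral>\<^sup>+ s. ennreal ((f s - ?A n s \<omega>)\<^sup>2) * indicator {0..t} s \<partial>lborel) + 2 * ?R \<partial>M)"
    proof (rule nn_integral_mono)
      fix \<omega>
      \<comment> \<open>In \<open>has_ito_integral\<close> the error is integrated over
        \<open>{0..t}\<close>. All nodes lie in this interval, so the elementary process vanishes
        outside it, and nothing is lost in comparison with the whole line.\<close>
      have supp: "ennreal ((?A n s \<omega> - ?f s)\<^sup>2) = ennreal ((f s - ?A n s \<omega>)\<^sup>2) * indicator {0..t} s" for s
      proof (cases "s \<in> {0..t}")
        case False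
        have "h n j \<omega> * indicator {\<tau> n j<..\<tau> n (Suc j)} s = 0" if "j < m n" for j
          using False \<tau>pos[of j] \<tau>le[of "Suc j"] that by (auto simp: indicator_def)
        then have "?A n s \<omega> = 0" unfolding elementary_process_def by (intro sum.neutral) auto
        with False show ?thesis by simp
      qed (simp add: power2_commute)
      have "(\<integral>\<^sup>+s. ennreal ((?A n s \<omega> - ?B s)\<^sup>2) \<partial>lborel)
          \<le> (\<integral>\<^sup>+s. 2 * ennreal ((?A n s \<omega> - ?f s)\<^sup>2) + 2 * ennreal ((?f s - ?B s)\<^sup>2) \<partial>lborel)"
        by (intro nn_integral_mono sq)
      also have "\<dots> = 2 * (\<integral>\<^sup>+s. ennreal ((?A n s \<omega> - ?f s)\<^sup>2) \<partial>lborel) + 2 * ?R"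
        by (subst nn_integral_add) (auto simp: nn_integral_cmult)
      finally show "(\<integral>\<^sup>+s. ennreal ((?A n s \<omega> - ?B s)\<^sup>2) \<partial>lborel)
          \<le> 2 * (\<integral>\<^sup>+ s. ennreal ((f s - ?A n s \<omega>)\<^sup>2) * indicator {0..t} s \<partial>lborel) + 2 * ?R"
        unfolding supp .
    qed
    also have "\<dots> = 2 * ?a n + 2 * ?R"
    proof -
      have "(\<lambda>\<omega>. \<integral>\<^sup>+ s. ennreal ((f s - ?A n s \<omega>)\<^sup>2) * indicator {0..t} s \<partial>lborel)
          = (\<lambda>\<omega>. \<integral>\<^sup>+ s. ennreal ((?f s - ?A n s \<omega>)\<^sup>2) * indicator {0..t} s \<partial>lborel)"
        by (intro ext nn_integral_cong) (auto simp: indicator_def)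
      also have "\<dots> \<in> borel_measurable M" by measurable
      finally have [measurable]: "(\<lambda>\<omega>. \<integral>\<^sup>+ s. ennreal ((f s - ?A n s \<omega>)\<^sup>2) * indicator {0..t} s \<partial>lborel) \<in> borel_measurable M" .
      show ?thesis by (subst nn_integral_add) (auto simp: nn_integral_cmult emeasure_space_1)
    qed
    finally have "(\<integral>\<^sup>+\<omega>. ennreal ((?I n \<omega> - ?Y \<omega>)\<^sup>2) \<partial>M) \<le> 2 * ?a n + 2 * ?R" .
    then have "?E \<le> 2 * ?b n + 2 * (2 * ?a n + 2 * ?R)"
      by (intro order_trans[OF E] add_left_mono mult_left_mono) auto
    also have "\<dots> = 2 * ?b n + 4 * ?a n + 4 * ?R"
    proof -
      have "2 * (2 * x) = 4 * (x :: ennreal)" for x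
        unfolding mult.assoc[symmetric] by (simp flip: ennreal_numeral ennreal_mult)
      then show ?thesis by (simp add: distrib_left add.assoc)
    qed
    finally show ?thesis .
  qed
  have "(\<lambda>n. 2 * ?b n + 4 * ?a n + 4 * ?R) \<longlonglongrightarrow> 2 * 0 + 4 * 0 + 4 * ?R"
    by (intro tendsto_add tendsto_const ennreal_tendsto_cmult l1 l2) auto
  then show ?thesis using bound by (intro LIMSEQ_le_const[of "\<lambda>n. 2 * ?b n + 4 * ?a n + 4 * ?R"]) auto
qed

end

section \<open>Expansions in the eigenfunctions\<close>

lemma finite_measure_unit_interval: "finite_measure (lebesgue_on {0<..<1::real})"
  by (rule finite_measure_lebesgue_on) simp

lemma eigfun_measurable: "eigfun k \<in> borel_measurable (lebesgue_on {0<..<1})"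
proof -
  have "eigfun k \<in> borel_measurable lborel"
    unfolding eigfun_def by measurable
  then show ?thesis
    by (intro measurable_restrict_space1 measurable_completion)
qed

lemma L2_01_mult_integrable:
  assumes "f \<in> L2_01" "g \<in> L2_01"
  shows "integrable (lebesgue_on {0<..<1}) (\<lambda>x. f x * g x)"
proof (rule Bochner_Integration.integrable_bound)
  show "integrable (lebesgue_on {0<..<1}) (\<lambda>x. (f x)\<^sup>2 + (g x)\<^sup>2)"
    using assms unfolding L2_01_def by auto
  show "(\<lambda>x. f x * g x) \<in> borel_measurable (lebesgue_on {0<..<1})"
    using assms unfolding L2_01_def by auto
  have "\<bar>a * b\<bar> \<le> a\<^sup>2 + b\<^sup>2" for a b :: real
  proof -
    have "2 * (\<bar>a\<bar> * \<bar>b\<bar>) \<le> a\<^sup>2 + b\<^sup>2"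
      using sum_squares_bound[of "\<bar>a\<bar>" "\<bar>b\<bar>"] by (simp add: mult.assoc)
    moreover have "0 \<le> \<bar>a\<bar> * \<bar>b\<bar>" by simp
    ultimately show ?thesis by (simp only: abs_mult)
  qed
  then show "AE x in lebesgue_on {0<..<1}. norm (f x * g x) \<le> norm ((f x)\<^sup>2 + (g x)\<^sup>2)"
    by (intro AE_I2) (simp add: order_trans[OF _ abs_ge_self])
qed

lemma L2_01_add: "f \<in> L2_01 \<Longrightarrow> g \<in> L2_01 \<Longrightarrow> (\<lambda>x. f x + g x) \<in> L2_01"
  using L2_01_mult_integrable[of f g]
  unfolding L2_01_def by (auto simp: power2_sum mult.assoc)

lemma L2_01_cmult: "f \<in> L2_01 \<Longrightarrow> (\<lambda>x. c * f x) \<in> L2_01"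
  unfolding L2_01_def by (auto simp: power_mult_distrib)

lemma L2_01_diff: "f \<in> L2_01 \<Longrightarrow> g \<in> L2_01 \<Longrightarrow> (\<lambda>x. f x - g x) \<in> L2_01"
  using L2_01_add[OF _ L2_01_cmult[of g "-1"], of f] by simp

lemma eigfun_L2: "eigfun k \<in> L2_01"
proof -
  interpret finite_measure "lebesgue_on {0<..<1::real}" by (rule finite_measure_unit_interval)
  have "norm ((eigfun k x)\<^sup>2) \<le> 2" for x
    using abs_sin_le_one[of "real k * pi * x"] by (simp add: eigfun_def power_mult_distrib abs_square_le_1)
  then have "integrable (lebesgue_on {0<..<1}) (\<lambda>x. (eigfun k x)\<^sup>2)"
    using eigfun_measurable[of k] by (intro integrable_const_bound[of _ 2]) auto
  then show ?thesis unfolding L2_01_def using eigfun_measurable by auto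
qed

lemma L2_01_sum: "(\<lambda>x. \<Sum>k\<in>K. c k * eigfun k x) \<in> L2_01"
proof (induction K rule: infinite_finite_induct)
  case (insert k K)
  then show ?case using L2_01_add[OF L2_01_cmult[OF eigfun_L2[of k], of "c k"]] by simp
qed (auto simp: L2_01_def)

lemma L2_inner01_add_left: "f \<in> L2_01 \<Longrightarrow> g \<in> L2_01 \<Longrightarrow> h \<in> L2_01 \<Longrightarrow>
    L2_inner01 (\<lambda>x. f x + g x) h = L2_inner01 f h + L2_inner01 g h"
  by (simp add: L2_inner01_def distrib_right L2_01_mult_integrable)

lemma L2_inner01_cmult_left: "L2_inner01 (\<lambda>x. c * f x) h = c * L2_inner01 f h"
  by (simp add: L2_inner01_def mult.assoc)

lemma L2_inner01_commute: "L2_inner01 f g = L2_inner01 g f"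
  by (simp add: L2_inner01_def mult.commute)

lemma L2_inner01_nonneg: "L2_inner01 f f \<ge> 0"
  unfolding L2_inner01_def by (rule Bochner_Integration.integral_nonneg) simp

lemma L2_inner01_add_cmult_self:
  assumes "f \<in> L2_01" "g \<in> L2_01"
  shows "L2_inner01 (\<lambda>x. f x + t * g x) (\<lambda>x. f x + t * g x)
    = L2_inner01 f f + 2 * t * L2_inner01 f g + t\<^sup>2 * L2_inner01 g g"
proof -
  let ?h = "\<lambda>x. f x + t * g x"
  have tg: "(\<lambda>x. t * g x) \<in> L2_01" and h: "?h \<in> L2_01"
    using assms L2_01_cmult L2_01_add by auto
  have "L2_inner01 ?h f = L2_inner01 f f + t * L2_inner01 g f" "L2_inner01 ?h g = L2_inner01 f g + t * L2_inner01 g g"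
    using L2_inner01_add_left[OF assms(1) tg] assms by (simp_all add: L2_inner01_cmult_left)
  then have "L2_inner01 f ?h = L2_inner01 f f + t * L2_inner01 f g" "L2_inner01 g ?h = L2_inner01 f g + t * L2_inner01 g g"
    by (simp_all add: L2_inner01_commute)
  then show ?thesis
    using L2_inner01_add_left[OF assms(1) tg h]
    by (simp add: L2_inner01_cmult_left power2_eq_square algebra_simps)
qed

lemma L2_inner01_Cauchy_Schwarz:
  assumes "f \<in> L2_01" "g \<in> L2_01"
  shows "L2_inner01 f g \<le> L2_norm01 f * L2_norm01 g"
proof -
  define A B C where "A = L2_inner01 f f" and "B = L2_inner01 f g" and "C = L2_inner01 g g"
  have q: "0 \<le> A + 2 * t * B + t\<^sup>2 * C" for t
    using L2_inner01_nonneg[of "\<lambda>x. f x + t * g x"]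
    unfolding L2_inner01_add_cmult_self[OF assms] A_def B_def C_def .
  have C0: "C \<ge> 0" and A0: "A \<ge> 0" unfolding C_def A_def by (rule L2_inner01_nonneg)+
  have "B\<^sup>2 \<le> A * C"
  proof (cases "C = 0")
    case True
    have "B = 0"
    proof (rule ccontr)
      assume "B \<noteq> 0"
      \<comment> \<open>For \<open>C = 0\<close> the quadratic in \<open>t\<close> is affine, and
        this argument would give it the value \<open>-1\<close>.\<close>
      then have "A + 2 * (- (A + 1) / (2 * B)) * B = - 1" by (simp add: field_simps)
      then show False using q[of "- (A + 1) / (2 * B)"] True by simp
    qed
    with True show ?thesis by simp
  next
    case False
    then have "0 \<le> (A + 2 * (- B / C) * B + (- B / C)\<^sup>2 * C) * C"
      using q[of "- B / C"] C0 by (intro mult_nonneg_nonneg) auto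
    also have "\<dots> = A * C - B\<^sup>2" using False by (simp add: field_simps power2_eq_square)
    finally show ?thesis by simp
  qed
  then have "\<bar>B\<bar> \<le> sqrt (A * C)" by (rule real_le_rsqrt[of "\<bar>B\<bar>", simplified])
  then show ?thesis
    unfolding L2_norm01_def A_def B_def C_def by (simp add: real_sqrt_mult)
qed

lemma L2_norm01_nonneg: "L2_norm01 f \<ge> 0"
  by (simp add: L2_norm01_def L2_inner01_nonneg)

lemma L2_norm01_square: "(L2_norm01 f)\<^sup>2 = L2_inner01 f f"
  by (simp add: L2_norm01_def L2_inner01_nonneg)

lemma L2_norm01_triangle:
  assumes "f \<in> L2_01" "g \<in> L2_01"
  shows "L2_norm01 (\<lambda>x. f x + g x) \<le> L2_norm01 f + L2_norm01 g"
proof (rule power2_le_imp_le)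
  show "(L2_norm01 (\<lambda>x. f x + g x))\<^sup>2 \<le> (L2_norm01 f + L2_norm01 g)\<^sup>2"
    using L2_inner01_add_cmult_self[OF assms, of 1] L2_inner01_Cauchy_Schwarz[OF assms]
    by (simp add: L2_norm01_square power2_sum)
qed (simp add: L2_norm01_nonneg)

lemma L2_norm01_minus: "L2_norm01 (\<lambda>x. - f x) = L2_norm01 f"
  by (simp add: L2_norm01_def L2_inner01_def)

section \<open>Orthonormality of the eigenfunctions and Parseval's identity\<close>

lemma cos_integral_unit_interval:
  "((\<lambda>x. cos (real_of_int m * pi * x)) has_integral (if m = 0 then 1 else 0)) {0..1}"
proof (cases "m = 0")
  case True
  then show ?thesis using has_integral_const_real[of 1 0 1] by simp
next
  case False
  have "((\<lambda>x. cos (real_of_int m * pi * x)) has_integral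
      sin (real_of_int m * pi * 1) / (real_of_int m * pi) - sin (real_of_int m * pi * 0) / (real_of_int m * pi)) {0..1}"
    by (rule fundamental_theorem_of_calculus)
      (use False in \<open>auto intro!: derivative_eq_intros simp: has_real_derivative_iff_has_vector_derivative[symmetric]\<close>)
  moreover have "sin (real_of_int m * pi) = 0"
    by (simp add: sin_zero_iff_int2)
  ultimately show ?thesis using False by simp
qed

lemma eigfun_orthonormal:
  assumes "j \<ge> 1" "k \<ge> 1"
  shows "L2_inner01 (eigfun j) (eigfun k) = (if j = k then 1 else 0)"
proof -
  have prod: "eigfun j x * eigfun k x = cos (real_of_int (int j - int k) * pi * x) - cos (real_of_int (int j + int k) * pi * x)" for x
    by (simp add: eigfun_def algebra_simps cos_add cos_diff)
  have "((\<lambda>x. eigfun j x * eigfun k x) has_integral (if j = k then 1 else 0)) {0..1}"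
    unfolding prod
    using has_integral_diff[OF cos_integral_unit_interval[of "int j - int k"] cos_integral_unit_interval[of "int j + int k"]] assms
    by (auto split: if_splits)
  then have "integral {0<..<1} (\<lambda>x. eigfun j x * eigfun k x) = (if j = k then 1 else 0)"
    by (simp add: integral_open_interval_real[symmetric] integral_unique)
  then show ?thesis
    unfolding L2_inner01_def
    by (subst lebesgue_integral_eq_integral) (auto intro!: L2_01_mult_integrable eigfun_L2)
qed

lemma L2_norm01_eigfun_sum:
  "(L2_norm01 (\<lambda>x. \<Sum>k = 1..N. c k * eigfun k x))\<^sup>2 = (\<Sum>k = 1..N. (c k)\<^sup>2)"
proof -
  have int: "integrable (lebesgue_on {0<..<1}) (\<lambda>x. eigfun j x * eigfun k x)" for j k
    by (rule L2_01_mult_integrable[OF eigfun_L2 eigfun_L2])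
  have "(L2_norm01 (\<lambda>x. \<Sum>k = 1..N. c k * eigfun k x))\<^sup>2
      = integral\<^sup>L (lebesgue_on {0<..<1}) (\<lambda>x. \<Sum>j = 1..N. \<Sum>k = 1..N. (c j * c k) * (eigfun j x * eigfun k x))"
    unfolding L2_norm01_square L2_inner01_def by (simp add: sum_product ac_simps)
  also have "\<dots> = (\<Sum>j = 1..N. \<Sum>k = 1..N. (c j * c k) * L2_inner01 (eigfun j) (eigfun k))"
    using int by (simp add: L2_inner01_def)
  also have "\<dots> = (\<Sum>j = 1..N. \<Sum>k = 1..N. if k = j then (c j)\<^sup>2 else 0)"
    by (intro sum.cong) (auto simp: eigfun_orthonormal power2_eq_square)
  also have "\<dots> = (\<Sum>k = 1..N. (c k)\<^sup>2)" by (simp add: sum.delta)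
  finally show ?thesis .
qed

text \<open>By the reverse triangle inequality the norms of the partial sums tend to the norm of
  \<open>h\<close>, and orthonormality evaluates them. The \<open>Suc\<close> appears because modes
  are counted from 1 and series from 0.\<close>

lemma L2_expansion_Parseval:
  assumes "L2_expansion c h"
  shows "(\<lambda>k. (c (Suc k))\<^sup>2) sums (L2_norm01 h)\<^sup>2"
proof -
  let ?S = "\<lambda>N x. \<Sum>k = 1..N. c k * eigfun k x"
  have h: "h \<in> L2_01" and lim: "(\<lambda>N. L2_norm01 (\<lambda>x. h x - ?S N x)) \<longlonglongrightarrow> 0"
    using assms by (auto simp: L2_expansion_def)
  have "\<bar>L2_norm01 (?S N) - L2_norm01 h\<bar> \<le> L2_norm01 (\<lambda>x. h x - ?S N x)" for N
  proof -
    have S: "?S N \<in> L2_01" by (rule L2_01_sum)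
    have d: "(\<lambda>x. h x - ?S N x) \<in> L2_01" using L2_01_diff[OF h S] .
    have "L2_norm01 h \<le> L2_norm01 (?S N) + L2_norm01 (\<lambda>x. h x - ?S N x)"
      using L2_norm01_triangle[OF S d] by simp
    moreover have "L2_norm01 (?S N) \<le> L2_norm01 h + L2_norm01 (\<lambda>x. h x - ?S N x)"
      using L2_norm01_triangle[OF h L2_01_cmult[OF d, of "-1"]] L2_norm01_minus[of "\<lambda>x. h x - ?S N x"] by simp
    ultimately show ?thesis by linarith
  qed
  then have "(\<lambda>N. L2_norm01 (?S N) - L2_norm01 h) \<longlonglongrightarrow> 0"
    by (intro Lim_null_comparison[OF _ lim]) auto
  then have "(\<lambda>N. L2_norm01 (?S N)) \<longlonglongrightarrow> L2_norm01 h" by (simp add: Lim_null[symmetric])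
  then have "(\<lambda>N. (L2_norm01 (?S N))\<^sup>2) \<longlonglongrightarrow> (L2_norm01 h)\<^sup>2" by (rule tendsto_power)
  then have "(\<lambda>N. \<Sum>k = 1..N. (c k)\<^sup>2) \<longlonglongrightarrow> (L2_norm01 h)\<^sup>2"
    unfolding L2_norm01_eigfun_sum .
  moreover have "(\<Sum>k = 1..N. (c k)\<^sup>2) = (\<Sum>k<N. (c (Suc k))\<^sup>2)" for N
    by (induction N) auto
  ultimately show ?thesis by (simp add: sums_def)
qed

text \<open>For the two mild solutions the terms with the initial data coincide and cancel, so that
  only the stochastic coefficients are left.\<close>

lemma L2_expansion_diff:
  assumes "L2_expansion c u" "L2_expansion d v"
  shows "L2_expansion (\<lambda>k. c k - d k) (\<lambda>x. u x - v x)"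
proof -
  let ?S = "\<lambda>c N x. \<Sum>k = 1..N. c k * eigfun k x"
  have u: "u \<in> L2_01" and v: "v \<in> L2_01"
    and lim: "(\<lambda>N. L2_norm01 (\<lambda>x. u x - ?S c N x)) \<longlonglongrightarrow> 0" "(\<lambda>N. L2_norm01 (\<lambda>x. v x - ?S d N x)) \<longlonglongrightarrow> 0"
    using assms by (auto simp: L2_expansion_def)
  have "L2_norm01 (\<lambda>x. (u x - v x) - ?S (\<lambda>k. c k - d k) N x)
      \<le> L2_norm01 (\<lambda>x. u x - ?S c N x) + L2_norm01 (\<lambda>x. v x - ?S d N x)" for N
  proof -
    have a: "(\<lambda>x. u x - ?S c N x) \<in> L2_01" "(\<lambda>x. v x - ?S d N x) \<in> L2_01"
      using L2_01_diff[OF u L2_01_sum] L2_01_diff[OF v L2_01_sum] by auto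
    have eq: "(u x - v x) - ?S (\<lambda>k. c k - d k) N x = (u x - ?S c N x) + (-1) * (v x - ?S d N x)" for x
      by (simp add: left_diff_distrib sum_subtractf)
    show ?thesis
      unfolding eq using L2_norm01_triangle[OF a(1) L2_01_cmult[OF a(2), of "-1"]]
        L2_norm01_minus[of "\<lambda>x. v x - ?S d N x"] by simp
  qed
  then have "(\<lambda>N. L2_norm01 (\<lambda>x. (u x - v x) - ?S (\<lambda>k. c k - d k) N x)) \<longlonglongrightarrow> 0"
    by (intro Lim_null_comparison[OF always_eventually[OF allI] tendsto_add_zero[OF lim]])
       (simp only: real_norm_def abs_of_nonneg[OF L2_norm01_nonneg])
  then show ?thesis
    unfolding L2_expansion_def using L2_01_diff[OF u v] by simp
qed

section \<open>Averaging over the grid cells\<close>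

text \<open>Summed over the cells, the last factor on the right telescopes.\<close>

lemma powr_increment_square_le:
  fixes a q :: real
  assumes "0 < q" "q \<le> a" "a < 1" "2 * a - 1 \<le> q"
  obtains C where "C > 0" and "\<And>x y. 0 \<le> y \<Longrightarrow> y \<le> x \<Longrightarrow>
      (x powr a - y powr a)\<^sup>2 \<le> C * (x - y) powr (2 * a - q) * (x powr q - y powr q)"
proof
  \<comment> \<open>\<open>C1\<close> serves \<open>y \<le> x / 2\<close>, where
    \<open>x - y\<close> and both increments are comparable to powers of \<open>x\<close>.
    \<open>C2\<close> serves \<open>y > x / 2\<close>, where the intermediate points of the mean
    value theorem lie between \<open>x / 2\<close> and \<open>x\<close>.\<close>
  define C1 where "C1 = 2 powr (2 * a - q) / (1 - (1 / 2) powr q)"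
  define C2 where "C2 = a\<^sup>2 * (1 / 2) powr (2 * a - 2) / q"
  have h: "(1 / 2) powr q < (1::real)" using assms powr_less_mono2[of q "1 / 2" "1::real"] by simp
  have C1: "C1 > 0" using h by (simp add: C1_def)
  have C2: "C2 > 0" using assms by (simp add: C2_def)
  show "C1 + C2 > 0" using C1 C2 by simp
  fix x y :: real assume y: "0 \<le> y" "y \<le> x"
  have sq: "(z powr s)\<^sup>2 = z powr (2 * s)" if "z \<ge> 0" for z s :: real
    using that by (simp add: power2_eq_square flip: powr_add)
  have pos: "(x - y) powr (2 * a - q) * (x powr q - y powr q) \<ge> 0"
    using y assms by (intro mult_nonneg_nonneg) (auto intro!: powr_mono2)
  have conclude: "(x powr a - y powr a)\<^sup>2 \<le> (C1 + C2) * (x - y) powr (2 * a - q) * (x powr q - y powr q)"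
    if "(x powr a - y powr a)\<^sup>2 \<le> D * ((x - y) powr (2 * a - q) * (x powr q - y powr q))"
    "D \<le> C1 + C2" for D
    using order_trans[OF that(1) mult_right_mono[OF that(2) pos]] by (simp add: mult.assoc)
  consider "x = y" | "y < x" "y \<le> x / 2" | "y < x" "x / 2 < y" using y by linarith
  then show "(x powr a - y powr a)\<^sup>2 \<le> (C1 + C2) * (x - y) powr (2 * a - q) * (x powr q - y powr q)"
  proof cases
    case 2
    then have x: "x > 0" using y by linarith
    have "(x powr a - y powr a)\<^sup>2 \<le> (x powr a)\<^sup>2"
      using y assms by (intro power_mono) (auto intro!: powr_mono2)
    also have "\<dots> = C1 * ((x / 2) powr (2 * a - q) * (x powr q * (1 - (1 / 2) powr q)))"
    proof -
      have "x powr (2 * a - q) * x powr q = x powr (2 * a)" by (simp flip: powr_add)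
      moreover have "P / H * (X / P * (Y * H)) = X * Y" if "P \<noteq> 0" "H \<noteq> 0" for P H X Y :: real
        using that by simp
      ultimately show ?thesis using h x y assms(1) by (simp add: C1_def powr_divide sq)
    qed
    also have "\<dots> \<le> C1 * ((x - y) powr (2 * a - q) * (x powr q - y powr q))"
    proof (intro mult_left_mono mult_mono)
      show "(x / 2) powr (2 * a - q) \<le> (x - y) powr (2 * a - q)"
        using 2 x assms by (intro powr_mono2) auto
      have "y powr q \<le> (x * (1 / 2)) powr q" using 2 y assms by (intro powr_mono2) auto
      also have "\<dots> = x powr q * (1 / 2) powr q" by (rule powr_mult)
      finally show "x powr q * (1 - (1 / 2) powr q) \<le> x powr q - y powr q"
        by (simp add: right_diff_distrib)
    qed (use C1 h x in auto)
    finally show ?thesis by (rule conclude) (use C1 C2 in auto)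
  next
    case 3
    then have x: "x > 0" and y0: "y > 0" using y by linarith+
    have mvt: "\<exists>z. y < z \<and> z < x \<and> x powr s - y powr s = (x - y) * (s * z powr (s - 1))" for s :: real
      by (rule MVT2[OF 3(1)]) (use y0 in \<open>auto intro!: has_real_derivative_powr\<close>)
    obtain z where z: "y < z" "z < x" "x powr a - y powr a = (x - y) * (a * z powr (a - 1))"
      using mvt[of a] by blast
    obtain w where w: "y < w" "w < x" "x powr q - y powr q = (x - y) * (q * w powr (q - 1))"
      using mvt[of q] by blast
    have "(x powr a - y powr a)\<^sup>2 \<le> ((x - y) * (a * (x * (1 / 2)) powr (a - 1)))\<^sup>2"
      unfolding z(3) using 3 z x assms
      by (intro power_mono mult_left_mono powr_mono2') auto
    also have "\<dots> = C2 * q * ((x - y)\<^sup>2 * x powr (2 * a - 2))"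
    proof -
      have "2 * (a - 1) = 2 * a - 2" by simp
      then have "((x * (1 / 2)) powr (a - 1))\<^sup>2 = x powr (2 * a - 2) * (1 / 2) powr (2 * a - 2)"
        using sq[of "x * (1 / 2)" "a - 1"] x by (auto simp only: powr_mult)
      then show ?thesis using assms(1) by (simp only: power_mult_distrib) (simp add: C2_def)
    qed
    also have "(x - y)\<^sup>2 * x powr (2 * a - 2) \<le> (x - y) powr (2 * a - q) * ((x - y) * x powr (q - 1))"
    proof -
      have xy: "x - y > 0" using 3 by simp
      have 1: "(x - y)\<^sup>2 = (x - y) powr (2 * a - q) * (x - y) * (x - y) powr (1 - 2 * a + q)"
      proof -
        have "(x - y) powr (2 * a - q) * (x - y) powr 1 * (x - y) powr (1 - 2 * a + q) = (x - y) powr 2"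
          unfolding powr_add[symmetric] by simp
        then show ?thesis using xy by (simp add: powr_numeral)
      qed
      have 2: "x powr (q - 1) = x powr (1 - 2 * a + q) * x powr (2 * a - 2)"
        unfolding powr_add[symmetric] by simp
      \<comment> \<open>The exponent is nonnegative by \<open>2 * a - 1 \<le> q\<close>. With
        \<open>a = \<alpha> - 1\<close> this is the origin of the condition
        \<open>2 * \<alpha> - 3 \<le> q\<close>.\<close>
      have "(x - y) powr (1 - 2 * a + q) \<le> x powr (1 - 2 * a + q)"
        using xy y0 assms by (intro powr_mono2) auto
      then show ?thesis unfolding 1 2 using xy
        by (simp add: mult.assoc mult_left_mono mult_right_mono)
    qed
    then have "C2 * q * ((x - y)\<^sup>2 * x powr (2 * a - 2)) \<le> C2 * q * ((x - y) powr (2 * a - q) * ((x - y) * x powr (q - 1)))"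
      using C2 assms by (intro mult_left_mono) auto
    also have "\<dots> = C2 * ((x - y) powr (2 * a - q) * ((x - y) * (q * x powr (q - 1))))" by simp
    also have "\<dots> \<le> C2 * ((x - y) powr (2 * a - q) * (x powr q - y powr q))"
      unfolding w(3) using C2 3 w y0 assms
      by (intro mult_left_mono powr_mono2') auto
    finally show ?thesis by (rule conclude) (use C1 C2 in auto)
  qed simp
qed

text \<open>Clipping at 0 shortens the cell that contains \<open>t\<close> and collapses the later
  ones. So every increment is over a length of at most \<open>T / real I\<close>, which may be
  inserted because \<open>2 * a - q > 0\<close>, and the increments of the power \<open>q\<close>
  telescope down from \<open>x 1 = t\<close>.\<close>

lemma powr_increment_sum_le:
  fixes a q C :: real
  assumes C: "C > 0" "\<And>x y. 0 \<le> y \<Longrightarrow> y \<le> x \<Longrightarrow>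
      (x powr a - y powr a)\<^sup>2 \<le> C * (x - y) powr (2 * a - q) * (x powr q - y powr q)"
    and aq: "0 < q" "q \<le> a" and t: "0 \<le> t" and T: "T > 0" and I: "I \<ge> 1"
  defines "x \<equiv> \<lambda>i. max 0 (t - grid T I i)"
  shows "(\<Sum>i = 1..I. (x i powr a - x (Suc i) powr a)\<^sup>2) \<le> C * (T / real I) powr (2 * a - q) * t powr q"
proof -
  have g: "grid T I (Suc i) = grid T I i + T / real I" for i
    using I by (simp add: grid_def field_simps)
  have D: "T / real I > 0" using T I by simp
  have x: "0 \<le> x (Suc i)" "x (Suc i) \<le> x i" "x i - x (Suc i) \<le> T / real I" for i
    using D by (auto simp: x_def g)
  have "(\<Sum>i = 1..I. (x i powr a - x (Suc i) powr a)\<^sup>2)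
      \<le> (\<Sum>i = 1..I. C * (T / real I) powr (2 * a - q) * (x i powr q - x (Suc i) powr q))"
  proof (rule sum_mono)
    fix i
    have "(x i powr a - x (Suc i) powr a)\<^sup>2 \<le> C * (x i - x (Suc i)) powr (2 * a - q) * (x i powr q - x (Suc i) powr q)"
      using C(2) x by blast
    also have "\<dots> \<le> C * (T / real I) powr (2 * a - q) * (x i powr q - x (Suc i) powr q)"
      using C(1) x[of i] aq by (intro mult_right_mono mult_left_mono powr_mono2) (auto intro!: powr_mono2)
    finally show "(x i powr a - x (Suc i) powr a)\<^sup>2 \<le> C * (T / real I) powr (2 * a - q) * (x i powr q - x (Suc i) powr q)" .
  qed
  also have "\<dots> = C * (T / real I) powr (2 * a - q) * (\<Sum>i = 1..I. x i powr q - x (Suc i) powr q)"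
    by (simp add: sum_distrib_left)
  also have "(\<Sum>i = 1..I. x i powr q - x (Suc i) powr q) = x 1 powr q - x (Suc I) powr q"
    using I by (induction I rule: dec_induct) auto
  also have "C * (T / real I) powr (2 * a - q) * \<dots> \<le> C * (T / real I) powr (2 * a - q) * t powr q"
    using C(1) t by (intro mult_left_mono) (auto simp: x_def grid_def)
  finally show ?thesis .
qed

text \<open>The square error is a quadratic in the constant; its value at \<open>d\<close> exceeds
  that at \<open>c\<close> by \<open>\<Delta>\<close> times the square of
  \<open>c - d\<close>.\<close>

lemma mean_minimizes_square:
  fixes f :: "real \<Rightarrow> real"
  assumes S: "S \<in> sets borel" "emeasure lborel S = ennreal \<Delta>" "\<Delta> > 0"
    and f: "f \<in> borel_measurable borel" "\<And>s. \<bar>f s\<bar> \<le> B"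
  defines "c \<equiv> (\<integral>s. indicator S s * f s \<partial>lborel) / \<Delta>"
  shows "(\<integral>\<^sup>+s. ennreal ((f s - c)\<^sup>2) * indicator S s \<partial>lborel) \<le> (\<integral>\<^sup>+s. ennreal ((f s - d)\<^sup>2) * indicator S s \<partial>lborel)"
proof -
  note f(1) [measurable] and S(1) [measurable]
  have int1: "integrable lborel (\<lambda>s. indicator S s * f s)"
  proof (rule Bochner_Integration.integrable_bound[of _ "\<lambda>s. indicator S s * B"])
    show "integrable lborel (\<lambda>s. indicator S s * B)" using S by (auto intro!: integrable_mult_left)
    show "AE s in lborel. norm (indicator S s * f s) \<le> norm (indicator S s * B)"
      using f(2) by (auto simp: indicator_def intro: order_trans[OF _ abs_ge_self])
  qed measurable
  have int2: "integrable lborel (\<lambda>s. indicator S s * (f s)\<^sup>2)"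
  proof (rule Bochner_Integration.integrable_bound[of _ "\<lambda>s. indicator S s * B\<^sup>2"])
    show "integrable lborel (\<lambda>s. indicator S s * B\<^sup>2)" using S by (auto intro!: integrable_mult_left)
    have "(f s)\<^sup>2 \<le> B\<^sup>2" for s using power_mono[OF f(2)[of s] abs_ge_zero, of 2] by simp
    then show "AE s in lborel. norm (indicator S s * (f s)\<^sup>2) \<le> norm (indicator S s * B\<^sup>2)"
      by (auto simp: indicator_def)
  qed measurable
  have int3: "integrable lborel (indicator S :: real \<Rightarrow> real)" using S by auto
  have m: "measure lborel S = \<Delta>" using S by (simp add: measure_def)
  define Q where "Q = (\<integral>s. indicator S s * (f s)\<^sup>2 \<partial>lborel)"
  have eq: "indicator S s * (f s - e)\<^sup>2 = indicator S s * (f s)\<^sup>2 - 2 * e * (indicator S s * f s) + e\<^sup>2 * indicator S s" for s e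
    by (simp add: power2_diff algebra_simps)
  have val: "(\<integral>\<^sup>+s. ennreal ((f s - e)\<^sup>2) * indicator S s \<partial>lborel) = ennreal (Q - 2 * e * (\<Delta> * c) + e\<^sup>2 * \<Delta>)" for e
  proof -
    have "has_bochner_integral lborel (\<lambda>s. indicator S s * (f s - e)\<^sup>2) (Q - 2 * e * (\<Delta> * c) + e\<^sup>2 * \<Delta>)"
      unfolding eq
      using int1 int2 int3 m S(3) by (simp add: has_bochner_integral_iff Q_def c_def)
    moreover have "(\<integral>\<^sup>+s. ennreal ((f s - e)\<^sup>2) * indicator S s \<partial>lborel) = (\<integral>\<^sup>+s. ennreal (indicator S s * (f s - e)\<^sup>2) \<partial>lborel)"
      by (intro nn_integral_cong) (auto simp: indicator_def)
    ultimately show ?thesis by (simp add: nn_integral_eq_integral has_bochner_integral_iff)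
  qed
  have "(Q - 2 * d * (\<Delta> * c) + d\<^sup>2 * \<Delta>) - (Q - 2 * c * (\<Delta> * c) + c\<^sup>2 * \<Delta>) = \<Delta> * (c - d)\<^sup>2"
    by (simp add: power2_eq_square algebra_simps)
  moreover have "\<Delta> * (c - d)\<^sup>2 \<ge> 0" using S by simp
  ultimately show ?thesis unfolding val by (intro ennreal_leI) linarith
qed

text \<open>
  \<open>g\<close> stands for the kernel of a fixed mode and \<open>\<phi>\<close> for its regularized coefficient. Below, \<open>f\<close> is the
  integrand extended by zero, and \<open>mean i\<close> is its average over the \<open>i\<close>-th cell.
\<close>

locale cell_averaging =
  fixes T t a A C \<mu> \<gamma> :: real and I :: nat and g \<phi> :: "real \<Rightarrow> real"
  assumes T: "T > 0" and t: "0 < t" "t \<le> T" and I: "I \<ge> 1"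
    and a: "0 < a" "a < 1"
    and cont_g: "continuous_on {0..} g" and g0: "g 0 = 0"
    and g_le: "\<And>r. r \<ge> 0 \<Longrightarrow> \<bar>g r\<bar> \<le> A"
    and g_diff: "\<And>r s. 0 \<le> s \<Longrightarrow> s \<le> r \<Longrightarrow> \<bar>g r - g s\<bar> \<le> C * (r powr a - s powr a)"
    and cont_phi: "continuous_on {0..T} \<phi>"
    and phi_le: "\<And>s. s \<in> {0..T} \<Longrightarrow> \<bar>\<phi> s\<bar> \<le> \<mu>"
    and phi_diff: "\<And>r s. r \<in> {0..T} \<Longrightarrow> s \<in> {0..T} \<Longrightarrow> \<bar>\<phi> r - \<phi> s\<bar> \<le> \<gamma> * \<bar>r - s\<bar>"
    and C: "C > 0"
begin

definition "\<Delta> = T / real I"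
text \<open>Open on the left like the intervals of elementary processes. The regularized noise uses
  intervals closed on the left; the difference is a null set.\<close>

definition "cell i = {grid T I i<..grid T I (Suc i)}"
definition "f s = indicator {0..t} s * (g (t - s) * \<phi> s)"
definition "mean i = (\<integral>s. indicator (cell i) s * f s \<partial>lborel) / \<Delta>"

lemma A_nonneg: "A \<ge> 0" using g_le[of 0] by linarith
lemma mu_nonneg: "\<mu> \<ge> 0" using phi_le[of 0] T by (auto intro: order_trans[OF abs_ge_zero])
lemma gamma_nonneg: "\<gamma> \<ge> 0"
  using phi_diff[of 0 T] T by (auto simp: zero_le_mult_iff dest: order_trans[OF abs_ge_zero])
lemma Delta_pos: "\<Delta> > 0" using T I by (simp add: \<Delta>_def)
lemma grid_Suc: "grid T I (Suc i) = grid T I i + \<Delta>"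
  using I by (simp add: grid_def \<Delta>_def field_simps)
lemma grid_nonneg: "i \<ge> 1 \<Longrightarrow> grid T I i \<ge> 0" using T by (simp add: grid_def)
lemma grid_mono: "i \<le> j \<Longrightarrow> grid T I i \<le> grid T I j"
  using T by (auto simp: grid_def intro!: divide_right_mono mult_right_mono)
lemma grid_last: "grid T I (Suc I) = T" using I by (simp add: grid_def)
lemma grid_first: "grid T I 1 = 0" by (simp add: grid_def)

lemma f_measurable: "f \<in> borel_measurable borel"
proof -
  have "continuous_on {0..t} (\<lambda>s. g (t - s) * \<phi> s)"
    by (intro continuous_intros continuous_on_compose2[OF cont_g] continuous_on_subset[OF cont_phi]) (use t in auto)
  from borel_measurable_continuous_on_indicator[OF _ this] show ?thesis
    unfolding f_def[abs_def] by simp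
qed

lemma f_le: "\<bar>f s\<bar> \<le> A * \<mu>"
  using g_le[of "t - s"] phi_le[of s] t A_nonneg mu_nonneg
  by (auto simp: f_def abs_mult indicator_def intro!: mult_mono)

lemma f_le_powr: "\<bar>f s\<bar> \<le> indicator {0..t} s * (C * \<mu> * t powr a)"
proof (cases "s \<in> {0..t}")
  case True
  then have "\<bar>g (t - s)\<bar> \<le> C * (t - s) powr a" using g_diff[of 0 "t - s"] g0 a by simp
  also have "\<dots> \<le> C * t powr a" using C True a by (intro mult_left_mono powr_mono2) auto
  finally have "\<bar>g (t - s) * \<phi> s\<bar> \<le> (C * t powr a) * \<mu>"
    unfolding abs_mult using phi_le[of s] True t C by (intro mult_mono) auto
  then show ?thesis using True by (simp add: f_def ac_simps)
qed (simp add: f_def)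

text \<open>The difference splits into an increment of the kernel, with constant \<open>C\<close>,
  and one of the coefficient, with the small factor \<open>A\<close>. The zero extension does no
  harm because \<open>g 0 = 0\<close>: if \<open>t\<close> lies between the left endpoint and
  \<open>s\<close>, then the value at the left endpoint is itself controlled by an increment of the
  kernel down to \<open>0\<close>.\<close>

lemma f_cell_oscillation:
  assumes i: "i \<in> {1..I}" and s: "s \<in> cell i"
  shows "\<bar>f s - f (grid T I i)\<bar>
    \<le> C * \<mu> * (max 0 (t - grid T I i) powr a - max 0 (t - grid T I (Suc i)) powr a) + A * \<gamma> * \<Delta>"
proof -
  let ?u = "grid T I i"
  let ?v = "grid T I (Suc i)"
  have u: "0 \<le> ?u" "?u < s" "s \<le> ?v" "?v \<le> T" "?v = ?u + \<Delta>"
    using i s grid_nonneg[of i] grid_mono[of "Suc i" "Suc I"] grid_last grid_Suc[of i] by (auto simp: cell_def)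
  have err: "0 \<le> A * \<gamma> * \<Delta>" using A_nonneg gamma_nonneg Delta_pos by simp
  consider "s \<le> t" | "?u \<le> t" "t < s" | "t < ?u" by linarith
  then show ?thesis
  proof cases
    case 1
    then have eq: "f s - f ?u = (g (t - s) - g (t - ?u)) * \<phi> s + g (t - ?u) * (\<phi> s - \<phi> ?u)"
      using u by (simp add: f_def algebra_simps)
    have "\<bar>g (t - s) - g (t - ?u)\<bar> \<le> C * ((t - ?u) powr a - (t - s) powr a)"
      using g_diff[of "t - s" "t - ?u"] 1 u by (simp add: abs_minus_commute)
    also have "\<dots> \<le> C * (max 0 (t - ?u) powr a - max 0 (t - ?v) powr a)"
      using C 1 u a by (intro mult_left_mono diff_mono powr_mono2) auto
    finally have "\<bar>(g (t - s) - g (t - ?u)) * \<phi> s\<bar> \<le> (C * (max 0 (t - ?u) powr a - max 0 (t - ?v) powr a)) * \<mu>"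
      unfolding abs_mult using phi_le[of s] u by (intro mult_mono) auto
    moreover have "\<bar>g (t - ?u) * (\<phi> s - \<phi> ?u)\<bar> \<le> A * (\<gamma> * \<Delta>)"
      unfolding abs_mult
    proof (intro mult_mono)
      have "\<bar>\<phi> s - \<phi> ?u\<bar> \<le> \<gamma> * \<bar>s - ?u\<bar>" using phi_diff[of s ?u] u by auto
      also have "\<dots> \<le> \<gamma> * \<Delta>" using u gamma_nonneg by (intro mult_left_mono) auto
      finally show "\<bar>\<phi> s - \<phi> ?u\<bar> \<le> \<gamma> * \<Delta>" .
    qed (use g_le[of "t - ?u"] 1 u A_nonneg in auto)
    ultimately show ?thesis unfolding eq
      by (intro order_trans[OF abs_triangle_ineq]) (simp add: algebra_simps)
  next
    case 2
    then have "\<bar>g (t - ?u)\<bar> \<le> C * (t - ?u) powr a" using g_diff[of 0 "t - ?u"] g0 a by simp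
    then have "\<bar>g (t - ?u) * \<phi> ?u\<bar> \<le> (C * (t - ?u) powr a) * \<mu>"
      unfolding abs_mult using phi_le[of ?u] u C by (intro mult_mono) auto
    moreover have "f s = 0" "f ?u = g (t - ?u) * \<phi> ?u" "max 0 (t - ?v) = 0" "max 0 (t - ?u) = t - ?u"
      using 2 u by (auto simp: f_def)
    ultimately show ?thesis using err a by (simp add: ac_simps)
  next
    case 3
    then show ?thesis using u err a by (simp add: f_def)
  qed
qed

lemma cell_sets [measurable, simp]: "cell i \<in> sets borel"
  by (simp add: cell_def)

lemma emeasure_cell: "emeasure lborel (cell i) = ennreal \<Delta>"
  using Delta_pos by (simp add: cell_def grid_Suc)

lemma cell_error_le:
  assumes "\<And>s. s \<in> cell i \<Longrightarrow> \<bar>f s - d\<bar> \<le> e"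
  shows "(\<integral>\<^sup>+s. ennreal ((f s - mean i)\<^sup>2) * indicator (cell i) s \<partial>lborel) \<le> ennreal (\<Delta> * e\<^sup>2)"
proof -
  have "(\<integral>\<^sup>+s. ennreal ((f s - mean i)\<^sup>2) * indicator (cell i) s \<partial>lborel)
      \<le> (\<integral>\<^sup>+s. ennreal ((f s - d)\<^sup>2) * indicator (cell i) s \<partial>lborel)"
    unfolding mean_def
    by (rule mean_minimizes_square[OF _ emeasure_cell Delta_pos f_measurable f_le]) (simp add: cell_def)
  also have "\<dots> \<le> (\<integral>\<^sup>+s. ennreal (e\<^sup>2) * indicator (cell i) s \<partial>lborel)"
  proof (rule nn_integral_mono)
    fix s
    have "(f s - d)\<^sup>2 \<le> e\<^sup>2" if "s \<in> cell i"
      using power_mono[OF assms[OF that] abs_ge_zero, of 2] by simp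
    then show "ennreal ((f s - d)\<^sup>2) * indicator (cell i) s \<le> ennreal (e\<^sup>2) * indicator (cell i) s"
      by (auto simp: indicator_def intro: ennreal_leI)
  qed
  also have "\<dots> = ennreal (\<Delta> * e\<^sup>2)"
    using Delta_pos by (subst nn_integral_cmult_indicator) (auto simp: emeasure_cell ennreal_mult mult.commute)
  finally show ?thesis .
qed

text \<open>The kernel part is summed by telescoping and gains a further factor
  \<open>\<Delta>\<close> as the length of the cell. The coefficient part is the same for all cells,
  and their total length is \<open>T\<close>.\<close>

lemma averaging_error_fine:
  assumes q: "0 < q" "q \<le> a" and K: "K > 0" "\<And>x y. 0 \<le> y \<Longrightarrow> y \<le> x \<Longrightarrow>
      (x powr a - y powr a)\<^sup>2 \<le> K * (x - y) powr (2 * a - q) * (x powr q - y powr q)"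
  shows "(\<Sum>i = 1..I. (\<integral>\<^sup>+s. ennreal ((f s - mean i)\<^sup>2) * indicator (cell i) s \<partial>lborel))
    \<le> ennreal (2 * C\<^sup>2 * K * \<mu>\<^sup>2 * (t powr q * \<Delta> powr (1 + 2 * a - q)) + 2 * A\<^sup>2 * \<gamma>\<^sup>2 * \<Delta>\<^sup>2 * T)"
proof -
  define d where "d i = max 0 (t - grid T I i) powr a - max 0 (t - grid T I (Suc i)) powr a" for i
  have "(\<Sum>i = 1..I. (\<integral>\<^sup>+s. ennreal ((f s - mean i)\<^sup>2) * indicator (cell i) s \<partial>lborel))
      \<le> (\<Sum>i = 1..I. ennreal (\<Delta> * (C * \<mu> * d i + A * \<gamma> * \<Delta>)\<^sup>2))"
    unfolding d_def by (rule sum_mono, rule cell_error_le, rule f_cell_oscillation)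
  also have "\<dots> = ennreal (\<Sum>i = 1..I. \<Delta> * (C * \<mu> * d i + A * \<gamma> * \<Delta>)\<^sup>2)"
    using Delta_pos by (intro sum_ennreal) auto
  also have "\<dots> \<le> ennreal (2 * C\<^sup>2 * K * \<mu>\<^sup>2 * (t powr q * \<Delta> powr (1 + 2 * a - q)) + 2 * A\<^sup>2 * \<gamma>\<^sup>2 * \<Delta>\<^sup>2 * T)"
  proof (rule ennreal_leI)
    have sq: "(X + Y)\<^sup>2 \<le> 2 * X\<^sup>2 + 2 * Y\<^sup>2" for X Y :: real
      using sum_squares_bound[of X Y] by (simp add: power2_sum)
    have "(\<Sum>i = 1..I. \<Delta> * (C * \<mu> * d i + A * \<gamma> * \<Delta>)\<^sup>2)
        \<le> (\<Sum>i = 1..I. \<Delta> * (2 * (C * \<mu> * d i)\<^sup>2 + 2 * (A * \<gamma> * \<Delta>)\<^sup>2))"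
      using Delta_pos by (intro sum_mono mult_left_mono sq) auto
    also have "\<dots> = 2 * C\<^sup>2 * \<mu>\<^sup>2 * \<Delta> * (\<Sum>i = 1..I. (d i)\<^sup>2) + (real I * \<Delta>) * (2 * A\<^sup>2 * \<gamma>\<^sup>2 * \<Delta>\<^sup>2)"
      by (simp add: sum.distrib distrib_left sum_distrib_left power_mult_distrib algebra_simps)
    also have "real I * \<Delta> = T" using I by (simp add: \<Delta>_def)
    also have "2 * C\<^sup>2 * \<mu>\<^sup>2 * \<Delta> * (\<Sum>i = 1..I. (d i)\<^sup>2) \<le> 2 * C\<^sup>2 * \<mu>\<^sup>2 * \<Delta> * (K * \<Delta> powr (2 * a - q) * t powr q)"
      using powr_increment_sum_le[OF K q _ T I, of t] t Delta_pos unfolding d_def \<Delta>_def[symmetric]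
      by (intro mult_left_mono) auto
    also have "\<dots> = 2 * C\<^sup>2 * K * \<mu>\<^sup>2 * (t powr q * (\<Delta> powr 1 * \<Delta> powr (2 * a - q)))"
      using Delta_pos by simp
    also have "\<Delta> powr 1 * \<Delta> powr (2 * a - q) = \<Delta> powr (1 + 2 * a - q)"
      unfolding powr_add[symmetric] by (simp add: algebra_simps)
    finally show "(\<Sum>i = 1..I. \<Delta> * (C * \<mu> * d i + A * \<gamma> * \<Delta>)\<^sup>2)
        \<le> 2 * C\<^sup>2 * K * \<mu>\<^sup>2 * (t powr q * \<Delta> powr (1 + 2 * a - q)) + 2 * A\<^sup>2 * \<gamma>\<^sup>2 * \<Delta>\<^sup>2 * T"
      by (simp add: ac_simps)
  qed
  finally show ?thesis .
qed

text \<open>For \<open>t < \<Delta>\<close> the comparison value is 0, because \<open>2 * a - q\<close> may be negative here.\<close>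

lemma averaging_error_coarse:
  assumes "t < \<Delta>" and q: "q \<le> 1 + 2 * a"
  shows "(\<Sum>i = 1..I. (\<integral>\<^sup>+s. ennreal ((f s - mean i)\<^sup>2) * indicator (cell i) s \<partial>lborel))
    \<le> ennreal (C\<^sup>2 * \<mu>\<^sup>2 * (t powr q * \<Delta> powr (1 + 2 * a - q)))"
proof -
  have "(\<integral>\<^sup>+s. ennreal ((f s - mean i)\<^sup>2) * indicator (cell i) s \<partial>lborel)
      \<le> (\<integral>\<^sup>+s. ennreal ((C * \<mu> * t powr a)\<^sup>2) * indicator {0..t} s * indicator (cell i) s \<partial>lborel)" for i
  proof -
    have "(\<integral>\<^sup>+s. ennreal ((f s - mean i)\<^sup>2) * indicator (cell i) s \<partial>lborel)
        \<le> (\<integral>\<^sup>+s. ennreal ((f s - 0)\<^sup>2) * indicator (cell i) s \<partial>lborel)"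
      unfolding mean_def
      by (rule mean_minimizes_square[OF _ emeasure_cell Delta_pos f_measurable f_le]) (simp add: cell_def)
    also have "\<dots> \<le> (\<integral>\<^sup>+s. ennreal ((C * \<mu> * t powr a)\<^sup>2) * indicator {0..t} s * indicator (cell i) s \<partial>lborel)"
    proof (intro nn_integral_mono mult_right_mono)
      fix s
      have "(f s - 0)\<^sup>2 \<le> (indicator {0..t} s * (C * \<mu> * t powr a))\<^sup>2"
        using power_mono[OF f_le_powr abs_ge_zero, of s 2] by simp
      then show "ennreal ((f s - 0)\<^sup>2) \<le> ennreal ((C * \<mu> * t powr a)\<^sup>2) * indicator {0..t} s"
        by (auto simp: indicator_def intro: ennreal_leI split: if_splits)
    qed simp
    finally show ?thesis .
  qed
  then have "(\<Sum>i = 1..I. (\<integral>\<^sup>+s. ennreal ((f s - mean i)\<^sup>2) * indicator (cell i) s \<partial>lborel))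
      \<le> (\<Sum>i = 1..I. (\<integral>\<^sup>+s. ennreal ((C * \<mu> * t powr a)\<^sup>2) * indicator {0..t} s * indicator (cell i) s \<partial>lborel))"
    by (rule sum_mono)
  \<comment> \<open>Since \<open>t < \<Delta>\<close>, only the first cell meets
    \<open>{0..t}\<close> in more than a null set.\<close>
  also have "\<dots> = (\<Sum>i = 1..I. if i = 1 then (\<integral>\<^sup>+s. ennreal ((C * \<mu> * t powr a)\<^sup>2) * indicator {0..t} s * indicator (cell i) s \<partial>lborel) else 0)"
  proof (intro sum.cong refl)
    fix i assume i: "i \<in> {1..I}"
    have "(\<integral>\<^sup>+s. ennreal ((C * \<mu> * t powr a)\<^sup>2) * indicator {0..t} s * indicator (cell i) s \<partial>lborel) = 0" if "i \<noteq> 1"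
    proof -
      have "\<Delta> \<le> grid T I i"
        using i that grid_mono[of "Suc 1" i] grid_Suc[of 1] grid_first by auto
      then have "indicator {0..t} s * indicator (cell i) s = (0::ennreal)" for s
        using assms(1) by (auto simp: indicator_def cell_def)
      then show ?thesis unfolding mult.assoc by (simp only: mult_zero_right) simp
    qed
    then show "(\<integral>\<^sup>+s. ennreal ((C * \<mu> * t powr a)\<^sup>2) * indicator {0..t} s * indicator (cell i) s \<partial>lborel)
        = (if i = 1 then (\<integral>\<^sup>+s. ennreal ((C * \<mu> * t powr a)\<^sup>2) * indicator {0..t} s * indicator (cell i) s \<partial>lborel) else 0)"
      by simp
  qed
  also have "\<dots> = (\<integral>\<^sup>+s. ennreal ((C * \<mu> * t powr a)\<^sup>2) * indicator {0..t} s * indicator (cell 1) s \<partial>lborel)"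
    using I by (simp add: sum.delta)
  also have "\<dots> \<le> (\<integral>\<^sup>+s. ennreal ((C * \<mu> * t powr a)\<^sup>2) * indicator {0..t} s \<partial>lborel)"
    by (intro nn_integral_mono) (auto simp: indicator_def)
  also have "\<dots> = ennreal ((C * \<mu> * t powr a)\<^sup>2 * t)"
    using t by (subst nn_integral_cmult_indicator) (auto simp: ennreal_mult)
  also have "\<dots> \<le> ennreal (C\<^sup>2 * \<mu>\<^sup>2 * (t powr q * \<Delta> powr (1 + 2 * a - q)))"
  proof (rule ennreal_leI)
    \<comment> \<open>The exponent \<open>1 + 2 * a - q\<close> is nonnegative, so this power of
      \<open>t\<close> may be traded for the same power of \<open>\<Delta>\<close>.\<close>
    have "(t powr a)\<^sup>2 * t = t powr a * t powr a * t powr 1" using t by (simp add: power2_eq_square)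
    also have "\<dots> = t powr q * t powr (1 + 2 * a - q)"
      unfolding powr_add[symmetric] by (simp add: algebra_simps)
    also have "\<dots> \<le> t powr q * \<Delta> powr (1 + 2 * a - q)"
      using assms t by (intro mult_left_mono powr_mono2) auto
    finally have "(t powr a)\<^sup>2 * t \<le> t powr q * \<Delta> powr (1 + 2 * a - q)" .
    then have "(C\<^sup>2 * \<mu>\<^sup>2) * ((t powr a)\<^sup>2 * t) \<le> (C\<^sup>2 * \<mu>\<^sup>2) * (t powr q * \<Delta> powr (1 + 2 * a - q))"
      by (intro mult_left_mono) auto
    then show "(C * \<mu> * t powr a)\<^sup>2 * t \<le> C\<^sup>2 * \<mu>\<^sup>2 * (t powr q * \<Delta> powr (1 + 2 * a - q))"
      by (simp add: power_mult_distrib mult.assoc)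
  qed
  finally show ?thesis .
qed

text \<open>Telescoping covers exponents up to \<open>a\<close> only. A larger \<open>q\<close> is
  reached from \<open>q0 = a\<close> when \<open>t \<ge> \<Delta>\<close>, because then
  \<open>(t / \<Delta>) powr q0 \<le> (t / \<Delta>) powr q\<close>; for \<open>t < \<Delta>\<close>
  the coarse bound holds with \<open>q\<close> itself.\<close>

lemma averaging_error:
  assumes q: "0 < q" "q < 1" "q0 = min q a" and K: "K > 0" "\<And>x y. 0 \<le> y \<Longrightarrow> y \<le> x \<Longrightarrow>
      (x powr a - y powr a)\<^sup>2 \<le> K * (x - y) powr (2 * a - q0) * (x powr q0 - y powr q0)"
  shows "(\<integral>\<^sup>+s. ennreal ((f s - (\<Sum>i = 1..I. mean i * indicator (cell i) s))\<^sup>2) \<partial>lborel)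
    \<le> ennreal ((2 * C\<^sup>2 * K + C\<^sup>2) * \<mu>\<^sup>2 * (t powr q * \<Delta> powr (1 + 2 * a - q)) + 2 * A\<^sup>2 * \<gamma>\<^sup>2 * \<Delta>\<^sup>2 * T)"
    (is "_ \<le> ennreal ?R")
proof -
  have "(\<integral>\<^sup>+s. ennreal ((f s - (\<Sum>i = 1..I. mean i * indicator (cell i) s))\<^sup>2) \<partial>lborel)
      \<le> (\<integral>\<^sup>+s. (\<Sum>i = 1..I. ennreal ((f s - mean i)\<^sup>2) * indicator (cell i) s) \<partial>lborel)"
  proof (rule nn_integral_mono_AE)
    \<comment> \<open>The point \<open>0\<close> is excluded because it lies in no cell, although
      \<open>f\<close> may be nonzero there.\<close>
    have "AE s in lborel. s \<noteq> 0" by (rule AE_lborel_singleton)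
    then show "AE s in lborel. ennreal ((f s - (\<Sum>i = 1..I. mean i * indicator (cell i) s))\<^sup>2)
        \<le> (\<Sum>i = 1..I. ennreal ((f s - mean i)\<^sup>2) * indicator (cell i) s)"
    proof eventually_elim
      case (elim s)
      show ?case
      proof (cases "\<exists>i\<in>{1..I}. s \<in> cell i")
        case True
        then obtain i where i: "i \<in> {1..I}" "s \<in> cell i" by blast
        have uniq: "j = i" if "s \<in> cell j" for j
        proof (rule ccontr)
          assume "j \<noteq> i"
          then consider "Suc j \<le> i" | "Suc i \<le> j" by linarith
          then show False
            using grid_mono[of "Suc j" i] grid_mono[of "Suc i" j] i that by cases (auto simp: cell_def)
        qed
        have "(\<Sum>j = 1..I. mean j * indicator (cell j) s) = (\<Sum>j = 1..I. if j = i then mean i else 0)"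
        proof (intro sum.cong refl)
          fix j
          show "mean j * indicator (cell j) s = (if j = i then mean i else 0)"
            using uniq[of j] i(2) by (cases "s \<in> cell j") auto
        qed
        also have "\<dots> = mean i" using i by (simp add: sum.delta)
        finally have "ennreal ((f s - (\<Sum>i = 1..I. mean i * indicator (cell i) s))\<^sup>2) = ennreal ((f s - mean i)\<^sup>2) * indicator (cell i) s"
          using i by simp
        also have "\<dots> \<le> (\<Sum>i = 1..I. ennreal ((f s - mean i)\<^sup>2) * indicator (cell i) s)"
          using i(1) by (intro member_le_sum) auto
        finally show ?thesis .
      next
        case False
        have "s \<notin> {0<..T}"
        proof
          assume s: "s \<in> {0<..T}"
          define i where "i = nat \<lceil>s / \<Delta>\<rceil>"
          have pos: "s / \<Delta> > 0" using s Delta_pos by simp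
          then have i1: "i \<ge> 1" by (simp add: i_def Suc_le_eq)
          have ceil: "real i = of_int \<lceil>s / \<Delta>\<rceil>" using pos by (simp add: i_def)
          have "s / \<Delta> \<le> real i" "real i - 1 < s / \<Delta>" unfolding ceil by linarith+
          then have b: "s \<le> real i * \<Delta>" "(real i - 1) * \<Delta> < s"
            using Delta_pos by (auto simp: field_simps)
          have "(real i - 1) * \<Delta> < real I * \<Delta>" using b(2) s I by (simp add: \<Delta>_def)
          then have "i \<le> I" using Delta_pos by simp
          moreover have "s \<in> cell i"
            using b by (simp add: cell_def grid_def \<Delta>_def)
          ultimately show False using False i1 by auto
        qed
        then have "f s = 0" using elim t by (auto simp: f_def indicator_def)
        moreover have "(\<Sum>i = 1..I. mean i * indicator (cell i) s) = 0"
          using False by (intro sum.neutral) (auto simp: indicator_def)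
        ultimately show ?thesis by simp
      qed
    qed
  qed
  also have "\<dots> = (\<Sum>i = 1..I. (\<integral>\<^sup>+s. ennreal ((f s - mean i)\<^sup>2) * indicator (cell i) s \<partial>lborel))"
    using f_measurable by (intro nn_integral_sum) (auto simp: cell_def)
  also have "\<dots> \<le> ennreal ?R"
  proof (cases "t < \<Delta>")
    case True
    have "C\<^sup>2 * \<mu>\<^sup>2 * (t powr q * \<Delta> powr (1 + 2 * a - q)) \<le> ?R"
      using K(1) T by (simp add: distrib_right)
    then show ?thesis
      using averaging_error_coarse[OF True, of q] q a by (meson ennreal_leI order_trans less_imp_le add_increasing2 mult_nonneg_nonneg zero_le_numeral)
  next
    case False
    have "t powr q0 * \<Delta> powr (1 + 2 * a - q0) = (t / \<Delta>) powr q0 * \<Delta> powr (1 + 2 * a)"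
      using t Delta_pos by (simp add: powr_divide powr_diff)
    also have "\<dots> \<le> (t / \<Delta>) powr q * \<Delta> powr (1 + 2 * a)"
      using False Delta_pos q by (intro mult_right_mono powr_mono) auto
    also have "\<dots> = t powr q * \<Delta> powr (1 + 2 * a - q)"
      using t Delta_pos by (simp add: powr_divide powr_diff)
    finally have "2 * C\<^sup>2 * K * \<mu>\<^sup>2 * (t powr q0 * \<Delta> powr (1 + 2 * a - q0)) \<le> 2 * C\<^sup>2 * K * \<mu>\<^sup>2 * (t powr q * \<Delta> powr (1 + 2 * a - q))"
      using K by (intro mult_left_mono) auto
    moreover have "0 \<le> C\<^sup>2 * \<mu>\<^sup>2 * (t powr q * \<Delta> powr (1 + 2 * a - q))" by simp
    ultimately have "2 * C\<^sup>2 * K * \<mu>\<^sup>2 * (t powr q0 * \<Delta> powr (1 + 2 * a - q0)) + 2 * A\<^sup>2 * \<gamma>\<^sup>2 * \<Delta>\<^sup>2 * T \<le> ?R"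
      unfolding distrib_right by linarith
    then show ?thesis
      using averaging_error_fine[of q0 K] q a K by (intro order_trans[OF averaging_error_fine ennreal_leI]) auto
  qed
  finally show ?thesis .
qed

text \<open>The two factors \<open>1 / sqrt \<Delta>\<close>, from the noise and from the scaled
  increments, combine to the \<open>1 / \<Delta>\<close> of an average. Thus the regularized
  integral is the stochastic integral of the step function with values
  \<open>mean i\<close>.\<close>

lemma regularized_integral_eq:
  "(LBINT s:{0..t}. g (t - s) * \<phi> s * regularized_white_noise T I \<xi> k s \<omega>)
    = (\<Sum>i = 1..I. mean i * (\<xi> k (grid T I (Suc i)) \<omega> - \<xi> k (grid T I i) \<omega>))"
proof -
  let ?d = "\<lambda>i. \<xi> k (grid T I (Suc i)) \<omega> - \<xi> k (grid T I i) \<omega>"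
  let ?c = "\<lambda>i. {grid T I i..<grid T I (Suc i)}"
  note f_measurable [measurable]
  have int: "integrable lborel (\<lambda>s. indicator (?c i) s * f s)" for i
  proof (rule Bochner_Integration.integrable_bound[of _ "\<lambda>s. indicator (?c i) s * (A * \<mu>)"])
    show "integrable lborel (\<lambda>s. indicator (?c i) s * (A * \<mu>))"
      using Delta_pos by (intro integrable_mult_left) (auto simp: grid_Suc)
    show "AE s in lborel. norm (indicator (?c i) s * f s) \<le> norm (indicator (?c i) s * (A * \<mu>))"
      using f_le by (auto simp: indicator_def intro: order_trans[OF _ abs_ge_self])
  qed measurable
  have "(LBINT s:{0..t}. g (t - s) * \<phi> s * regularized_white_noise T I \<xi> k s \<omega>)
      = (\<integral>s. (\<Sum>i = 1..I. (?d i / \<Delta>) * (indicator (?c i) s * f s)) \<partial>lborel)"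
    unfolding set_lebesgue_integral_def
  proof (intro Bochner_Integration.integral_cong refl)
    fix s
    have "1 / sqrt \<Delta> * (1 / sqrt \<Delta> * x) = x / \<Delta>" for x
      using Delta_pos by (simp add: field_simps flip: real_sqrt_mult)
    then have "regularized_white_noise T I \<xi> k s \<omega> = (\<Sum>i = 1..I. ?d i / \<Delta> * indicator (?c i) s)"
      unfolding regularized_white_noise_def scaled_increment_def \<Delta>_def[symmetric] using Delta_pos by simp
    then show "indicator {0..t} s *\<^sub>R (g (t - s) * \<phi> s * regularized_white_noise T I \<xi> k s \<omega>)
        = (\<Sum>i = 1..I. (?d i / \<Delta>) * (indicator (?c i) s * f s))"
      by (simp add: f_def sum_distrib_left ac_simps)
  qed
  also have "\<dots> = (\<Sum>i = 1..I. (?d i / \<Delta>) * (\<integral>s. indicator (?c i) s * f s \<partial>lborel))"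
    using int by simp
  also have "\<dots> = (\<Sum>i = 1..I. mean i * ?d i)"
  proof (intro sum.cong refl)
    fix i
    have "(\<integral>s. indicator (?c i) s * f s \<partial>lborel) = (\<integral>s. indicator (cell i) s * f s \<partial>lborel)"
    proof (rule integral_cong_AE)
      have "AE s in lborel. s \<noteq> grid T I i" "AE s in lborel. s \<noteq> grid T I (Suc i)"
        by (rule AE_lborel_singleton)+
      then show "AE s in lborel. indicator (?c i) s * f s = indicator (cell i) s * f s"
        by eventually_elim (auto simp: indicator_def cell_def)
    qed (auto simp: cell_def)
    then show "(?d i / \<Delta>) * (\<integral>s. indicator (?c i) s * f s \<partial>lborel) = mean i * ?d i"
      by (simp add: mean_def)
  qed
  finally show ?thesis .
qed

end

section \<open>The regularization error\<close>

text \<open>The distance from the true integrand to the cell averages passes through the regularized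
  integrand \<open>f\<close>: the first leg is at most \<open>A * \<eta>\<close> pointwise, the
  second is the averaging error. The constants 8 and 16 collect the 4 from
  \<open>ito_integral_step_error\<close>, the 2 from this splitting and the 2 already present in
  \<open>averaging_error\<close>.\<close>

lemma (in wiener) mode_error:
  assumes ca: "cell_averaging T t a A C \<mu> \<gamma> I g \<phi>"
    and X: "has_ito_integral M F W t (\<lambda>s \<omega>. g (t - s) * \<psi> s) X"
    and W: "\<And>i. \<xi> k i = W i"
    and psi: "continuous_on {0..T} \<psi>" "\<And>s. s \<in> {0..T} \<Longrightarrow> \<bar>\<psi> s - \<phi> s\<bar> \<le> \<eta>"
    and q: "0 < q" "q < 1" "q0 = min q a" and K: "K > 0" "\<And>x y. 0 \<le> y \<Longrightarrow> y \<le> x \<Longrightarrow>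
      (x powr a - y powr a)\<^sup>2 \<le> K * (x - y) powr (2 * a - q0) * (x powr q0 - y powr q0)"
  defines "Y \<equiv> \<lambda>\<omega>. LBINT s:{0..t}. g (t - s) * \<phi> s * regularized_white_noise T I \<xi> k s \<omega>"
  shows "Y \<in> borel_measurable M"
    and "(\<integral>\<^sup>+\<omega>. ennreal ((X \<omega> - Y \<omega>)\<^sup>2) \<partial>M) \<le> ennreal (8 * T * (A\<^sup>2 * \<eta>\<^sup>2)
      + 8 * (2 * C\<^sup>2 * K + C\<^sup>2) * (t powr q * (T / real I) powr (1 + 2 * a - q)) * \<mu>\<^sup>2
      + 16 * T * (T / real I)\<^sup>2 * (A\<^sup>2 * \<gamma>\<^sup>2))"
proof -
  interpret cell_averaging T t a A C \<mu> \<gamma> I g \<phi> by (rule ca)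
  have Y: "Y \<omega> = (\<Sum>i = 1..I. mean i * (W (grid T I (Suc i)) \<omega> - W (grid T I i) \<omega>))" for \<omega>
    unfolding Y_def regularized_integral_eq by (simp add: W)
  have gr: "0 \<le> grid T I i \<and> grid T I i \<le> grid T I (Suc i)" if "i \<in> {1..I}" for i
    using that grid_nonneg[of i] grid_mono[of i "Suc i"] by auto
  show "Y \<in> borel_measurable M"
    unfolding Y[abs_def]
  proof (intro borel_measurable_sum borel_measurable_times borel_measurable_diff borel_measurable_const)
    fix i assume "i \<in> {1..I}"
    from gr[OF this] show "W (grid T I (Suc i)) \<in> borel_measurable M" "W (grid T I i) \<in> borel_measurable M"
      by (auto intro: W_measurable)
  qed
  let ?F = "\<lambda>s. indicator {0..t} s * (g (t - s) * \<psi> s)"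
  let ?B = "\<lambda>s. \<Sum>i = 1..I. mean i * indicator (cell i) s"
  have "continuous_on {0..t} (\<lambda>s. g (t - s) * \<psi> s)"
    by (intro continuous_intros continuous_on_compose2[OF cont_g] continuous_on_subset[OF psi(1)]) (use t in auto)
  from borel_measurable_continuous_on_indicator[OF _ this]
  have Fm: "?F \<in> borel_measurable borel" by simp
  note Fm [measurable] and f_measurable [measurable]
  have "(\<integral>\<^sup>+\<omega>. ennreal ((X \<omega> - Y \<omega>)\<^sup>2) \<partial>M) \<le> 4 * (\<integral>\<^sup>+s. ennreal ((?F s - ?B s)\<^sup>2) \<partial>lborel)"
    unfolding Y cell_def by (rule ito_integral_step_error[OF X gr _ Fm]) auto
  also have "\<dots> \<le> 4 * ennreal (2 * (A\<^sup>2 * \<eta>\<^sup>2 * T) + 2 * ((2 * C\<^sup>2 * K + C\<^sup>2) * \<mu>\<^sup>2 * (t powr q * \<Delta> powr (1 + 2 * a - q)) + 2 * A\<^sup>2 * \<gamma>\<^sup>2 * \<Delta>\<^sup>2 * T))"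
    (is "_ \<le> 4 * ennreal (2 * ?r1 + 2 * ?r2)")
  proof (rule mult_left_mono)
    have r: "?r1 \<ge> 0" "?r2 \<ge> 0" using T K by auto
    have "(\<integral>\<^sup>+s. ennreal ((?F s - ?B s)\<^sup>2) \<partial>lborel)
        \<le> (\<integral>\<^sup>+s. 2 * ennreal ((?F s - f s)\<^sup>2) + 2 * ennreal ((f s - ?B s)\<^sup>2) \<partial>lborel)"
    proof (rule nn_integral_mono)
      fix s
      have "(?F s - ?B s)\<^sup>2 \<le> 2 * (?F s - f s)\<^sup>2 + 2 * (f s - ?B s)\<^sup>2"
        using sum_squares_bound[of "?F s - f s" "f s - ?B s"] power2_sum[of "?F s - f s" "f s - ?B s"] by simp
      then have "ennreal ((?F s - ?B s)\<^sup>2) \<le> ennreal (2 * (?F s - f s)\<^sup>2 + 2 * (f s - ?B s)\<^sup>2)" by (rule ennreal_leI)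
      then show "ennreal ((?F s - ?B s)\<^sup>2) \<le> 2 * ennreal ((?F s - f s)\<^sup>2) + 2 * ennreal ((f s - ?B s)\<^sup>2)"
        by (simp add: ennreal_mult)
    qed
    also have "\<dots> = 2 * (\<integral>\<^sup>+s. ennreal ((?F s - f s)\<^sup>2) \<partial>lborel) + 2 * (\<integral>\<^sup>+s. ennreal ((f s - ?B s)\<^sup>2) \<partial>lborel)"
    proof -
      have "(\<integral>\<^sup>+s. 2 * x s + 2 * y s \<partial>lborel) = 2 * (\<integral>\<^sup>+s. x s \<partial>lborel) + 2 * (\<integral>\<^sup>+s. y s \<partial>lborel)"
        if "x \<in> borel_measurable borel" "y \<in> borel_measurable borel" for x y :: "real \<Rightarrow> ennreal"
        using that by (subst nn_integral_add) (auto simp: nn_integral_cmult)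
      then show ?thesis by measurable
    qed
    also have "\<dots> \<le> 2 * ennreal ?r1 + 2 * ennreal ?r2"
    proof (intro add_mono mult_left_mono averaging_error[OF q K])
      have "(\<integral>\<^sup>+s. ennreal ((?F s - f s)\<^sup>2) \<partial>lborel) \<le> (\<integral>\<^sup>+s. ennreal (A\<^sup>2 * \<eta>\<^sup>2) * indicator {0..t} s \<partial>lborel)"
      proof (rule nn_integral_mono)
        fix s
        have "(?F s - f s)\<^sup>2 \<le> A\<^sup>2 * \<eta>\<^sup>2" if s: "s \<in> {0..t}"
        proof -
          have "\<bar>g (t - s) * (\<psi> s - \<phi> s)\<bar> \<le> A * \<eta>"
            unfolding abs_mult using g_le[of "t - s"] psi(2)[of s] s t A_nonneg by (intro mult_mono) auto
          from power_mono[OF this abs_ge_zero, of 2] show ?thesis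
            using s by (simp add: f_def power_mult_distrib right_diff_distrib)
        qed
        then show "ennreal ((?F s - f s)\<^sup>2) \<le> ennreal (A\<^sup>2 * \<eta>\<^sup>2) * indicator {0..t} s"
          by (cases "s \<in> {0..t}") (auto simp: f_def intro: ennreal_leI)
      qed
      also have "\<dots> = ennreal (A\<^sup>2 * \<eta>\<^sup>2 * t)"
        using t by (subst nn_integral_cmult_indicator) (auto simp: ennreal_mult)
      also have "\<dots> \<le> ennreal ?r1" using t by (intro ennreal_leI mult_left_mono) auto
      finally show "(\<integral>\<^sup>+s. ennreal ((?F s - f s)\<^sup>2) \<partial>lborel) \<le> ennreal ?r1" .
    qed auto
    also have "\<dots> = ennreal (2 * ?r1 + 2 * ?r2)"
    proof -
      have "2 * ennreal x + 2 * ennreal y = ennreal (2 * x + 2 * y)" if "x \<ge> 0" "y \<ge> 0" for x y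
        using that by (simp add: ennreal_mult)
      from this[OF r] show ?thesis .
    qed
    finally show "(\<integral>\<^sup>+s. ennreal ((?F s - ?B s)\<^sup>2) \<partial>lborel) \<le> ennreal (2 * ?r1 + 2 * ?r2)" .
  qed simp
  also have "\<dots> = ennreal (4 * (2 * ?r1 + 2 * ?r2))"
    using T K by (subst ennreal_mult) auto
  also have "4 * (2 * ?r1 + 2 * ?r2) = 8 * T * (A\<^sup>2 * \<eta>\<^sup>2)
      + 8 * (2 * C\<^sup>2 * K + C\<^sup>2) * (t powr q * (T / real I) powr (1 + 2 * a - q)) * \<mu>\<^sup>2
      + 16 * T * (T / real I)\<^sup>2 * (A\<^sup>2 * \<gamma>\<^sup>2)"
    unfolding \<Delta>_def by (simp add: algebra_simps)
  finally show "(\<integral>\<^sup>+\<omega>. ennreal ((X \<omega> - Y \<omega>)\<^sup>2) \<partial>M) \<le> ennreal (8 * T * (A\<^sup>2 * \<eta>\<^sup>2)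
      + 8 * (2 * C\<^sup>2 * K + C\<^sup>2) * (t powr q * (T / real I) powr (1 + 2 * a - q)) * \<mu>\<^sup>2
      + 16 * T * (T / real I)\<^sup>2 * (A\<^sup>2 * \<gamma>\<^sup>2))" .
qed

section \<open>Summation over the modes\<close>

lemma (in complete_measure) borel_measurable_AE_cong:
  fixes f g :: "'a \<Rightarrow> 'b::topological_space"
  assumes f: "f \<in> borel_measurable M" and ae: "AE x in M. f x = g x"
  shows "g \<in> borel_measurable M"
proof (rule measurableI)
  fix A :: "'b set" assume "A \<in> sets borel"
  then have A: "f -` A \<inter> space M \<in> sets M" using f by (rule measurable_sets[rotated])
  have "AE x in M. x \<in> f -` A \<inter> space M \<longleftrightarrow> x \<in> g -` A \<inter> space M"
    using ae by eventually_elim auto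
  from in_sets_AE[OF this A] show "g -` A \<inter> space M \<in> sets M" by simp
qed auto

text \<open>Here \<open>h\<close> will be the squared error norm, which is known only almost surely
  as a sum over modes; completeness of the measure makes it measurable all the same. Monotone
  convergence then exchanges sum and expectation.\<close>

lemma (in complete_measure) integral_suminf_le:
  fixes h :: "'a \<Rightarrow> real" and e :: "nat \<Rightarrow> 'a \<Rightarrow> real"
  assumes e: "\<And>k. e k \<in> borel_measurable M" "\<And>k \<omega>. e k \<omega> \<ge> 0"
    and le: "\<And>k. (\<integral>\<^sup>+\<omega>. ennreal (e k \<omega>) \<partial>M) \<le> ennreal (R k)"
    and R: "\<And>k. R k \<ge> 0" "summable R"
    and h: "AE \<omega> in M. (\<lambda>k. e k \<omega>) sums h \<omega>" "\<And>\<omega>. h \<omega> \<ge> 0"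
  shows "integrable M h" "integral\<^sup>L M h \<le> suminf R"
proof -
  have "AE \<omega> in M. (\<Sum>k. e k \<omega>) = h \<omega>" using h(1) by eventually_elim (simp add: sums_iff)
  moreover have "(\<lambda>\<omega>. \<Sum>k. e k \<omega>) \<in> borel_measurable M"
    using e(1) by (rule borel_measurable_suminf)
  ultimately have m: "h \<in> borel_measurable M"
    by (rule borel_measurable_AE_cong[rotated])
  have "(\<integral>\<^sup>+\<omega>. ennreal (h \<omega>) \<partial>M) = (\<integral>\<^sup>+\<omega>. (\<Sum>k. ennreal (e k \<omega>)) \<partial>M)"
  proof (rule nn_integral_cong_AE)
    show "AE \<omega> in M. ennreal (h \<omega>) = (\<Sum>k. ennreal (e k \<omega>))"
      using h(1) by eventually_elim (use e(2) in \<open>auto simp: sums_iff suminf_ennreal2\<close>)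
  qed
  also have "\<dots> = (\<Sum>k. \<integral>\<^sup>+\<omega>. ennreal (e k \<omega>) \<partial>M)"
    using e(1) by (intro nn_integral_suminf) auto
  also have "\<dots> \<le> (\<Sum>k. ennreal (R k))"
    by (intro suminf_le le) auto
  also have "\<dots> = ennreal (suminf R)" using R by (intro suminf_ennreal2) auto
  finally have nn: "(\<integral>\<^sup>+\<omega>. ennreal (h \<omega>) \<partial>M) \<le> ennreal (suminf R)" .
  then show int: "integrable M h"
    using m h(2) by (intro integrableI_nonneg) (auto simp: top_unique less_top[symmetric])
  have "ennreal (integral\<^sup>L M h) \<le> ennreal (suminf R)"
    using nn nn_integral_eq_integral[OF int] h(2) by simp
  then show "integral\<^sup>L M h \<le> suminf R"
    using suminf_nonneg[OF R(2,1)] by (simp add: ennreal_le_iff)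
qed

lemma bounded_derivative_lipschitz:
  fixes f :: "real \<Rightarrow> real"
  assumes "\<And>t. t \<in> {0..T} \<Longrightarrow> \<exists>d. (f has_real_derivative d) (at t within {0..T}) \<and> \<bar>d\<bar> \<le> \<gamma>"
  shows "continuous_on {0..T} f"
    and "r \<in> {0..T} \<Longrightarrow> s \<in> {0..T} \<Longrightarrow> \<bar>f r - f s\<bar> \<le> \<gamma> * \<bar>r - s\<bar>"
proof -
  obtain d where d: "\<And>t. t \<in> {0..T} \<Longrightarrow> (f has_real_derivative d t) (at t within {0..T})"
    "\<And>t. t \<in> {0..T} \<Longrightarrow> \<bar>d t\<bar> \<le> \<gamma>"
    using assms by metis
  show "continuous_on {0..T} f" using d(1) by (rule DERIV_continuous_on)
  show "\<bar>f r - f s\<bar> \<le> \<gamma> * \<bar>r - s\<bar>" if "r \<in> {0..T}" "s \<in> {0..T}"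
    using field_differentiable_bound[of "{0..T}" f d \<gamma> r s] d that by simp
qed

text \<open>Both cases of the theorem with a common exponent \<open>q\<close> for the time factor.
  The constant is fixed before the noise, the data and the grid.\<close>

lemma mean_square_regularization_error:
  fixes \<alpha> \<beta> T q :: real
  assumes "1 < \<alpha>" "\<alpha> < 2" and T: "T > 0" and q: "0 < q" "q < 1" "2 * \<alpha> - 3 \<le> q"
  shows "\<exists>C>0.
       \<forall>(M :: 'a measure) F \<xi> \<sigma> \<sigma>n \<mu> \<gamma> \<eta>n \<mu>n \<gamma>n v1 v2 (I :: nat) u un.
         complete_filtered_prob_space M F \<longrightarrow>
         (\<forall>k\<ge>1. wiener_process M F (\<xi> k)) \<longrightarrow>
         noise_coefficients T \<sigma> \<sigma>n \<mu> \<gamma> \<eta>n \<mu>n \<gamma>n \<longrightarrow>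
         v1 \<in> L2_01 \<longrightarrow> v2 \<in> L2_01 \<longrightarrow> I \<ge> 1 \<longrightarrow>
         mild_solution M F \<xi> \<alpha> \<beta> T \<sigma> v1 v2 u \<longrightarrow>
         regularized_mild_solution M \<xi> \<alpha> \<beta> T I \<sigma>n v1 v2 un \<longrightarrow>
         summable (\<lambda>k. eigval (Suc k) powr (- (2 * \<beta> * (\<alpha> - 1) / \<alpha>)) * (\<eta>n (Suc k))\<^sup>2) \<longrightarrow>
         summable (\<lambda>k. eigval (Suc k) powr (- (2 * \<beta> * (\<alpha> - 1) / \<alpha>)) * (\<gamma>n (Suc k))\<^sup>2) \<longrightarrow>
         summable (\<lambda>k. (\<mu>n (Suc k))\<^sup>2) \<longrightarrow>
         (\<forall>t\<in>{0<..T}.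
            integrable M (\<lambda>\<omega>. (L2_norm01 (\<lambda>x. u t \<omega> x - un t \<omega> x))\<^sup>2) \<and>
            integral\<^sup>L M (\<lambda>\<omega>. (L2_norm01 (\<lambda>x. u t \<omega> x - un t \<omega> x))\<^sup>2)
            \<le> C * (\<Sum>k. eigval (Suc k) powr (- (2 * \<beta> * (\<alpha> - 1) / \<alpha>)) * (\<eta>n (Suc k))\<^sup>2)
              + C * (T / real I)\<^sup>2
                * (\<Sum>k. eigval (Suc k) powr (- (2 * \<beta> * (\<alpha> - 1) / \<alpha>)) * (\<gamma>n (Suc k))\<^sup>2)
              + C * t powr q * (T / real I) powr (2 * \<alpha> - 1 - q)
                * (\<Sum>k. (\<mu>n (Suc k))\<^sup>2))"
proof -
  define a where "a = \<alpha> - 1"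
  define q0 where "q0 = min q a"
  have a: "0 < a" "a < 1" using assms by (auto simp: a_def)
  \<comment> \<open>Passing from \<open>q\<close> to \<open>min q a\<close> preserves the lower
    bound, because \<open>a < 1\<close> gives \<open>2 * a - 1 < a\<close>.\<close>
  have q0: "0 < q0" "q0 \<le> a" "2 * a - 1 \<le> q0" using a q by (auto simp: q0_def a_def)
  obtain C where C: "C > 0"
    "\<And>k r. k \<ge> 1 \<Longrightarrow> r \<ge> 0 \<Longrightarrow> \<bar>mild_kernel \<alpha> \<beta> k r\<bar> \<le> C * eigval k powr (- (\<beta> * (\<alpha> - 1) / \<alpha>))"
    "\<And>k r s. k \<ge> 1 \<Longrightarrow> 0 \<le> s \<Longrightarrow> s \<le> r \<Longrightarrow>
        \<bar>mild_kernel \<alpha> \<beta> k r - mild_kernel \<alpha> \<beta> k s\<bar> \<le> C * (r powr a - s powr a)"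
    using mild_kernel_bounds[OF assms(1,2), of \<beta>] unfolding a_def by metis
  obtain K where K: "K > 0" "\<And>x y. 0 \<le> y \<Longrightarrow> y \<le> x \<Longrightarrow>
      (x powr a - y powr a)\<^sup>2 \<le> K * (x - y) powr (2 * a - q0) * (x powr q0 - y powr q0)"
    using powr_increment_square_le[OF q0(1,2) a(2) q0(3)] by metis
  \<comment> \<open>Dominates the constants of the three terms in \<open>mode_error\<close> at once;
    it involves neither the mode nor \<open>t\<close> nor the grid.\<close>
  define D where "D = 16 * T * C\<^sup>2 + 8 * (2 * C\<^sup>2 * K + C\<^sup>2)"
  have D: "D > 0" "8 * T * C\<^sup>2 \<le> D" "16 * T * C\<^sup>2 \<le> D" "8 * (2 * C\<^sup>2 * K + C\<^sup>2) \<le> D"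
    using T C(1) K(1) by (auto simp: D_def intro!: add_pos_pos)
  show ?thesis
  proof (rule exI[of _ D], rule conjI[OF D(1)], intro allI impI ballI)
    fix M :: "'a measure" and F \<xi> \<sigma> \<sigma>n \<mu> \<gamma> \<eta>n \<mu>n \<gamma>n v1 v2 and I :: nat and u un t
    let ?w = "\<lambda>k. eigval (Suc k) powr (- (2 * \<beta> * (\<alpha> - 1) / \<alpha>))"
    assume cf: "complete_filtered_prob_space M F" and wp: "\<forall>k\<ge>1. wiener_process M F (\<xi> k)"
      and nc: "noise_coefficients T \<sigma> \<sigma>n \<mu> \<gamma> \<eta>n \<mu>n \<gamma>n" and I: "I \<ge> 1"
      and ms: "mild_solution M F \<xi> \<alpha> \<beta> T \<sigma> v1 v2 u"
      and rms: "regularized_mild_solution M \<xi> \<alpha> \<beta> T I \<sigma>n v1 v2 un"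
      and sm: "summable (\<lambda>k. ?w k * (\<eta>n (Suc k))\<^sup>2)" "summable (\<lambda>k. ?w k * (\<gamma>n (Suc k))\<^sup>2)" "summable (\<lambda>k. (\<mu>n (Suc k))\<^sup>2)"
      and t: "t \<in> {0<..T}"
    interpret prob_space M using cf by (simp add: complete_filtered_prob_space_def)
    interpret complete_measure M using cf by (simp add: complete_filtered_prob_space_def)
    have wn: "wiener M F (\<xi> k)" if "k \<ge> 1" for k
    proof (intro wiener.intro wiener_axioms.intro prob_space_axioms)
      show "wiener_process M F (\<xi> k)" using wp that by blast
    qed (use cf in \<open>auto simp: complete_filtered_prob_space_def\<close>)
    have t': "t \<in> {0..T}" using t by auto
    obtain J where J: "\<And>k. k \<ge> 1 \<Longrightarrow> has_ito_integral M F (\<xi> k) t (\<lambda>s \<omega>. mild_kernel \<alpha> \<beta> k (t - s) * \<sigma> k s) (J k)"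
      and Ju: "AE \<omega> in M. L2_expansion (\<lambda>k. mild_initial \<alpha> \<beta> v1 v2 t k + J k \<omega>) (u t \<omega>)"
      using bspec[OF ms[unfolded mild_solution_def] t'] by blast
    define Y where "Y k \<omega> = (LBINT s:{0..t}. mild_kernel \<alpha> \<beta> k (t - s) * \<sigma>n k s * regularized_white_noise T I \<xi> k s \<omega>)" for k \<omega>
    have Yu: "AE \<omega> in M. L2_expansion (\<lambda>k. mild_initial \<alpha> \<beta> v1 v2 t k + Y k \<omega>) (un t \<omega>)"
      using bspec[OF rms[unfolded regularized_mild_solution_def] t'] unfolding Y_def .
    have sums: "AE \<omega> in M. (\<lambda>k. (J (Suc k) \<omega> - Y (Suc k) \<omega>)\<^sup>2) sums (L2_norm01 (\<lambda>x. u t \<omega> x - un t \<omega> x))\<^sup>2"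
      using Ju Yu
    proof eventually_elim
      case (elim \<omega>)
      from L2_expansion_Parseval[OF L2_expansion_diff[OF elim]] show ?case by simp
    qed
    let ?P = "t powr q * (T / real I) powr (2 * \<alpha> - 1 - q)"
    define R where "R k = D * (?w k * (\<eta>n (Suc k))\<^sup>2) + D * (T / real I)\<^sup>2 * (?w k * (\<gamma>n (Suc k))\<^sup>2) + D * ?P * (\<mu>n (Suc k))\<^sup>2" for k
    have mode: "Y (Suc k) \<in> borel_measurable M"
      "(\<integral>\<^sup>+\<omega>. ennreal ((J (Suc k) \<omega> - Y (Suc k) \<omega>)\<^sup>2) \<partial>M) \<le> ennreal (R k)" for k
    proof -
      interpret w: wiener M F "\<xi> (Suc k)" by (rule wn) simp
      let ?A = "C * eigval (Suc k) powr (- (\<beta> * (\<alpha> - 1) / \<alpha>))"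
      have nk: "\<bar>\<sigma> (Suc k) s - \<sigma>n (Suc k) s\<bar> \<le> \<eta>n (Suc k)" "\<bar>\<sigma>n (Suc k) s\<bar> \<le> \<mu>n (Suc k)"
        "\<exists>d. (\<sigma> (Suc k) has_real_derivative d) (at s within {0..T}) \<and> \<bar>d\<bar> \<le> \<gamma> (Suc k)"
        "\<exists>d. (\<sigma>n (Suc k) has_real_derivative d) (at s within {0..T}) \<and> \<bar>d\<bar> \<le> \<gamma>n (Suc k)" if "s \<in> {0..T}" for s
        using nc that unfolding noise_coefficients_def by auto
      have ca: "cell_averaging T t a ?A C (\<mu>n (Suc k)) (\<gamma>n (Suc k)) I (mild_kernel \<alpha> \<beta> (Suc k)) (\<sigma>n (Suc k))"
      proof
        show "continuous_on {0..} (mild_kernel \<alpha> \<beta> (Suc k))"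
          by (rule continuous_on_mild_kernel[OF assms(1,2)])
        show "mild_kernel \<alpha> \<beta> (Suc k) 0 = 0" by (simp add: mild_kernel_def)
      qed (use T t I a C nk bounded_derivative_lipschitz[OF nk(4)] in auto)
      have "1 \<le> Suc k" by simp
      note err = w.mode_error[where \<xi> = \<xi> and k = "Suc k" and \<psi> = "\<sigma> (Suc k)", OF ca J[OF this] refl bounded_derivative_lipschitz(1)[OF nk(3)] nk(1) q(1,2) q0_def K]
      show "Y (Suc k) \<in> borel_measurable M"
        using err(1) unfolding Y_def[abs_def] by simp
      \<comment> \<open>Squaring the kernel bound doubles the exponent of the eigenvalue; this is
        the origin of the weight in the first two series.\<close>
      have A2: "?A\<^sup>2 = C\<^sup>2 * ?w k"
        using eigval_pos[of "Suc k"]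
        by (simp add: power_mult_distrib power2_eq_square[of "_ powr _"] mult.assoc flip: powr_add)
      have e: "1 + 2 * a - q = 2 * \<alpha> - 1 - q" by (simp add: a_def)
      have "(\<integral>\<^sup>+\<omega>. ennreal ((J (Suc k) \<omega> - Y (Suc k) \<omega>)\<^sup>2) \<partial>M)
          \<le> ennreal (8 * T * (?A\<^sup>2 * (\<eta>n (Suc k))\<^sup>2) + 8 * (2 * C\<^sup>2 * K + C\<^sup>2) * ?P * (\<mu>n (Suc k))\<^sup>2
            + 16 * T * (T / real I)\<^sup>2 * (?A\<^sup>2 * (\<gamma>n (Suc k))\<^sup>2))"
        using err(2) unfolding Y_def e by simp
      also have "\<dots> \<le> ennreal (R k)"
      proof (rule ennreal_leI)
        have "8 * T * (?A\<^sup>2 * (\<eta>n (Suc k))\<^sup>2) \<le> D * (?w k * (\<eta>n (Suc k))\<^sup>2)"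
          using mult_right_mono[OF D(2), of "?w k * (\<eta>n (Suc k))\<^sup>2"] unfolding A2 by (simp add: mult.assoc)
        moreover have "8 * (2 * C\<^sup>2 * K + C\<^sup>2) * ?P * (\<mu>n (Suc k))\<^sup>2 \<le> D * ?P * (\<mu>n (Suc k))\<^sup>2"
          using D(4) by (intro mult_right_mono) auto
        moreover have "16 * T * (T / real I)\<^sup>2 * (?A\<^sup>2 * (\<gamma>n (Suc k))\<^sup>2) \<le> D * (T / real I)\<^sup>2 * (?w k * (\<gamma>n (Suc k))\<^sup>2)"
          using mult_right_mono[OF D(3), of "(T / real I)\<^sup>2 * (?w k * (\<gamma>n (Suc k))\<^sup>2)"] unfolding A2
          by (simp only: ac_simps) simp
        ultimately show "8 * T * (?A\<^sup>2 * (\<eta>n (Suc k))\<^sup>2) + 8 * (2 * C\<^sup>2 * K + C\<^sup>2) * ?P * (\<mu>n (Suc k))\<^sup>2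
            + 16 * T * (T / real I)\<^sup>2 * (?A\<^sup>2 * (\<gamma>n (Suc k))\<^sup>2) \<le> R k"
          unfolding R_def by linarith
      qed
      finally show "(\<integral>\<^sup>+\<omega>. ennreal ((J (Suc k) \<omega> - Y (Suc k) \<omega>)\<^sup>2) \<partial>M) \<le> ennreal (R k)" .
    qed
    have Jm: "J (Suc k) \<in> borel_measurable M" for k
      using J[of "Suc k"] by (simp add: has_ito_integral_def)
    have R0: "R k \<ge> 0" for k using D(1) by (auto simp: R_def intro!: add_nonneg_nonneg mult_nonneg_nonneg)
    have Rs: "R sums (D * (\<Sum>k. ?w k * (\<eta>n (Suc k))\<^sup>2) + D * (T / real I)\<^sup>2 * (\<Sum>k. ?w k * (\<gamma>n (Suc k))\<^sup>2) + D * ?P * (\<Sum>k. (\<mu>n (Suc k))\<^sup>2))"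
      unfolding R_def by (intro sums_add sums_mult summable_sums sm)
    have "integrable M (\<lambda>\<omega>. (L2_norm01 (\<lambda>x. u t \<omega> x - un t \<omega> x))\<^sup>2)"
      "integral\<^sup>L M (\<lambda>\<omega>. (L2_norm01 (\<lambda>x. u t \<omega> x - un t \<omega> x))\<^sup>2) \<le> suminf R"
      using mode Jm by (intro integral_suminf_le[OF _ _ _ R0 sums_summable[OF Rs] sums]; auto)+
    then show "integrable M (\<lambda>\<omega>. (L2_norm01 (\<lambda>x. u t \<omega> x - un t \<omega> x))\<^sup>2) \<and>
       integral\<^sup>L M (\<lambda>\<omega>. (L2_norm01 (\<lambda>x. u t \<omega> x - un t \<omega> x))\<^sup>2)
       \<le> D * (\<Sum>k. ?w k * (\<eta>n (Suc k))\<^sup>2) + D * (T / real I)\<^sup>2 * (\<Sum>k. ?w k * (\<gamma>n (Suc k))\<^sup>2)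
         + D * t powr q * (T / real I) powr (2 * \<alpha> - 1 - q) * (\<Sum>k. (\<mu>n (Suc k))\<^sup>2)"
      using sums_unique[OF Rs] by (simp add: mult.assoc)
  qed
qed

theorem theorem2p6:
  fixes \<alpha> \<beta> T :: real
  assumes "1 < \<alpha>" "\<alpha> < 2" "1 / 2 < \<beta>" "\<beta> \<le> 1" "T > 0"
  shows
    "(\<alpha> \<le> 3 / 2 \<longrightarrow> (\<forall>\<epsilon>. 0 < \<epsilon> \<and> \<epsilon> < 1 / 2 \<longrightarrow> (\<exists>C>0.
       \<forall>(M :: 'a measure) F \<xi> \<sigma> \<sigma>n \<mu> \<gamma> \<eta>n \<mu>n \<gamma>n v1 v2 (I :: nat) u un.
         complete_filtered_prob_space M F \<longrightarrow>
         (\<forall>k\<ge>1. wiener_process M F (\<xi> k)) \<longrightarrow>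
         noise_coefficients T \<sigma> \<sigma>n \<mu> \<gamma> \<eta>n \<mu>n \<gamma>n \<longrightarrow>
         v1 \<in> L2_01 \<longrightarrow> v2 \<in> L2_01 \<longrightarrow> I \<ge> 1 \<longrightarrow>
         mild_solution M F \<xi> \<alpha> \<beta> T \<sigma> v1 v2 u \<longrightarrow>
         regularized_mild_solution M \<xi> \<alpha> \<beta> T I \<sigma>n v1 v2 un \<longrightarrow>
         summable (\<lambda>k. eigval (Suc k) powr (- (2 * \<beta> * (\<alpha> - 1) / \<alpha>)) * (\<eta>n (Suc k))\<^sup>2) \<longrightarrow>
         summable (\<lambda>k. eigval (Suc k) powr (- (2 * \<beta> * (\<alpha> - 1) / \<alpha>)) * (\<gamma>n (Suc k))\<^sup>2) \<longrightarrow>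
         summable (\<lambda>k. (\<mu>n (Suc k))\<^sup>2) \<longrightarrow>
         (\<forall>t\<in>{0<..T}.
            integrable M (\<lambda>\<omega>. (L2_norm01 (\<lambda>x. u t \<omega> x - un t \<omega> x))\<^sup>2) \<and>
            integral\<^sup>L M (\<lambda>\<omega>. (L2_norm01 (\<lambda>x. u t \<omega> x - un t \<omega> x))\<^sup>2)
            \<le> C * (\<Sum>k. eigval (Suc k) powr (- (2 * \<beta> * (\<alpha> - 1) / \<alpha>)) * (\<eta>n (Suc k))\<^sup>2)
              + C * (T / real I)\<^sup>2
                * (\<Sum>k. eigval (Suc k) powr (- (2 * \<beta> * (\<alpha> - 1) / \<alpha>)) * (\<gamma>n (Suc k))\<^sup>2)
              + C * t powr (2 * \<epsilon>) * (T / real I) powr (2 * \<alpha> - 1 - 2 * \<epsilon>)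
                * (\<Sum>k. (\<mu>n (Suc k))\<^sup>2)))))
     \<and>
     (3 / 2 < \<alpha> \<longrightarrow> (\<exists>C>0.
       \<forall>(M :: 'a measure) F \<xi> \<sigma> \<sigma>n \<mu> \<gamma> \<eta>n \<mu>n \<gamma>n v1 v2 (I :: nat) u un.
         complete_filtered_prob_space M F \<longrightarrow>
         (\<forall>k\<ge>1. wiener_process M F (\<xi> k)) \<longrightarrow>
         noise_coefficients T \<sigma> \<sigma>n \<mu> \<gamma> \<eta>n \<mu>n \<gamma>n \<longrightarrow>
         v1 \<in> L2_01 \<longrightarrow> v2 \<in> L2_01 \<longrightarrow> I \<ge> 1 \<longrightarrow>
         mild_solution M F \<xi> \<alpha> \<beta> T \<sigma> v1 v2 u \<longrightarrow>
         regularized_mild_solution M \<xi> \<alpha> \<beta> T I \<sigma>n v1 v2 un \<longrightarrow>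
         summable (\<lambda>k. eigval (Suc k) powr (- (2 * \<beta> * (\<alpha> - 1) / \<alpha>)) * (\<eta>n (Suc k))\<^sup>2) \<longrightarrow>
         summable (\<lambda>k. eigval (Suc k) powr (- (2 * \<beta> * (\<alpha> - 1) / \<alpha>)) * (\<gamma>n (Suc k))\<^sup>2) \<longrightarrow>
         summable (\<lambda>k. (\<mu>n (Suc k))\<^sup>2) \<longrightarrow>
         (\<forall>t\<in>{0<..T}.
            integrable M (\<lambda>\<omega>. (L2_norm01 (\<lambda>x. u t \<omega> x - un t \<omega> x))\<^sup>2) \<and>
            integral\<^sup>L M (\<lambda>\<omega>. (L2_norm01 (\<lambda>x. u t \<omega> x - un t \<omega> x))\<^sup>2)
            \<le> C * (\<Sum>k. eigval (Suc k) powr (- (2 * \<beta> * (\<alpha> - 1) / \<alpha>)) * (\<eta>n (Suc k))\<^sup>2)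
              + C * (T / real I)\<^sup>2
                * (\<Sum>k. eigval (Suc k) powr (- (2 * \<beta> * (\<alpha> - 1) / \<alpha>)) * (\<gamma>n (Suc k))\<^sup>2)
              + C * t powr (2 * \<alpha> - 3) * (T / real I)\<^sup>2
                * (\<Sum>k. (\<mu>n (Suc k))\<^sup>2))))"
proof -
  let "(_ \<longrightarrow> (\<forall>\<epsilon>. _ \<longrightarrow> ?E1 \<epsilon>)) \<and> (_ \<longrightarrow> ?E2)" = ?thesis
  show ?thesis
  proof (intro conjI impI allI)
    fix \<epsilon> :: real
    assume "\<alpha> \<le> 3 / 2" "0 < \<epsilon> \<and> \<epsilon> < 1 / 2"
    then have q: "0 < 2 * \<epsilon>" "2 * \<epsilon> < 1" "2 * \<alpha> - 3 \<le> 2 * \<epsilon>" by auto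
    show "?E1 \<epsilon>"
      by (rule mean_square_regularization_error[OF assms(1,2,5) q])
  next
    assume "3 / 2 < \<alpha>"
    then have q: "0 < 2 * \<alpha> - 3" "2 * \<alpha> - 3 < 1" "2 * \<alpha> - 3 \<le> 2 * \<alpha> - 3" using assms by auto
    \<comment> \<open>With this \<open>q\<close> the exponent of the step size is 2. The case
      \<open>I = 0\<close> is included, with both sides \<open>0\<close>, since the rewriting takes
      place under the quantifier over \<open>I\<close>.\<close>
    have pow: "(T / real I) powr (2 * \<alpha> - 1 - (2 * \<alpha> - 3)) = (T / real I)\<^sup>2" for I
    proof -
      have "2 * \<alpha> - 1 - (2 * \<alpha> - 3) = 2" by simp
      then show ?thesis using assms(5) by (cases "I = 0") simp_all
    qed
    show ?E2
      by (rule mean_square_regularization_error[OF assms(1,2,5) q, unfolded pow])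
  qed
qed

end
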